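(* Let $L$ be an infinite lattice with connective constant $\sigma(L)>1$. Then for every $\lambda<\lambda_c(\sigma(L))$ there exists $\delta>0$ (depending on $\lambda$ and $L$) such that the free energy $f_L$ is unique and analytic on $\mathcal{L}_\delta([0,\lambda])$.
   Context: All graphs are locally finite. An infinite lattice is a connected, locally finite, infinite graph $L=(V,E)$ admitting a subgroup $\Gamma$ of its automorphism group with $\Gamma\cong\mathbb{Z}^d$ for some $d\ge1$, acting freely on $V$ (only the identity fixes a vertex) and with finitely many orbits on $V$ (i.e., there is a finite $F\subset V$ with $V=\Gamma F$). A self-avoiding walk (SAW) of length $k$ from $v$ is a walk $v=v_0,\dots,v_k$ with all $v_j$ distinct; $\mathcal{N}_k(L,v)$ is their number, $\sigma_k(L)=\sup_v\mathcal{N}_k(L,v)^{1/k}$, and $\sigma(L)=\limsup_{k\to\infty}\sigma_k(L)$. For $x>1$, $\lambda_c(x)=x^x/(x-1)^{x+1}$. For a real interval $I$ and $\delta>0$, $\mathcal{L}_\delta(I)=\{z\in\mathbb{C}:|z-z_0|\le\delta\text{ for some }z_0\in I\}$. For finite $\Lambda\subset V$, $Z_\Lambda(z)=\sum_I z^{|I|}$ over independent sets $I\subseteq\Lambda$ of $L$. A Følner–van Hove sequence is a sequence of finite sets $\Lambda_n\subset V$ with $|\Lambda_n|\to\infty$ and $|\partial^{(r)}\Lambda_n|/|\Lambda_n|\to0$ for every $r\in\mathbb{N}$, where $\partial^{(r)}S=\{v\in V:\mathrm{dist}(v,S)\le r,\ \mathrm{dist}(v,V\setminus S)\le r\}$.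 "The free energy $f_L$ is unique and analytic on $D$" means: all $Z_\Lambda$ are zero-free on $D$, and for every Følner–van Hove sequence $(\Lambda_n)$ the functions $f_{\Lambda_n}(z)=|\Lambda_n|^{-1}\log Z_{\Lambda_n}(z)$ (the branch of $\log$ continuous on $D$ with value $0$ at $z=0$) converge, uniformly on compact subsets of the interior of $D$, to an analytic function $f_L$ that does not depend on the chosen sequence. *)

theory Defs
  imports "HOL-Analysis.Analysis" "HOL-Library.Liminf_Limsup"
begin

text \<open>A graph is given by an adjacency relation E on the vertex type 'v; the vertex set is UNIV.\<close>

definition Zd :: "nat \<Rightarrow> (nat \<Rightarrow> int) set" where
  "Zd d = {g. \<forall>i\<ge>d. g i = 0}"

definition lattice_action :: "('v \<Rightarrow> 'v \<Rightarrow> bool) \<Rightarrow> nat \<Rightarrow> ((nat \<Rightarrow> int) \<Rightarrow> 'v \<Rightarrow> 'v) \<Rightarrow> bool" where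
  "lattice_action E d act \<longleftrightarrow>
     1 \<le> d \<and>
     (\<forall>g\<in>Zd d. bij (act g) \<and> (\<forall>u v. E u v \<longleftrightarrow> E (act g u) (act g v))) \<and>
     act (\<lambda>_. 0) = id \<and>
     (\<forall>g\<in>Zd d. \<forall>h\<in>Zd d. act (\<lambda>i. g i + h i) = act g \<circ> act h) \<and>
     (\<forall>g\<in>Zd d. \<forall>v. act g v = v \<longrightarrow> g = (\<lambda>_. 0)) \<and>
     (\<exists>F. finite F \<and> (\<forall>v. \<exists>g\<in>Zd d. \<exists>u\<in>F. v = act g u))"

definition infinite_lattice :: "('v \<Rightarrow> 'v \<Rightarrow> bool) \<Rightarrow> bool" where
  "infinite_lattice E \<longleftrightarrow>
     (\<forall>u v. E u v \<longrightarrow> E v u) \<and> (\<forall>v. \<not> E v v) \<and>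
     (\<forall>v. finite {u. E v u}) \<and>
     (\<forall>u v. E\<^sup>*\<^sup>* u v) \<and>
     infinite (UNIV :: 'v set) \<and>
     (\<exists>d act. lattice_action E d act)"

definition saws :: "('v \<Rightarrow> 'v \<Rightarrow> bool) \<Rightarrow> nat \<Rightarrow> 'v \<Rightarrow> 'v list set" where
  "saws E k v = {p. length p = Suc k \<and> hd p = v \<and> distinct p \<and> (\<forall>i<k. E (p ! i) (p ! Suc i))}"

definition num_saws :: "('v \<Rightarrow> 'v \<Rightarrow> bool) \<Rightarrow> nat \<Rightarrow> 'v \<Rightarrow> nat" where
  "num_saws E k v = card (saws E k v)"

definition sigma_k :: "('v \<Rightarrow> 'v \<Rightarrow> bool) \<Rightarrow> nat \<Rightarrow> ereal" where
  "sigma_k E k = (SUP v. ereal (root k (real (num_saws E k v))))"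

definition connective_constant :: "('v \<Rightarrow> 'v \<Rightarrow> bool) \<Rightarrow> ereal" where
  "connective_constant E = limsup (\<lambda>k. sigma_k E k)"

definition lambda_c :: "real \<Rightarrow> real" where
  "lambda_c x = x powr x / (x - 1) powr (x + 1)"

definition nbhd_interval :: "real \<Rightarrow> real \<Rightarrow> complex set" where
  "nbhd_interval lam \<delta> = {z. \<exists>t\<in>{0..lam}. cmod (z - complex_of_real t) \<le> \<delta>}"

definition indep_sets :: "('v \<Rightarrow> 'v \<Rightarrow> bool) \<Rightarrow> 'v set \<Rightarrow> 'v set set" where
  "indep_sets E \<Lambda> = {I. I \<subseteq> \<Lambda> \<and> (\<forall>a\<in>I. \<forall>b\<in>I. \<not> E a b)}"

definition Zpoly :: "('v \<Rightarrow> 'v \<Rightarrow> bool) \<Rightarrow> 'v set \<Rightarrow> complex \<Rightarrow> complex" where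
  "Zpoly E \<Lambda> z = (\<Sum>I\<in>indep_sets E \<Lambda>. z ^ card I)"

definition log_branch :: "complex set \<Rightarrow> (complex \<Rightarrow> complex) \<Rightarrow> complex \<Rightarrow> complex" where
  "log_branch D h = (SOME g. continuous_on D g \<and> (\<forall>z\<in>D. exp (g z) = h z) \<and> g 0 = 0)"

definition finite_free_energy :: "('v \<Rightarrow> 'v \<Rightarrow> bool) \<Rightarrow> complex set \<Rightarrow> 'v set \<Rightarrow> complex \<Rightarrow> complex" where
  "finite_free_energy E D \<Lambda> z = log_branch D (Zpoly E \<Lambda>) z / of_nat (card \<Lambda>)"

definition near :: "('v \<Rightarrow> 'v \<Rightarrow> bool) \<Rightarrow> nat \<Rightarrow> 'v \<Rightarrow> 'v set \<Rightarrow> bool" where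
  "near E r v S \<longleftrightarrow> (\<exists>u\<in>S. \<exists>k\<le>r. (E ^^ k) v u)"

definition bdry :: "('v \<Rightarrow> 'v \<Rightarrow> bool) \<Rightarrow> nat \<Rightarrow> 'v set \<Rightarrow> 'v set" where
  "bdry E r S = {v. near E r v S \<and> near E r v (- S)}"

definition folner_van_hove :: "('v \<Rightarrow> 'v \<Rightarrow> bool) \<Rightarrow> (nat \<Rightarrow> 'v set) \<Rightarrow> bool" where
  "folner_van_hove E \<Lambda> \<longleftrightarrow>
     (\<forall>n. finite (\<Lambda> n)) \<and>
     filterlim (\<lambda>n. card (\<Lambda> n)) at_top sequentially \<and>
     (\<forall>r. (\<lambda>n. real (card (bdry E r (\<Lambda> n))) / real (card (\<Lambda> n))) \<longlonglongrightarrow> 0)"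

definition free_energy_unique_analytic :: "('v \<Rightarrow> 'v \<Rightarrow> bool) \<Rightarrow> complex set \<Rightarrow> bool" where
  "free_energy_unique_analytic E D \<longleftrightarrow>
     (\<forall>\<Lambda>. finite \<Lambda> \<longrightarrow> (\<forall>z\<in>D. Zpoly E \<Lambda> z \<noteq> 0)) \<and>
     (\<exists>f. f analytic_on interior D \<and>
        (\<forall>\<Lambda>s. folner_van_hove E \<Lambda>s \<longrightarrow>
           (\<forall>K. compact K \<and> K \<subseteq> interior D \<longrightarrow>
              uniform_limit K (\<lambda>n. finite_free_energy E D (\<Lambda>s n)) f sequentially)))"

end

theory Submission
  imports Defs "HOL-Complex_Analysis.Complex_Analysis"
begin

text \<open>
  Put \<open>z = s\<^sup>2\<close> and write the occupation ratio \<open>z Z(\<Lambda> - N[v]) / Z(\<Lambda> - v)\<close> as \<open>sinh\<^sup>2 u\<close>. Removing the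
  neighbours of \<open>v\<close> one at a time gives \<open>sinh u = s \<Prod>\<^sub>i 1 / cosh u\<^sub>i\<close>, where the \<open>u\<^sub>i\<close> belong to the neighbours
  of \<open>v\<close> in shrinking domains; the partial derivatives are \<open>- tanh u tanh u\<^sub>i\<close>. For \<open>0 \<le> z < \<lambda>\<^sub>c(\<sigma>)\<close> real,
  Hoelder's inequality with a suitable exponent \<open>q\<close> shows that this recursion satisfies
  \<open>|\<delta>u|\<^sup>q \<le> \<kappa>\<^sup>q \<Sum>\<^sub>i |\<delta>u\<^sub>i|\<^sup>q\<close> with \<open>\<kappa>\<^sup>q \<sigma> < 1\<close>. The branches of the recursion tree are self-avoiding
  walks, so for \<open>\<kappa>\<^sup>q < c < 1/\<sigma>\<close> the weights \<open>w = \<Sum>\<^sub>j c\<^sup>j #{walks of length j}\<close> are bounded and satisfy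
  \<open>c \<Sum>\<^sub>i w\<^sub>i \<le> w\<close>. Hence \<open>|\<delta>u| \<le> \<epsilon> w\<^bsup>1/q\<^esup>\<close> propagates up the tree: complex messages stay close to real ones,
  which gives zero-freeness, and the influence of distant vertices decays exponentially. The derivative
  of \<open>log Z\<close> is the sum over \<open>v\<close> of the local densities \<open>Z(\<Lambda> - N[v]) / Z(\<Lambda>)\<close>, which converge uniformly as
  \<open>\<Lambda>\<close> grows to limits depending only on the orbit of \<open>v\<close>; a Foelner sequence meets all orbits equally often.
\<close>


section \<open>The real contraction inequality\<close>

text \<open>The variable \<open>u\<close> is chosen for symmetry: the square of
  \<open>tanh u * tanh u\<^sub>i\<close> is a product of two occupation probabilities
  \<open>x / (1 + x)\<close>. The obstacle is that \<sigma> is only a growth rate of walks, in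
  general neither an integer nor the branching number at any vertex. So the one-step inequality must
  hold for any number of children with arbitrary real messages, with a constant just below
  \<open>\<sigma> powr (-1/q)\<close>. This dictates the exponent: the symmetric fixed point of the
  \<sigma>-ary tree at \<open>lambda_c \<sigma>\<close> has to be an equality case of every
  inequality used, and then each smaller activity gains a factor below 1. Near the real axis the
  real contraction is merely perturbed, with an error linear in the distance \<eta> from real
  messages; the constants can be crude because \<delta> may depend on the graph. All estimates are
  pointwise in a square root \<open>s\<close> of \<open>z\<close>, so the branch point at 0 does no
  harm: holomorphy in \<open>z\<close> is always inherited from partition functions, which are
  polynomials.\<close>

lemma Holder_sum:
  fixes a b :: "'i \<Rightarrow> real"
  assumes "finite I" "p > 1" "q > 1" "1/p + 1/q = 1"
    and "\<And>i. i \<in> I \<Longrightarrow> a i \<ge> 0" "\<And>i. i \<in> I \<Longrightarrow> b i \<ge> 0"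
  shows "(\<Sum>i\<in>I. a i * b i) \<le> (\<Sum>i\<in>I. a i powr p) powr (1/p) * (\<Sum>i\<in>I. b i powr q) powr (1/q)"
proof -
  define A where "A = (\<Sum>i\<in>I. a i powr p)"
  define B where "B = (\<Sum>i\<in>I. b i powr q)"
  have A0: "A \<ge> 0" and B0: "B \<ge> 0" unfolding A_def B_def by (auto intro: sum_nonneg)
  show ?thesis
  proof (cases "A = 0 \<or> B = 0")
    case True
    then have "\<forall>i\<in>I. a i * b i = 0"
      using assms(1) by (auto simp: A_def B_def sum_nonneg_eq_0_iff)
    then have "(\<Sum>i\<in>I. a i * b i) = 0" by (intro sum.neutral) auto
    then show ?thesis by simp
  next
    case False
    then have pos: "A > 0" "B > 0" using A0 B0 by auto
    define \<alpha> where "\<alpha> = A powr (1/p)"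
    define \<gamma> where "\<gamma> = B powr (1/q)"
    have p0: "\<alpha> > 0" "\<gamma> > 0" using pos by (auto simp: \<alpha>_def \<gamma>_def)
    have pw: "\<alpha> powr p = A" "\<gamma> powr q = B"
      using pos assms(2,3) by (auto simp: \<alpha>_def \<gamma>_def powr_powr)
    have "(\<Sum>i\<in>I. (a i / \<alpha>) * (b i / \<gamma>)) \<le> (\<Sum>i\<in>I. (a i / \<alpha>) powr p / p + (b i / \<gamma>) powr q / q)"
      using assms p0 by (intro sum_mono Youngs_inequality) auto
    also have "\<dots> = (\<Sum>i\<in>I. a i powr p) / A / p + (\<Sum>i\<in>I. b i powr q) / B / q"
      using assms p0 by (simp add: powr_divide pw sum.distrib sum_divide_distrib)
    also have "\<dots> = 1"
      using pos assms(4) by (simp add: A_def[symmetric] B_def[symmetric])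
    finally have "(\<Sum>i\<in>I. a i * b i) / (\<alpha> * \<gamma>) \<le> 1"
      by (simp add: sum_divide_distrib)
    then show ?thesis using p0 by (simp add: \<alpha>_def \<gamma>_def A_def B_def field_simps)
  qed
qed

text \<open>Convexity of \<open>exp\<close> between 0 and \<open>t\<close>. It decides the sign of
  the derivative of \<open>h\<close> on either side of \<open>L\<close> in the next lemma.\<close>

lemma exp_secant_mono:
  fixes s t :: real
  assumes "0 < s" "s \<le> t"
  shows "(exp s - 1) * t \<le> (exp t - 1) * s"
proof -
  have "exp ((1 - s/t) *\<^sub>R 0 + (s/t) *\<^sub>R t) \<le> (1 - s/t) * exp 0 + (s/t) * exp t"
    using assms by (intro convex_onD[OF exp_convex]) auto
  then have "exp s \<le> 1 - s/t + (s/t) * exp t" using assms by simp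
  then have "exp s * t \<le> (1 - s/t + (s/t) * exp t) * t" using assms by (intro mult_right_mono) auto
  also have "\<dots> = t - s + s * exp t" using assms by (simp add: field_simps)
  finally show ?thesis by (simp add: algebra_simps)
qed

text \<open>The exponent \<open>\<beta>\<close> makes this bound tight at \<open>t = L\<close>, which is \<open>ln (1 + x)\<close> for the critical fixed point \<open>x = 1 / (\<sigma> - 1)\<close>
of the recursion on the \<open>\<sigma>\<close>-ary tree; the companion bound \<open>critical_occupation_bound\<close> is tight at \<open>T = \<sigma> L\<close>.\<close>

lemma one_minus_exp_powr_le:
  fixes \<sigma> t :: real
  defines "L \<equiv> ln (\<sigma> / (\<sigma> - 1))"
  defines "\<beta> \<equiv> 1 / ((\<sigma> - 1) * L)"
  assumes s: "\<sigma> > 1" and t: "t \<ge> 0"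
  shows "(1 - exp (-t)) powr \<beta> \<le> \<sigma> powr (-\<beta>) * t / L"
proof (cases "t = 0")
  case False
  then have t0: "t > 0" using t by simp
  have L0: "L > 0" unfolding L_def using s by (intro ln_gt_zero) (simp add: field_simps)
  have eL: "exp L = \<sigma> / (\<sigma> - 1)" using s by (simp add: L_def)
  have b0: "\<beta> > 0" using L0 s by (simp add: \<beta>_def)
  \<comment> \<open>Up to a positive factor and an additive constant, \<open>h\<close> is the
    logarithm of the right side over the left side, so the claim is that \<open>h\<close> is minimal
    at \<open>L\<close>.\<close>
  define h where "h = (\<lambda>t. (\<sigma> - 1) * L * ln t - ln (1 - exp (-t)))"
  have der: "(h has_real_derivative ((\<sigma> - 1) * L / x - exp (-x) / (1 - exp (-x)))) (at x)" if "x > 0" for x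
    unfolding h_def using that by (auto intro!: derivative_eq_intros simp: divide_simps)
  have sgn: "(\<sigma> - 1) * L / x - exp (-x) / (1 - exp (-x)) = ((\<sigma> - 1) * L * (exp x - 1) - x) / (x * (exp x - 1))"
    if "x > 0" for x
  proof -
    have "exp (-x) / (1 - exp (-x)) = 1 / (exp x - 1)"
      using that by (simp add: exp_minus field_simps)
    then show ?thesis using that by (simp add: field_simps)
  qed
  have "h L \<le> h t"
  proof (cases "L \<le> t")
    case True
    show ?thesis
    proof (rule DERIV_nonneg_imp_nondecreasing[OF True])
      fix x assume x: "L \<le> x" "x \<le> t"
      then have "x > 0" using L0 by simp
      have "(exp L - 1) * x \<le> (exp x - 1) * L" using x L0 by (intro exp_secant_mono) auto
      then have "x \<le> (\<sigma> - 1) * L * (exp x - 1)" using s by (simp add: eL field_simps)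
      then have "0 \<le> ((\<sigma> - 1) * L * (exp x - 1) - x) / (x * (exp x - 1))" using \<open>x>0\<close> by simp
      then show "\<exists>y. (h has_real_derivative y) (at x) \<and> 0 \<le> y" using der sgn \<open>x>0\<close> by metis
    qed
  next
    case False
    then have F: "t \<le> L" by simp
    show ?thesis
    proof (rule DERIV_nonpos_imp_nonincreasing[OF F])
      fix x assume x: "t \<le> x" "x \<le> L"
      then have "x > 0" using t0 by simp
      have "(exp x - 1) * L \<le> (exp L - 1) * x" using x \<open>x>0\<close> by (intro exp_secant_mono) auto
      then have "(\<sigma> - 1) * L * (exp x - 1) \<le> x" using s by (simp add: eL field_simps)
      then have "((\<sigma> - 1) * L * (exp x - 1) - x) / (x * (exp x - 1)) \<le> 0" using \<open>x>0\<close>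
        by (simp add: divide_nonpos_pos)
      then show "\<exists>y. (h has_real_derivative y) (at x) \<and> y \<le> 0" using der sgn \<open>x>0\<close> by metis
    qed
  qed
  moreover have "1 - exp (-L) = 1/\<sigma>" using s by (simp add: exp_minus eL field_simps)
  ultimately have "(\<sigma> - 1) * L * ln L + ln \<sigma> \<le> (\<sigma> - 1) * L * ln t - ln (1 - exp (-t))"
    using s by (simp add: h_def ln_div)
  then have "ln (1 - exp (-t)) \<le> (\<sigma> - 1) * L * (ln t - ln L) - ln \<sigma>" by (simp add: algebra_simps)
  then have "\<beta> * ln (1 - exp (-t)) \<le> \<beta> * ((\<sigma> - 1) * L * (ln t - ln L) - ln \<sigma>)"
    using b0 by (intro mult_left_mono) auto
  also have "\<dots> = ln t - ln L - \<beta> * ln \<sigma>" using s L0 by (simp add: \<beta>_def right_diff_distrib)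
  finally have "exp (\<beta> * ln (1 - exp (-t))) \<le> exp (ln t - ln L - \<beta> * ln \<sigma>)" by simp
  also have "\<dots> = \<sigma> powr (-\<beta>) * t / L" using t0 L0 s by (simp add: exp_diff exp_add powr_def exp_minus field_simps)
  finally show ?thesis using t0 by (simp add: powr_def)
qed simp

text \<open>\<open>T\<close> stands for the sum of \<open>ln (1 + x\<^sub>i)\<close> over the
  children, and the fraction is the occupation probability of the root at critical activity. Two
  bounds are added: convexity of \<open>exp\<close> between 0 and
  \<open>D = T - \<sigma> * L\<close>, and \<open>ln y \<le> y - 1\<close> for
  \<open>y = T / (\<sigma> * L)\<close>. With this \<beta> their linear terms in \<open>T\<close>
  cancel.\<close>

lemma critical_occupation_bound:
  fixes \<sigma> T :: real
  defines "L \<equiv> ln (\<sigma> / (\<sigma> - 1))"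
  defines "\<beta> \<equiv> 1 / ((\<sigma> - 1) * L)"
  assumes s: "\<sigma> > 1" and T: "T \<ge> 0"
  shows "T * (lambda_c \<sigma> * exp (-T) / (1 + lambda_c \<sigma> * exp (-T))) powr \<beta> \<le> L * \<sigma> powr (1 - \<beta>)"
proof (cases "T = 0")
  case True
  have "L > 0" unfolding L_def using s by (intro ln_gt_zero) (simp add: field_simps)
  then show ?thesis using True by simp
next
  case False
  then have T0: "T > 0" using T by simp
  have L0: "L > 0" unfolding L_def using s by (intro ln_gt_zero) (simp add: field_simps)
  have b0: "\<beta> > 0" using L0 s by (simp add: \<beta>_def)
  define D where "D = T - \<sigma> * L"
  \<comment> \<open>With \<open>x = 1 / (\<sigma> - 1)\<close> one has \<open>1 + x = exp L\<close>,
    and the critical activity is \<open>x * (1 + x) powr \<sigma>\<close>, the one for which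
    \<open>x\<close> is the fixed point of the \<sigma>-ary recursion.\<close>
  have lc: "lambda_c \<sigma> = exp (\<sigma> * L) / (\<sigma> - 1)"
  proof -
    have "exp (\<sigma> * L) = (\<sigma> / (\<sigma> - 1)) powr \<sigma>" using s by (simp add: L_def powr_def)
    also have "\<dots> = \<sigma> powr \<sigma> / (\<sigma> - 1) powr \<sigma>" using s by (simp add: powr_divide)
    finally show ?thesis using s by (simp add: lambda_c_def powr_add)
  qed
  have lcT: "lambda_c \<sigma> * exp (-T) = exp (-D) / (\<sigma> - 1)"
    by (simp add: lc D_def exp_diff exp_minus field_simps)
  define p where "p = lambda_c \<sigma> * exp (-T) / (1 + lambda_c \<sigma> * exp (-T))"
  have p: "p = 1 / (1 + (\<sigma> - 1) * exp D)"
  proof -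
    have "(\<sigma> - 1) + exp (-D) > 0" using s by (intro add_pos_pos) auto
    then show ?thesis unfolding p_def lcT using s by (simp add: exp_minus divide_simps) (simp add: algebra_simps)
  qed
  have pos: "1 + (\<sigma> - 1) * exp D > 0" using s by (intro add_pos_pos mult_pos_pos) auto
  have "exp ((1 - (1 - 1/\<sigma>)) *\<^sub>R 0 + (1 - 1/\<sigma>) *\<^sub>R D) \<le> (1 - (1 - 1/\<sigma>)) * exp 0 + (1 - 1/\<sigma>) * exp D"
    using s by (intro convex_onD[OF exp_convex]) (auto simp: field_simps)
  then have "\<sigma> * exp ((1 - 1/\<sigma>) * D) \<le> 1 + (\<sigma> - 1) * exp D" using s by (simp add: field_simps)
  then have "ln (\<sigma> * exp ((1 - 1/\<sigma>) * D)) \<le> ln (1 + (\<sigma> - 1) * exp D)" using s pos by (subst ln_le_cancel_iff) auto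
  then have 1: "ln p \<le> - ln \<sigma> - (1 - 1/\<sigma>) * D" using s pos by (simp add: p ln_div ln_mult)
  have "ln (T / (\<sigma> * L)) \<le> T / (\<sigma> * L) - 1" using T0 s L0 by (intro ln_le_minus_one) auto
  then have 2: "ln T \<le> ln (\<sigma> * L) + T / (\<sigma> * L) - 1" using T0 s L0 by (simp add: ln_div)
  have "\<beta> * ((1 - 1/\<sigma>) * D) = T / (\<sigma> * L) - 1" using s L0 by (simp add: \<beta>_def D_def divide_simps)
  moreover have "\<beta> * ln p \<le> \<beta> * (- ln \<sigma> - (1 - 1/\<sigma>) * D)" using b0 1 by (intro mult_left_mono) auto
  ultimately have "ln T + \<beta> * ln p \<le> ln (\<sigma> * L) - \<beta> * ln \<sigma>" using 2 by (simp add: algebra_simps)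
  then have "exp (ln T + \<beta> * ln p) \<le> exp (ln (\<sigma> * L) - \<beta> * ln \<sigma>)" by simp
  moreover have "p > 0" using pos by (simp add: p)
  ultimately have "T * p powr \<beta> \<le> \<sigma> * L * \<sigma> powr (-\<beta>)"
    using T0 s L0 by (simp add: exp_add exp_diff powr_def exp_minus field_simps)
  also have "\<dots> = L * \<sigma> powr (1 - \<beta>)" using s by (simp add: powr_diff powr_minus field_simps)
  finally show ?thesis by (simp add: p_def)
qed

lemma lambda_c_pos: "\<sigma> > 1 \<Longrightarrow> lambda_c \<sigma> > 0"
  by (simp add: lambda_c_def)

text \<open>\<open>w\<close> is \<open>sinh\<close> of the root's message and
  \<open>w / sqrt (1 + w\<^sup>2)\<close> its \<open>tanh\<close>, so the left side is the
  first-order change of the root's message under changes of size \<open>e i\<close> at the children.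
  The index sets consist of naturals because children will be numbered by their position in a list
  of neighbours.\<close>

definition contractive :: "real \<Rightarrow> real \<Rightarrow> real \<Rightarrow> bool" where
  "contractive q \<kappa> S \<longleftrightarrow>
    (\<forall>(I::nat set) r e s. finite I \<longrightarrow> (\<forall>i\<in>I. r i \<ge> 0 \<and> e i \<ge> 0) \<longrightarrow> 0 \<le> s \<longrightarrow> s \<le> S \<longrightarrow>
      (let w = s * (\<Prod>i\<in>I. inverse (cosh (r i))) in
       w / sqrt (1 + w\<^sup>2) * (\<Sum>i\<in>I. tanh (r i) * e i) \<le> \<kappa> * (\<Sum>i\<in>I. e i powr q) powr (1/q)))"

text \<open>Hoelder with the conjugate exponents \<open>a = 2 * \<beta>\<close> and \<open>q\<close>
  leaves the sum of \<open>(tanh u * tanh (r i)) powr a\<close>, in which each term is a product of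
  two occupation probabilities to the power \<beta>. The two preceding bounds multiply to
  \<open>\<sigma> powr (1 - a)\<close> at criticality, whose \<open>a\<close>-th root is
  \<open>\<sigma> powr (-1/q)\<close>; being strictly below criticality supplies the extra factor
  \<open>sqrt \<rho>\<close>.\<close>

lemma hardcore_contraction:
  fixes \<sigma> lam :: real
  assumes s: "\<sigma> > 1" and lam: "0 \<le> lam" "lam < lambda_c \<sigma>"
  shows "\<exists>q>1. \<exists>\<kappa>>0. \<kappa> powr q * \<sigma> < 1 \<and> contractive q \<kappa> (sqrt lam)"
proof -
  define L where "L = ln (\<sigma> / (\<sigma> - 1))"
  define \<beta> where "\<beta> = 1 / ((\<sigma> - 1) * L)"
  define lc where "lc = lambda_c \<sigma>"
  \<comment> \<open>Bounds the occupation probability at activity \<open>lam\<close> by \<rho> times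
    the one at \<open>lc\<close>: their quotient increases in \<open>y = exp (-T)\<close>, and the
    second argument of \<open>max\<close> is its value at \<open>y = 1\<close>. The
    \<open>1/2\<close> keeps \<rho> positive when \<open>lam = 0\<close>.\<close>
  define \<rho> where "\<rho> = max (1/2) (lam * (1 + lc) / (lc * (1 + lam)))"
  define a where "a = 2 * \<beta>"
  define q where "q = a / (a - 1)"
  define \<kappa> where "\<kappa> = sqrt \<rho> * \<sigma> powr (-1/q)"
  have lc0: "lc > 0" using s by (simp add: lc_def lambda_c_pos)
  have L0: "L > 0" unfolding L_def using s by (intro ln_gt_zero) (simp add: field_simps)
  have "L \<le> \<sigma> / (\<sigma> - 1) - 1" unfolding L_def using s by (intro ln_le_minus_one) auto
  then have "(\<sigma> - 1) * L \<le> 1" using s by (simp add: field_simps)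
  then have b1: "\<beta> \<ge> 1" using s L0 by (simp add: \<beta>_def field_simps)
  then have a: "a > 1" by (simp add: a_def)
  then have q1: "q > 1" by (simp add: q_def field_simps)
  have aq: "1/a + 1/q = 1" using a by (simp add: q_def field_simps)
  have \<rho>: "0 < \<rho>" "\<rho> < 1"
  proof -
    have "lam * (1 + lc) < 1 * (lc * (1 + lam))" using lam by (simp add: lc_def algebra_simps)
    moreover have "lc * (1 + lam) > 0" using lc0 lam by (intro mult_pos_pos) auto
    ultimately have "lam * (1 + lc) / (lc * (1 + lam)) < 1" by (simp only: pos_divide_less_eq)
    then show "0 < \<rho>" "\<rho> < 1" by (auto simp: \<rho>_def less_max_iff_disj)
  qed
  have \<kappa>0: "\<kappa> > 0" using \<rho> s by (simp add: \<kappa>_def)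
  have "\<kappa> powr q * \<sigma> = sqrt \<rho> powr q"
    using \<rho> s q1 by (simp add: \<kappa>_def powr_mult powr_powr powr_minus powr_divide field_simps)
  also have "\<dots> < 1" using \<rho> q1 powr_less_mono2[of q "sqrt \<rho>" 1] by simp
  finally have \<kappa>q: "\<kappa> powr q * \<sigma> < 1" .
  have main: "w / sqrt (1 + w\<^sup>2) * (\<Sum>i\<in>I. tanh (r i) * e i) \<le> \<kappa> * (\<Sum>i\<in>I. e i powr q) powr (1/q)"
    if I: "finite I" and re: "\<forall>i\<in>I. r i \<ge> 0 \<and> e i \<ge> 0" and s0: "0 \<le> s0" "s0 \<le> sqrt lam"
      and w: "w = s0 * (\<Prod>i\<in>I. inverse (cosh (r i)))" for I :: "nat set" and r e s0 w
  proof -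
    \<comment> \<open>This is \<open>ln (1 + x\<^sub>i)\<close> for the occupation ratio
      \<open>x\<^sub>i = (sinh (r i))\<^sup>2\<close>, so the squared product over the children
      becomes \<open>exp (-T)\<close>.\<close>
    define t where "t = (\<lambda>i. 2 * ln (cosh (r i)))"
    define T where "T = (\<Sum>i\<in>I. t i)"
    have t0: "t i \<ge> 0" for i using cosh_real_ge_1[of "r i"] by (simp add: t_def)
    then have T0: "T \<ge> 0" unfolding T_def by (intro sum_nonneg) auto
    have et: "exp (- t i) = (inverse (cosh (r i)))\<^sup>2" for i
    proof -
      have "exp (- t i) = inverse (exp (ln (cosh (r i)) + ln (cosh (r i))))"
        by (simp add: t_def exp_minus)
      also have "\<dots> = (inverse (cosh (r i)))\<^sup>2"
        unfolding exp_add by (simp add: power2_eq_square)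
      finally show ?thesis .
    qed
    have w0: "w \<ge> 0" using s0 by (auto simp: w intro!: mult_nonneg_nonneg prod_nonneg)
    have w2: "w\<^sup>2 = s0\<^sup>2 * exp (-T)"
      by (simp add: w T_def exp_sum[OF I] sum_negf[symmetric] et power_mult_distrib prod_power_distrib)
    define y where "y = exp (-T)"
    have y: "0 < y" "y \<le> 1" using T0 by (auto simp: y_def)
    have "s0\<^sup>2 \<le> lam" using s0 lam by (metis real_sqrt_le_iff real_sqrt_pow2 power_mono)
    then have w2l: "w\<^sup>2 \<le> lam * y" unfolding w2 y_def by (intro mult_right_mono) auto
    define p where "p = w\<^sup>2 / (1 + w\<^sup>2)"
    define pc where "pc = lc * exp (-T) / (1 + lc * exp (-T))"
    have pc0: "pc \<ge> 0" using lc0 by (simp add: pc_def)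
    have p0: "p \<ge> 0" by (simp add: p_def)
    have "p \<le> lam * y / (1 + lam * y)"
    proof -
      have "0 < 1 + lam * y" "0 < 1 + w\<^sup>2" using lam y by (auto intro!: add_pos_nonneg)
      then show ?thesis unfolding p_def using w2l
        by (simp add: divide_simps) (simp add: algebra_simps)
    qed
    also have "\<dots> \<le> \<rho> * pc"
    proof -
      have "lam * (1 + lc * y) * (lc * (1 + lam)) \<le> (lam * (1 + lc)) * (lc * (1 + lam * y))"
      proof -
        have "(1 + lc * y) * (1 + lam) \<le> (1 + lc) * (1 + lam * y)"
          using mult_right_mono[of y 1 "lc - lam"] lam y by (simp add: lc_def algebra_simps)
        then have "lam * lc * ((1 + lc * y) * (1 + lam)) \<le> lam * lc * ((1 + lc) * (1 + lam * y))"
          using lam lc0 by (intro mult_left_mono) auto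
        then show ?thesis by (simp add: algebra_simps)
      qed
      moreover have P: "lc * (1 + lam) > 0" "1 + lam * y > 0" "1 + lc * y > 0"
        using lc0 lam y by (auto intro!: mult_pos_pos add_pos_nonneg)
      ultimately have "lam * (1 + lc * y) \<le> lam * (1 + lc) * (lc * (1 + lam * y)) / (lc * (1 + lam))"
        by (simp only: pos_le_divide_eq)
      then have "lam * (1 + lc * y) \<le> (lam * (1 + lc) / (lc * (1 + lam))) * (lc * (1 + lam * y))"
        by (simp only: times_divide_eq_left)
      also have "\<dots> \<le> \<rho> * (lc * (1 + lam * y))"
        using lc0 P by (intro mult_right_mono) (auto simp: \<rho>_def)
      finally have "lam * (1 + lc * y) * y \<le> \<rho> * (lc * (1 + lam * y)) * y"
        using y by (intro mult_right_mono) auto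
      then have "lam * y * (1 + lc * y) \<le> \<rho> * (lc * y) * (1 + lam * y)"
        by (simp add: algebra_simps)
      then show ?thesis using P unfolding pc_def y_def[symmetric] by (simp add: divide_simps)
    qed
    finally have pp: "p \<le> \<rho> * pc" .
    \<comment> \<open>The occupation probability of child \<open>i\<close> in its own subtree, equal
      to the square of \<open>tanh (r i)\<close>; the name shadows the constant
      \<open>pi\<close>.\<close>
    define pi where "pi = (\<lambda>i. 1 - exp (- t i))"
    have pi0: "pi i \<ge> 0" for i using t0[of i] by (simp add: pi_def)
    have tanh2: "(tanh (r i))\<^sup>2 = pi i" for i
    proof -
      have "(cosh (r i))\<^sup>2 > 0" by simp
      then have "pi i = ((cosh (r i))\<^sup>2 - 1) / (cosh (r i))\<^sup>2" unfolding pi_def et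
        by (simp add: field_simps)
      also have "\<dots> = (tanh (r i))\<^sup>2" by (simp add: tanh_def cosh_square_eq power_divide)
      finally show ?thesis by simp
    qed
    have tau2: "(w / sqrt (1 + w\<^sup>2))\<^sup>2 = p" by (simp add: p_def power_divide)
    have pw: "x powr a = (x\<^sup>2) powr \<beta>" if "x \<ge> 0" for x :: real
    proof -
      have "x powr a = (x powr 2) powr \<beta>" by (simp add: a_def powr_powr)
      also have "x powr 2 = x\<^sup>2" using that by simp
      finally show ?thesis .
    qed
    define \<tau> where "\<tau> = w / sqrt (1 + w\<^sup>2)"
    have \<tau>0: "\<tau> \<ge> 0" using w0 by (simp add: \<tau>_def)
    have S: "(\<Sum>i\<in>I. (\<tau> * tanh (r i)) powr a) = p powr \<beta> * (\<Sum>i\<in>I. pi i powr \<beta>)"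
      using re \<tau>0 by (simp add: sum_distrib_left powr_mult pw tanh2 tau2 flip: \<tau>_def)
        (simp add: \<tau>_def tau2)
    have "(\<Sum>i\<in>I. pi i powr \<beta>) \<le> (\<Sum>i\<in>I. \<sigma> powr (-\<beta>) * t i / L)"
      unfolding pi_def \<beta>_def L_def by (intro sum_mono one_minus_exp_powr_le s t0)
    also have "\<dots> = \<sigma> powr (-\<beta>) * T / L" by (simp add: T_def sum_distrib_left sum_divide_distrib)
    finally have "p powr \<beta> * (\<Sum>i\<in>I. pi i powr \<beta>) \<le> p powr \<beta> * (\<sigma> powr (-\<beta>) * T / L)"
      by (intro mult_left_mono) auto
    also have "\<dots> \<le> (\<rho> * pc) powr \<beta> * (\<sigma> powr (-\<beta>) * T / L)"
      using pp p0 b1 T0 L0 by (intro mult_right_mono powr_mono2) auto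
    also have "\<dots> = \<rho> powr \<beta> * \<sigma> powr (-\<beta>) / L * (T * pc powr \<beta>)"
      using \<rho> pc0 by (simp add: powr_mult)
    also have "\<dots> \<le> \<rho> powr \<beta> * \<sigma> powr (-\<beta>) / L * (L * \<sigma> powr (1 - \<beta>))"
      using critical_occupation_bound[OF s T0] L0 unfolding pc_def lc_def L_def[symmetric] \<beta>_def[symmetric]
      by (intro mult_left_mono) auto
    also have "\<dots> = \<rho> powr \<beta> * \<sigma> powr (1 - a)" using L0 s by (simp add: a_def powr_add[symmetric])
    finally have S2: "(\<Sum>i\<in>I. (\<tau> * tanh (r i)) powr a) \<le> \<rho> powr \<beta> * \<sigma> powr (1 - a)"
      by (simp only: S)
    have "\<tau> * (\<Sum>i\<in>I. tanh (r i) * e i) = (\<Sum>i\<in>I. (\<tau> * tanh (r i)) * e i)"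
      by (simp add: sum_distrib_left mult.assoc)
    also have "\<dots> \<le> (\<Sum>i\<in>I. (\<tau> * tanh (r i)) powr a) powr (1/a) * (\<Sum>i\<in>I. e i powr q) powr (1/q)"
      using I a q1 aq \<tau>0 re by (intro Holder_sum) auto
    also have "\<dots> \<le> (\<rho> powr \<beta> * \<sigma> powr (1 - a)) powr (1/a) * (\<Sum>i\<in>I. e i powr q) powr (1/q)"
      using S2 a by (intro mult_right_mono powr_mono2) (auto intro: sum_nonneg)
    also have "(\<rho> powr \<beta> * \<sigma> powr (1 - a)) powr (1/a) = \<kappa>"
    proof -
      have "1/q = (a - 1)/a" using a by (simp add: q_def)
      then have "(1 - a) / a = -1/q" using a by (simp add: field_simps)
      moreover have "\<beta> / a = 1/2" using b1 by (simp add: a_def)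
      ultimately show ?thesis using \<rho> s
        by (simp add: \<kappa>_def powr_mult powr_powr powr_half_sqrt)
    qed
    finally show ?thesis by (simp add: \<tau>_def)
  qed
  show ?thesis
    using q1 \<kappa>0 \<kappa>q main by (intro exI[of _ q] exI[of _ \<kappa>] conjI) (auto simp: contractive_def Let_def)
qed

section \<open>Hyperbolic functions near the real axis\<close>

text \<open>The half-width \<open>1/2\<close> is below pi/3, so the cosine of the imaginary part is
  at least \<open>1/2\<close> and \<open>cosh\<close> stays away from its zeros. The same strip also
  serves for \<open>w = sinh u\<close>: there \<open>1 + w\<^sup>2\<close> lies in the right
  half-plane, off the cut of \<open>csqrt\<close>.\<close>

definition strip :: "complex set" where "strip = {z. \<bar>Im z\<bar> \<le> 1/2}"

lemma strip_alt: "strip = {z. Im z \<le> 1/2} \<inter> {z. Im z \<ge> -1/2}"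
  by (auto simp: strip_def)

lemma convex_strip: "convex strip"
  unfolding strip_alt by (intro convex_Int convex_halfspace_Im_le convex_halfspace_Im_ge)

lemma of_real_in_strip [simp]: "complex_of_real x \<in> strip"
  by (simp add: strip_def)

lemma near_real_in_strip:
  assumes "cmod (z - of_real x) \<le> 1/2" shows "z \<in> strip"
  using abs_Im_le_cmod[of "z - of_real x"] assms by (simp add: strip_def)

lemma Re_cosh_ge: assumes "z \<in> strip" shows "Re (cosh z) \<ge> 1/2"
proof -
  have "cos (1/2::real) \<ge> cos (pi/3)" using pi_gt3 by (intro cos_monotone_0_pi_le) auto
  moreover have "cos \<bar>Im z\<bar> \<ge> cos (1/2)" using assms pi_gt3 unfolding strip_def
    by (intro cos_monotone_0_pi_le) auto
  ultimately have c: "cos (Im z) \<ge> 1/2" by (simp add: cos_60)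
  have "Re (cosh z) = cosh (Re z) * cos (Im z)"
    by (simp add: cosh_field_def Re_exp exp_minus[symmetric] algebra_simps add_divide_distrib)
  also have "\<dots> \<ge> 1 * (1/2)" using c cosh_real_ge_1[of "Re z"] by (intro mult_mono) auto
  finally show ?thesis by simp
qed

lemma cosh_strip_nz: assumes "z \<in> strip" shows "cosh z \<noteq> 0"
  using Re_cosh_ge[OF assms] by auto

lemma norm_sech_le: assumes "z \<in> strip" shows "norm (inverse (cosh z)) \<le> 2"
proof -
  have "norm (cosh z) \<ge> 1/2" using Re_cosh_ge[OF assms] complex_Re_le_cmod[of "cosh z"] by linarith
  then show ?thesis using le_imp_inverse_le[of "1/2" "norm (cosh z)"] by (simp add: norm_inverse)
qed

lemma norm_tanh_le: assumes "z \<in> strip" shows "norm (tanh z) \<le> 3"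
proof -
  have nz: "cosh z \<noteq> 0" by (rule cosh_strip_nz[OF assms])
  have "(tanh z)\<^sup>2 = 1 - (inverse (cosh z))\<^sup>2"
    using nz by (simp add: tanh_def sinh_square_eq field_simps)
  then have "norm (tanh z) ^ 2 \<le> 1 + norm (inverse (cosh z)) ^ 2"
    by (metis norm_one norm_power norm_triangle_ineq4)
  also have "\<dots> \<le> 1 + 2^2" using norm_sech_le[OF assms] by (intro add_left_mono power_mono) auto
  finally have "norm (tanh z) ^ 2 \<le> 3^2" by simp
  then show ?thesis by (rule power2_le_imp_le) simp
qed

lemma sech_lipschitz:
  assumes "z \<in> strip" "z' \<in> strip"
  shows "norm (inverse (cosh z) - inverse (cosh z')) \<le> 6 * norm (z - z')"
proof (rule field_differentiable_bound[OF convex_strip _ _ assms])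
  fix x assume x: "x \<in> strip"
  show "((\<lambda>x. inverse (cosh x)) has_field_derivative (- tanh x * inverse (cosh x))) (at x within strip)"
    using cosh_strip_nz[OF x] by (auto intro!: derivative_eq_intros simp: tanh_def field_simps)
  show "norm (- tanh x * inverse (cosh x)) \<le> 6"
    using mult_mono[OF norm_tanh_le[OF x] norm_sech_le[OF x]] by (simp add: norm_mult)
qed

lemma tanh_lipschitz:
  assumes "z \<in> strip" "z' \<in> strip"
  shows "norm (tanh z - tanh z') \<le> 4 * norm (z - z')"
proof (rule field_differentiable_bound[OF convex_strip _ _ assms])
  fix x assume x: "x \<in> strip"
  have nz: "cosh x \<noteq> 0" by (rule cosh_strip_nz[OF x])
  have "1 - (tanh x)\<^sup>2 = (inverse (cosh x))\<^sup>2" using nz by (simp add: tanh_def sinh_square_eq field_simps)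
  then show "(tanh has_field_derivative (inverse (cosh x))\<^sup>2) (at x within strip)"
    using nz by (auto intro!: derivative_eq_intros)
  show "norm ((inverse (cosh x))\<^sup>2) \<le> 4"
    using power_mono[OF norm_sech_le[OF x], of 2] by (simp add: norm_power)
qed

lemma Re_one_plus_sq: assumes "w \<in> strip" shows "Re (1 + w\<^sup>2) \<ge> 3/4"
proof -
  have "\<bar>Im w\<bar>\<^sup>2 \<le> (1/2)\<^sup>2" using assms unfolding strip_def by (intro power_mono) auto
  then have "Im w * Im w \<le> 1/4" by (simp add: power2_eq_square)
  moreover have "Re (1 + w\<^sup>2) = 1 + (Re w * Re w - Im w * Im w)" by (simp add: power2_eq_square)
  ultimately show ?thesis using zero_le_square[of "Re w"] by linarith
qed

lemma norm_inverse_csqrt_le: assumes "w \<in> strip" shows "norm (inverse (csqrt (1 + w\<^sup>2))) \<le> 2"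
proof -
  \<comment> \<open>The bound \<open>3/4\<close> is weakened to \<open>1/4\<close>, whose square
    root is rational.\<close>
  have "norm (1 + w\<^sup>2) \<ge> 1/4" using Re_one_plus_sq[OF assms] complex_Re_le_cmod[of "1 + w\<^sup>2"] by linarith
  then have "sqrt (norm (1 + w\<^sup>2)) \<ge> sqrt (1/4)" by (simp only: real_sqrt_le_iff)
  moreover have "sqrt (1/4::real) = 1/2" by (simp add: real_sqrt_divide)
  ultimately have "norm (csqrt (1 + w\<^sup>2)) \<ge> 1/2" by (simp add: norm_csqrt)
  then show ?thesis using le_imp_inverse_le[of "1/2" "norm (csqrt (1 + w\<^sup>2))"] by (simp add: norm_inverse)
qed

lemma one_plus_sq_nonpos: assumes "w \<in> strip" shows "1 + w\<^sup>2 \<notin> \<real>\<^sub>\<le>\<^sub>0"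
  using Re_one_plus_sq[OF assms] by (auto simp: complex_nonpos_Reals_iff)

lemma csqrt_one_plus_sq_nz: assumes "w \<in> strip" shows "csqrt (1 + w\<^sup>2) \<noteq> 0"
  using one_plus_sq_nonpos[OF assms] by auto

text \<open>The map expresses \<open>tanh\<close> through \<open>sinh\<close>. Its derivative is the
  cube of \<open>inverse (csqrt (1 + x\<^sup>2))\<close>, whence \<open>8 = 2 ^ 3\<close>.\<close>

lemma psi_lipschitz:
  assumes "z \<in> strip" "z' \<in> strip"
  shows "norm (z / csqrt (1 + z\<^sup>2) - z' / csqrt (1 + z'\<^sup>2)) \<le> 8 * norm (z - z')"
proof (rule field_differentiable_bound[OF convex_strip _ _ assms])
  fix x assume x: "x \<in> strip"
  define r where "r = csqrt (1 + x\<^sup>2)"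
  have nz: "r \<noteq> 0" unfolding r_def by (rule csqrt_one_plus_sq_nz[OF x])
  have r2: "r\<^sup>2 = 1 + x\<^sup>2" by (simp add: r_def)
  have "(r - x * (x / r)) / (r * r) = inverse r ^ 3" using nz r2
    by (simp add: divide_simps power2_eq_square power3_eq_cube) 
  then show "((\<lambda>x. x / csqrt (1 + x\<^sup>2)) has_field_derivative (inverse r ^ 3)) (at x within strip)"
    using nz one_plus_sq_nonpos[OF x] unfolding r_def
    by (auto intro!: derivative_eq_intros simp: field_simps)
  show "norm (inverse r ^ 3) \<le> 8"
    using power_mono[OF norm_inverse_csqrt_le[OF x], of 3] by (simp add: norm_power r_def)
qed

section \<open>The complex inverse hyperbolic sine\<close>

lemma arsinh_complex: "arsinh w = Ln (w + csqrt (1 + w\<^sup>2))" for w :: complex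
  by (simp add: arsinh_def csqrt_conv_powr add.commute)

lemma arsinh_arg_nz: "w + csqrt (1 + w\<^sup>2) \<noteq> 0" for w :: complex
proof
  assume "w + csqrt (1 + w\<^sup>2) = 0"
  then have "(csqrt (1 + w\<^sup>2))\<^sup>2 = (- w)\<^sup>2" by (metis add_eq_0_iff)
  then show False by simp
qed

lemma exp_arsinh: "exp (arsinh w) = w + csqrt (1 + w\<^sup>2)" for w :: complex
  by (simp add: arsinh_complex arsinh_arg_nz)

lemma exp_minus_arsinh: "exp (- arsinh w) = csqrt (1 + w\<^sup>2) - w" for w :: complex
proof -
  have "(w + csqrt (1 + w\<^sup>2)) * (csqrt (1 + w\<^sup>2) - w) = (csqrt (1 + w\<^sup>2))\<^sup>2 - w\<^sup>2"
    by (simp add: power2_eq_square algebra_simps)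
  then have "(w + csqrt (1 + w\<^sup>2)) * (csqrt (1 + w\<^sup>2) - w) = 1" by simp
  then show ?thesis using arsinh_arg_nz[of w] by (simp add: exp_minus exp_arsinh inverse_unique)
qed

lemma sinh_arsinh_complex: "sinh (arsinh w) = w" for w :: complex
  by (simp add: sinh_field_def exp_arsinh exp_minus_arsinh)

lemma arsinh_of_real: "arsinh (complex_of_real x) = of_real (arsinh x)"
proof -
  have "csqrt (1 + (complex_of_real x)\<^sup>2) = csqrt (of_real (1 + x\<^sup>2))" by simp
  also have "\<dots> = of_real (sqrt (1 + x\<^sup>2))" by (subst csqrt_of_real_nonneg) (auto simp del: of_real_add of_real_power)
  finally have "complex_of_real x + csqrt (1 + (complex_of_real x)\<^sup>2) = of_real (x + sqrt (1 + x\<^sup>2))" by simp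
  then show ?thesis using arsinh_real_aux[of x]
    by (simp add: arsinh_complex arsinh_real_def Ln_of_real add.commute del: of_real_add)
qed

text \<open>The logarithm never meets its cut: if \<open>w + csqrt (1 + w\<^sup>2)\<close> were a
  real \<open>c \<le> 0\<close>, solving for \<open>w\<close> would make \<open>w\<close> real, and
  for real \<open>w\<close> the expression is positive.\<close>

lemma arsinh_has_field_derivative_strip:
  assumes "w \<in> strip"
  shows "(arsinh has_field_derivative inverse (csqrt (1 + w\<^sup>2))) (at w within A)"
proof -
  define r where "r = csqrt (1 + w\<^sup>2)"
  have nz: "r \<noteq> 0" unfolding r_def by (rule csqrt_one_plus_sq_nz[OF assms])
  have r2: "r\<^sup>2 = 1 + w\<^sup>2" by (simp add: r_def)
  have arg: "w + r \<notin> \<real>\<^sub>\<le>\<^sub>0"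
  proof
    assume "w + r \<in> \<real>\<^sub>\<le>\<^sub>0"
    then have R: "Im (w + r) = 0" "Re (w + r) \<le> 0" by (auto simp: complex_nonpos_Reals_iff)
    define c where "c = Re (w + r)"
    have wr: "r = of_real c - w" using R by (simp add: complex_eq_iff c_def)
    have "c \<noteq> 0" using arsinh_arg_nz[of w] wr by (auto simp: r_def)
    have "(of_real c - w)\<^sup>2 = 1 + w\<^sup>2" using r2 wr by simp
    moreover have "2 * of_real c * w = (of_real c)\<^sup>2 - ((of_real c - w)\<^sup>2 - w\<^sup>2)"
      by (simp add: power2_diff)
    ultimately have "2 * of_real c * w = of_real (c\<^sup>2 - 1)" by simp
    then have "w = of_real ((c\<^sup>2 - 1) / (2 * c))" using \<open>c \<noteq> 0\<close> by (simp add: field_simps)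
    then obtain x where x: "w = of_real x" by blast
    have "r = csqrt (of_real (1 + x\<^sup>2))" by (simp add: r_def x)
    also have "\<dots> = of_real (sqrt (1 + x\<^sup>2))" by (subst csqrt_of_real_nonneg) (auto simp del: of_real_add of_real_power)
    finally have "c = x + sqrt (1 + x\<^sup>2)" by (simp add: c_def x)
    then show False using R arsinh_real_aux[of x] by (simp add: c_def add.commute)
  qed
  have "((\<lambda>w. Ln (w + csqrt (1 + w\<^sup>2))) has_field_derivative inverse r) (at w within A)"
  proof -
    have "w + r \<noteq> 0" using arg by auto
    then have "(1 + w / r) / (w + r) = inverse r" using nz by (simp add: divide_simps)
    then show ?thesis
      using one_plus_sq_nonpos[OF assms] arg nz unfolding r_def
      by (auto intro!: derivative_eq_intros simp: field_simps)
  qed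
  then show ?thesis by (simp add: arsinh_complex[abs_def] r_def)
qed

section \<open>Lipschitz bounds for the message recursion\<close>

lemma cosh_of_real: "cosh (complex_of_real x) = of_real (cosh x)"
  by (simp add: cosh_field_def exp_of_real[symmetric])

lemma sinh_of_real: "sinh (complex_of_real x) = of_real (sinh x)"
  by (simp add: sinh_field_def exp_of_real[symmetric])

lemma tanh_of_real: "tanh (complex_of_real x) = of_real (tanh x)"
  by (simp add: tanh_def cosh_of_real sinh_of_real)

lemma sech_prod_norm_le:
  assumes "finite I" "card I \<le> \<Delta>" "\<And>i. i \<in> I \<Longrightarrow> u i \<in> strip"
  shows "norm (\<Prod>i\<in>I. inverse (cosh (u i))) \<le> 2 ^ \<Delta>"
proof -
  have "norm (\<Prod>i\<in>I. inverse (cosh (u i))) = (\<Prod>i\<in>I. norm (inverse (cosh (u i))))"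
    by (rule prod_norm[symmetric])
  also have "\<dots> \<le> (\<Prod>i\<in>I. 2)" using norm_sech_le assms(3) by (intro prod_mono) auto
  also have "\<dots> = 2 ^ card I" by simp
  also have "\<dots> \<le> 2 ^ \<Delta>" using assms(2) by (intro power_increasing) auto
  finally show ?thesis .
qed

text \<open>Halving each factor puts it into the unit disc, where a difference of products is at
  most the sum of the differences of the factors; the 3 is half of the Lipschitz constant 6.\<close>

lemma sech_prod_lipschitz:
  assumes "finite I" "card I \<le> \<Delta>" "\<And>i. i \<in> I \<Longrightarrow> u i \<in> strip" "\<And>i. i \<in> I \<Longrightarrow> v i \<in> strip"
  shows "norm ((\<Prod>i\<in>I. inverse (cosh (u i))) - (\<Prod>i\<in>I. inverse (cosh (v i)))) \<le> 2 ^ \<Delta> * 3 * (\<Sum>i\<in>I. norm (u i - v i))"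
proof -
  have eq: "(\<Prod>i\<in>I. inverse (cosh (u i))) = 2 ^ card I * (\<Prod>i\<in>I. inverse (cosh (u i)) / 2)" for u :: "'a \<Rightarrow> complex"
    by (simp add: prod_dividef)
  have "norm ((\<Prod>i\<in>I. inverse (cosh (u i))) - (\<Prod>i\<in>I. inverse (cosh (v i))))
     = 2 ^ card I * norm ((\<Prod>i\<in>I. inverse (cosh (u i)) / 2) - (\<Prod>i\<in>I. inverse (cosh (v i)) / 2))"
    unfolding eq[of u] eq[of v] right_diff_distrib[symmetric] by (simp add: norm_mult norm_power)
  also have "\<dots> \<le> 2 ^ card I * (\<Sum>i\<in>I. norm (inverse (cosh (u i)) / 2 - inverse (cosh (v i)) / 2))"
    using norm_sech_le assms(3,4)
    by (intro mult_left_mono norm_prod_diff) (auto simp: norm_divide)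
  also have "\<dots> \<le> 2 ^ \<Delta> * (\<Sum>i\<in>I. 3 * norm (u i - v i))"
  proof (intro mult_mono power_increasing sum_mono)
    fix i assume i: "i \<in> I"
    have "norm (inverse (cosh (u i)) / 2 - inverse (cosh (v i)) / 2) = norm (inverse (cosh (u i)) - inverse (cosh (v i))) / 2"
      by (simp add: diff_divide_distrib[symmetric] norm_divide del: diff_divide_distrib)
    then show "norm (inverse (cosh (u i)) / 2 - inverse (cosh (v i)) / 2) \<le> 3 * norm (u i - v i)"
      using sech_lipschitz[OF assms(3,4)[OF i]] by simp
  qed (use assms(2) in \<open>auto intro: sum_nonneg\<close>)
  finally show ?thesis by (simp add: sum_distrib_left mult.assoc)
qed

text \<open>Crude, since each term is compared with the whole \<open>q\<close>-norm; it will only be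
  applied to error terms that carry a factor \<eta>.\<close>

lemma le_powr_sum:
  fixes e :: "'i \<Rightarrow> real"
  assumes "finite I" "q > 0" "\<And>i. i \<in> I \<Longrightarrow> e i \<ge> 0"
  shows "(\<Sum>i\<in>I. e i) \<le> real (card I) * (\<Sum>i\<in>I. e i powr q) powr (1/q)"
proof -
  have "e i \<le> (\<Sum>i\<in>I. e i powr q) powr (1/q)" if i: "i \<in> I" for i
  proof -
    have "e i = (e i powr q) powr (1/q)" using assms i by (simp add: powr_powr)
    also have "\<dots> \<le> (\<Sum>i\<in>I. e i powr q) powr (1/q)"
      using assms i member_le_sum[of i I "\<lambda>i. e i powr q"] by (intro powr_mono2) auto
    finally show ?thesis .
  qed
  from sum_bounded_above[of I e, OF this] show ?thesis by simp
qed

text \<open>The derivative at a complex point, in direction \<open>e\<close>, is compared with the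
  one at the real point \<open>r\<close>, where \<open>contractive\<close> applies.
  \<open>C1 * \<eta>\<close> bounds the displacement of \<open>w\<close>. The term
  \<open>24 * C1\<close> is the constant 8 of \<open>psi_lipschitz\<close> times the bound 3 on
  \<open>tanh\<close>, the 4 is the Lipschitz constant of \<open>tanh\<close>, and \<Delta> is the
  price of passing from a sum to the \<open>q\<close>-norm.\<close>

lemma message_gradient_bound:
  fixes u :: "nat \<Rightarrow> complex"
  assumes C: "contractive q \<kappa> S" and q: "q > 0" and S: "S \<ge> 0"
    and I: "finite I" "card I \<le> \<Delta>"
    and near: "\<And>i. i \<in> I \<Longrightarrow> r i \<ge> 0 \<and> cmod (u i - of_real (r i)) \<le> \<eta>"
    and s: "0 \<le> s0" "s0 \<le> S" "cmod (s - of_real s0) \<le> \<eta>"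
    and C1: "C1 = 2 ^ \<Delta> * (1 + 3 * S * \<Delta>)"
    and eta: "0 \<le> \<eta>" "\<eta> \<le> 1/2" "C1 * \<eta> \<le> 1/2"
    and w: "w = s * (\<Prod>i\<in>I. inverse (cosh (u i)))"
  shows "w \<in> strip"
    and "cmod (w / csqrt (1 + w\<^sup>2) * (\<Sum>i\<in>I. tanh (u i) * e i))
          \<le> (\<kappa> + (24 * C1 + 4) * \<Delta> * \<eta>) * (\<Sum>i\<in>I. cmod (e i) powr q) powr (1/q)"
proof -
  have us: "u i \<in> strip" if "i \<in> I" for i
    using near[OF that] eta by (intro near_real_in_strip[of _ "r i"]) linarith
  define P where "P = (\<Prod>i\<in>I. inverse (cosh (u i)))"
  define P0 where "P0 = (\<Prod>i\<in>I. inverse (cosh (r i)))"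
  define w0 where "w0 = s0 * P0"
  have P0c: "complex_of_real P0 = (\<Prod>i\<in>I. inverse (cosh (complex_of_real (r i))))"
    by (simp add: P0_def cosh_of_real)
  have "cmod (P - of_real P0) \<le> 2 ^ \<Delta> * 3 * (\<Sum>i\<in>I. cmod (u i - of_real (r i)))"
    unfolding P0c P_def using us by (intro sech_prod_lipschitz I) auto
  also have "(\<Sum>i\<in>I. cmod (u i - of_real (r i))) \<le> real (card I) * \<eta>"
    using near by (intro sum_bounded_above) auto
  also have "\<dots> \<le> real \<Delta> * \<eta>" using I eta by (intro mult_right_mono) auto
  finally have PP: "cmod (P - of_real P0) \<le> 2 ^ \<Delta> * 3 * (\<Delta> * \<eta>)" by simp
  have "w - of_real w0 = (s - of_real s0) * P + of_real s0 * (P - of_real P0)"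
    by (simp add: w w0_def P_def algebra_simps)
  then have "cmod (w - of_real w0) \<le> cmod (s - of_real s0) * cmod P + s0 * cmod (P - of_real P0)"
    using s norm_triangle_ineq[of "(s - of_real s0) * P" "of_real s0 * (P - of_real P0)"]
    by (simp add: norm_mult)
  also have "\<dots> \<le> \<eta> * 2 ^ \<Delta> + S * (2 ^ \<Delta> * 3 * (\<Delta> * \<eta>))"
    using s eta S PP sech_prod_norm_le[OF I us] unfolding P_def
    by (intro add_mono mult_mono) auto
  also have "\<dots> = C1 * \<eta>" by (simp add: C1 algebra_simps)
  finally have ww: "cmod (w - of_real w0) \<le> C1 * \<eta>" .
  then show ws: "w \<in> strip" using eta by (intro near_real_in_strip[of _ w0]) linarith
  have w00: "w0 \<ge> 0" using s by (auto simp: w0_def P0_def intro!: mult_nonneg_nonneg prod_nonneg)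
  define \<psi> where "\<psi> = w / csqrt (1 + w\<^sup>2)"
  define \<psi>0 where "\<psi>0 = w0 / sqrt (1 + w0\<^sup>2)"
  have psi0c: "complex_of_real \<psi>0 = of_real w0 / csqrt (1 + (of_real w0)\<^sup>2)"
  proof -
    have "csqrt (1 + (complex_of_real w0)\<^sup>2) = csqrt (of_real (1 + w0\<^sup>2))" by simp
    also have "\<dots> = of_real (sqrt (1 + w0\<^sup>2))"
      by (subst csqrt_of_real_nonneg) (auto simp del: of_real_add of_real_power)
    finally show ?thesis by (simp add: \<psi>0_def)
  qed
  have psi: "cmod (\<psi> - of_real \<psi>0) \<le> 8 * (C1 * \<eta>)"
    using psi_lipschitz[OF ws of_real_in_strip[of w0]] ww unfolding psi0c \<psi>_def by linarith
  have psi0: "0 \<le> \<psi>0" "\<psi>0 \<le> 1"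
  proof -
    have "w0 \<le> sqrt (1 + w0\<^sup>2)" by (rule real_le_rsqrt) simp
    moreover have "sqrt (1 + w0\<^sup>2) > 0" by (simp add: add_pos_nonneg)
    ultimately show "0 \<le> \<psi>0" "\<psi>0 \<le> 1" using w00 by (auto simp: \<psi>0_def)
  qed
  have C10: "C1 \<ge> 0" using S by (simp add: C1)
  have summand: "cmod (\<psi> * tanh (u i)) \<le> \<psi>0 * tanh (r i) + (24 * C1 + 4) * \<eta>" if i: "i \<in> I" for i
  proof -
    have "\<psi> * tanh (u i) = of_real (\<psi>0 * tanh (r i)) + ((\<psi> - of_real \<psi>0) * tanh (u i)
        + of_real \<psi>0 * (tanh (u i) - tanh (of_real (r i))))"
      by (simp add: algebra_simps tanh_of_real)
    then have "cmod (\<psi> * tanh (u i)) \<le> cmod (of_real (\<psi>0 * tanh (r i))) + (cmod ((\<psi> - of_real \<psi>0) * tanh (u i))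
        + cmod (of_real \<psi>0 * (tanh (u i) - tanh (of_real (r i)))))"
      by (simp only:) (intro order_trans[OF norm_triangle_ineq] add_left_mono norm_triangle_ineq)
    also have "cmod (of_real (\<psi>0 * tanh (r i))) = \<psi>0 * tanh (r i)"
      using psi0 near[OF i] by (simp add: norm_mult)
    also have "cmod ((\<psi> - of_real \<psi>0) * tanh (u i)) \<le> (8 * (C1 * \<eta>)) * 3"
      unfolding norm_mult using psi norm_tanh_le[OF us[OF i]] C10 eta by (intro mult_mono) auto
    also have "cmod (of_real \<psi>0 * (tanh (u i) - tanh (of_real (r i)))) \<le> 1 * (4 * \<eta>)"
      unfolding norm_mult
      using psi0 tanh_lipschitz[OF us[OF i] of_real_in_strip[of "r i"]] near[OF i]
      by (intro mult_mono) auto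
    finally show ?thesis by (simp add: algebra_simps)
  qed
  define N where "N = (\<Sum>i\<in>I. cmod (e i) powr q) powr (1/q)"
  have N0: "N \<ge> 0" by (simp add: N_def)
  have split_sum: "(\<Sum>i\<in>I. (\<psi>0 * tanh (r i) + K) * cmod (e i))
      = \<psi>0 * (\<Sum>i\<in>I. tanh (r i) * cmod (e i)) + K * (\<Sum>i\<in>I. cmod (e i))" for K
    by (simp add: algebra_simps sum.distrib sum_distrib_left)
  have "cmod (\<psi> * (\<Sum>i\<in>I. tanh (u i) * e i)) = cmod (\<Sum>i\<in>I. \<psi> * tanh (u i) * e i)"
    by (simp add: sum_distrib_left mult.assoc)
  also have "\<dots> \<le> (\<Sum>i\<in>I. (\<psi>0 * tanh (r i) + (24 * C1 + 4) * \<eta>) * cmod (e i))"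
    using summand by (intro sum_norm_le) (auto simp: norm_mult intro!: mult_right_mono)
  also have "\<dots> = \<psi>0 * (\<Sum>i\<in>I. tanh (r i) * cmod (e i)) + (24 * C1 + 4) * \<eta> * (\<Sum>i\<in>I. cmod (e i))"
    by (rule split_sum)
  also have "\<psi>0 * (\<Sum>i\<in>I. tanh (r i) * cmod (e i)) \<le> \<kappa> * N"
    using C[unfolded contractive_def Let_def, rule_format, of I r "\<lambda>i. cmod (e i)" s0] I near s
    by (simp add: N_def \<psi>0_def w0_def P0_def)
  also have "(24 * C1 + 4) * \<eta> * (\<Sum>i\<in>I. cmod (e i)) \<le> (24 * C1 + 4) * \<eta> * (\<Delta> * N)"
  proof (intro mult_left_mono)
    have "(\<Sum>i\<in>I. cmod (e i)) \<le> real (card I) * N" unfolding N_def using I q by (intro le_powr_sum) auto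
    also have "\<dots> \<le> \<Delta> * N" using I N0 by (intro mult_right_mono) auto
    finally show "(\<Sum>i\<in>I. cmod (e i)) \<le> \<Delta> * N" .
  qed (use C10 eta in auto)
  finally show "cmod (w / csqrt (1 + w\<^sup>2) * (\<Sum>i\<in>I. tanh (u i) * e i))
          \<le> (\<kappa> + (24 * C1 + 4) * \<Delta> * \<eta>) * (\<Sum>i\<in>I. cmod (e i) powr q) powr (1/q)"
    by (simp add: \<psi>_def N_def algebra_simps)
qed

text \<open>The mean value inequality along the segment from \<open>(u, s)\<close> to
  \<open>(u', s')\<close>. The two families may be far apart, as long as each is close to some real
  family: the real reference points are interpolated too, so the whole segment stays within \<eta>
  of nonnegative reals. Hence the lemma serves both to compare a complex message with a real one and
  to compare messages of different domains.\<close>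

lemma message_lipschitz:
  fixes u u' :: "nat \<Rightarrow> complex"
  assumes C: "contractive q \<kappa> S" and q: "q > 0" and S: "S \<ge> 0"
    and I: "finite I" "card I \<le> \<Delta>"
    and near: "\<And>i. i \<in> I \<Longrightarrow> r i \<ge> 0 \<and> cmod (u i - of_real (r i)) \<le> \<eta>"
    and near': "\<And>i. i \<in> I \<Longrightarrow> r' i \<ge> 0 \<and> cmod (u' i - of_real (r' i)) \<le> \<eta>"
    and s0: "0 \<le> s0" "s0 \<le> S" and s: "cmod (s - of_real s0) \<le> \<eta>" "cmod (s' - of_real s0) \<le> \<eta>"
    and C1: "C1 = 2 ^ \<Delta> * (1 + 3 * S * \<Delta>)"
    and eta: "0 \<le> \<eta>" "\<eta> \<le> 1/2" "C1 * \<eta> \<le> 1/2"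
  shows "cmod (arsinh (s' * (\<Prod>i\<in>I. inverse (cosh (u' i)))) - arsinh (s * (\<Prod>i\<in>I. inverse (cosh (u i)))))
          \<le> (\<kappa> + (24 * C1 + 4) * \<Delta> * \<eta>) * (\<Sum>i\<in>I. cmod (u' i - u i) powr q) powr (1/q) + 2 * 2 ^ \<Delta> * cmod (s' - s)"
    (is "_ \<le> ?B")
proof -
  define T :: "complex set" where "T = closed_segment 0 1"
  define v where "v = (\<lambda>i t. u i + t * (u' i - u i))"
  define z where "z = (\<lambda>t. s + t * (s' - s))"
  define P where "P = (\<lambda>t. \<Prod>i\<in>I. inverse (cosh (v i t)))"
  define w where "w = (\<lambda>t. z t * P t)"
  have interp: "cmod ((a + of_real \<tau> * (a' - a)) - of_real (b + \<tau> * (b' - b))) \<le> \<eta>"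
    if "0 \<le> \<tau>" "\<tau> \<le> 1" "cmod (a - of_real b) \<le> \<eta>" "cmod (a' - of_real b') \<le> \<eta>" for a a' b b' \<tau>
  proof -
    have "(a + of_real \<tau> * (a' - a)) - of_real (b + \<tau> * (b' - b))
       = of_real (1 - \<tau>) * (a - of_real b) + of_real \<tau> * (a' - of_real b')"
      by (simp add: algebra_simps)
    also have "cmod \<dots> \<le> (1 - \<tau>) * cmod (a - of_real b) + \<tau> * cmod (a' - of_real b')"
      using that norm_triangle_ineq[of "of_real (1 - \<tau>) * (a - of_real b)" "of_real \<tau> * (a' - of_real b')"]
      by (simp add: norm_mult del: of_real_diff)
    also have "\<dots> \<le> (1 - \<tau>) * \<eta> + \<tau> * \<eta>" using that by (intro add_mono mult_left_mono) auto
    finally show ?thesis by (simp add: algebra_simps)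
  qed
  have "cmod (arsinh (w 1) - arsinh (w 0)) \<le> ?B * cmod (1 - 0 :: complex)"
  proof (rule field_differentiable_bound[of T "\<lambda>t. arsinh (w t)"
       "\<lambda>t. P t * (s' - s) * inverse (csqrt (1 + (w t)\<^sup>2)) - w t / csqrt (1 + (w t)\<^sup>2) * (\<Sum>i\<in>I. tanh (v i t) * (u' i - u i))"])
    show "convex T" by (simp add: T_def)
    show "0 \<in> T" "1 \<in> T" by (auto simp: T_def)
    fix t assume "t \<in> T"
    then obtain \<tau> where \<tau>: "0 \<le> \<tau>" "\<tau> \<le> 1" "t = of_real \<tau>"
      by (auto simp: T_def in_segment scaleR_conv_of_real)
    define \<rho> where "\<rho> = (\<lambda>i. r i + \<tau> * (r' i - r i))"
    have vr: "\<rho> i \<ge> 0 \<and> cmod (v i t - of_real (\<rho> i)) \<le> \<eta>" if i: "i \<in> I" for i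
    proof
      have "\<rho> i = (1 - \<tau>) * r i + \<tau> * r' i" by (simp add: \<rho>_def algebra_simps)
      then show "\<rho> i \<ge> 0" using \<tau> near[OF i] near'[OF i] by (auto intro!: add_nonneg_nonneg)
      show "cmod (v i t - of_real (\<rho> i)) \<le> \<eta>"
        unfolding v_def \<rho>_def \<tau>(3) using near[OF i] near'[OF i] \<tau> by (intro interp) auto
    qed
    have zs: "cmod (z t - of_real s0) \<le> \<eta>"
      using interp[of \<tau> s s0 s' s0] s \<tau> by (simp add: z_def)
    have ws: "w t \<in> strip"
      unfolding w_def P_def by (rule message_gradient_bound(1)[OF C q S I vr s0 zs C1 eta refl])
    have vs: "v i t \<in> strip" if "i \<in> I" for i
      using vr[OF that] eta by (intro near_real_in_strip[of _ "\<rho> i"]) linarith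
    have dP: "(P has_field_derivative (P t * - (\<Sum>i\<in>I. tanh (v i t) * (u' i - u i)))) (at t within T)"
    proof -
      have "((\<lambda>t. \<Prod>i\<in>I. inverse (cosh (v i t))) has_field_derivative
         (\<Prod>i\<in>I. inverse (cosh (v i t))) * (\<Sum>i\<in>I. (- tanh (v i t) * inverse (cosh (v i t)) * (u' i - u i)) / inverse (cosh (v i t)))) (at t)"
      proof (rule has_field_derivative_prod')
        fix i assume i: "i \<in> I"
        have nz: "cosh (v i t) \<noteq> 0" by (rule cosh_strip_nz[OF vs[OF i]])
        then show "inverse (cosh (v i t)) \<noteq> 0" by simp
        have "(v i has_field_derivative (u' i - u i)) (at t)"
          unfolding v_def by (auto intro!: derivative_eq_intros)
        then show "((\<lambda>t. inverse (cosh (v i t))) has_field_derivative (- tanh (v i t) * inverse (cosh (v i t)) * (u' i - u i))) (at t)"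
          using nz by (auto intro!: derivative_eq_intros simp: tanh_def field_simps)
      qed
      also have "(\<Sum>i\<in>I. (- tanh (v i t) * inverse (cosh (v i t)) * (u' i - u i)) / inverse (cosh (v i t)))
         = - (\<Sum>i\<in>I. tanh (v i t) * (u' i - u i))"
        unfolding sum_negf[symmetric] using cosh_strip_nz[OF vs] by (intro sum.cong) auto
      finally show ?thesis by (simp add: P_def has_field_derivative_at_within)
    qed
    have dz: "(z has_field_derivative (s' - s)) (at t within T)"
      unfolding z_def by (auto intro!: derivative_eq_intros)
    have dw: "(w has_field_derivative (P t * (s' - s) - w t * (\<Sum>i\<in>I. tanh (v i t) * (u' i - u i)))) (at t within T)"
      unfolding w_def using DERIV_mult[OF dz dP] by (simp add: algebra_simps sum_negf)
    show "((\<lambda>t. arsinh (w t)) has_field_derivative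
        (P t * (s' - s) * inverse (csqrt (1 + (w t)\<^sup>2)) - w t / csqrt (1 + (w t)\<^sup>2) * (\<Sum>i\<in>I. tanh (v i t) * (u' i - u i)))) (at t within T)"
      using DERIV_chain2[OF arsinh_has_field_derivative_strip[OF ws] dw]
      by (simp add: divide_inverse algebra_simps)
    have "cmod (P t * (s' - s) * inverse (csqrt (1 + (w t)\<^sup>2))) \<le> 2 ^ \<Delta> * cmod (s' - s) * 2"
      unfolding norm_mult P_def
      using sech_prod_norm_le[OF I vs] norm_inverse_csqrt_le[OF ws] by (intro mult_mono) auto
    moreover have "cmod (w t / csqrt (1 + (w t)\<^sup>2) * (\<Sum>i\<in>I. tanh (v i t) * (u' i - u i)))
       \<le> (\<kappa> + (24 * C1 + 4) * \<Delta> * \<eta>) * (\<Sum>i\<in>I. cmod (u' i - u i) powr q) powr (1/q)"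
      unfolding w_def P_def
      by (rule message_gradient_bound(2)[OF C q S I vr s0 zs C1 eta refl])
    ultimately show "cmod (P t * (s' - s) * inverse (csqrt (1 + (w t)\<^sup>2)) - w t / csqrt (1 + (w t)\<^sup>2) * (\<Sum>i\<in>I. tanh (v i t) * (u' i - u i))) \<le> ?B"
      by (intro order_trans[OF norm_triangle_ineq4]) linarith
  qed
  then show ?thesis by (simp add: w_def z_def P_def v_def)
qed

section \<open>The recursion tree and its weights\<close>

definition saws_in :: "('v \<Rightarrow> 'v \<Rightarrow> bool) \<Rightarrow> nat \<Rightarrow> 'v set \<Rightarrow> 'v \<Rightarrow> 'v list set" where
  "saws_in E k \<Lambda> v = {p \<in> saws E k v. set p \<subseteq> \<Lambda>}"

definition gball :: "('v \<Rightarrow> 'v \<Rightarrow> bool) \<Rightarrow> nat \<Rightarrow> 'v \<Rightarrow> 'v set" where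
  "gball E r v = {u. \<exists>k\<le>r. (E ^^ k) v u}"

lemma gball_self [simp]: "v \<in> gball E r v"
  unfolding gball_def by (auto intro: exI[of _ 0])

lemma gball_step: "E v u \<Longrightarrow> gball E r u \<subseteq> gball E (Suc r) v"
  unfolding gball_def using relpowp_Suc_I2[of E v u] by (blast intro: Suc_le_mono[THEN iffD2])

lemma gball_mono: "r \<le> r' \<Longrightarrow> gball E r v \<subseteq> gball E r' v"
  unfolding gball_def using order_trans by blast

text \<open>Times \<open>z\<close> this is the occupation probability of \<open>v\<close>. Leaving
  \<open>z\<close> out keeps it regular at 0 and makes its sum over \<Lambda> the logarithmic
  derivative of \<open>Zpoly\<close>.\<close>

definition local_density :: "('v \<Rightarrow> 'v \<Rightarrow> bool) \<Rightarrow> 'v set \<Rightarrow> 'v \<Rightarrow> complex \<Rightarrow> complex" where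
  "local_density E \<Lambda> v z = Zpoly E (\<Lambda> - insert v {u. E v u}) z / Zpoly E \<Lambda> z"

locale bounded_graph =
  fixes E :: "'v \<Rightarrow> 'v \<Rightarrow> bool" and \<Delta> :: nat
  assumes sym: "E u v \<Longrightarrow> E v u"
    and irrefl: "\<not> E v v"
    and fin_nb: "finite {u. E v u}"
    and deg: "card {u. E v u} \<le> \<Delta>"
begin

text \<open>An arbitrary but fixed order of removal. It need not respect automorphisms, and so
  neither need the messages; only quantities defined through \<open>Zpoly\<close> are later
  transported along the lattice.\<close>

definition nbs :: "'v \<Rightarrow> 'v list" where
  "nbs v = (SOME xs. distinct xs \<and> set xs = {u. E v u})"

lemma nbs: "distinct (nbs v)" "set (nbs v) = {u. E v u}"
proof -
  have "\<exists>xs. distinct xs \<and> set xs = {u. E v u}" using finite_distinct_list[OF fin_nb] by blast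
  from someI_ex[OF this] show "distinct (nbs v)" "set (nbs v) = {u. E v u}" by (auto simp: nbs_def)
qed

lemma length_nbs: "length (nbs v) \<le> \<Delta>"
  using deg[of v] distinct_card[OF nbs(1), of v] by (simp add: nbs(2))

lemma nbs_adj: "i < length (nbs v) \<Longrightarrow> E v (nbs v ! i)"
  using nbs(2)[of v] nth_mem by blast

text \<open>The domain at the moment when the \<open>i\<close>-th neighbour is about to be removed:
  \<open>v\<close> and the neighbours before it are gone, while \<open>take i\<close> stops short of
  that neighbour itself.\<close>

definition child :: "'v set \<Rightarrow> 'v \<Rightarrow> nat \<Rightarrow> 'v set" where
  "child \<Lambda> v i = \<Lambda> - insert v (set (take i (nbs v)))"

definition kids :: "'v set \<Rightarrow> 'v \<Rightarrow> nat set" where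
  "kids \<Lambda> v = {i. i < length (nbs v) \<and> nbs v ! i \<in> \<Lambda>}"

lemma finite_kids [simp]: "finite (kids \<Lambda> v)"
  unfolding kids_def by simp

lemma card_kids: "card (kids \<Lambda> v) \<le> \<Delta>"
proof -
  have "card (kids \<Lambda> v) \<le> card {..<length (nbs v)}"
    unfolding kids_def by (intro card_mono) auto
  then show ?thesis using length_nbs[of v] by simp
qed

lemma kid_in_child: assumes "i \<in> kids \<Lambda> v" shows "nbs v ! i \<in> child \<Lambda> v i"
proof -
  have i: "i < length (nbs v)" "nbs v ! i \<in> \<Lambda>" using assms by (auto simp: kids_def)
  have "nbs v ! i \<notin> set (take i (nbs v))"
    using nbs(1)[of v] i by (auto simp: in_set_conv_nth nth_eq_iff_index_eq)
  moreover have "nbs v ! i \<noteq> v" using nbs_adj[OF i(1)] irrefl by auto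
  ultimately show ?thesis using i by (auto simp: child_def)
qed

lemma saws_Suc_subset: "saws E (Suc k) v \<subseteq> (\<Union>u\<in>{u. E v u}. Cons v ` saws E k u)"
proof
  fix p assume p: "p \<in> saws E (Suc k) v"
  then obtain p' where p': "p = v # p'" "length p' = Suc k" "distinct p'"
    by (cases p) (auto simp: saws_def)
  have adj: "\<forall>i<Suc k. E (p ! i) (p ! Suc i)" using p by (simp add: saws_def)
  have "E v (hd p')" using adj[rule_format, of 0] p' by (cases p') auto
  moreover have "p' \<in> saws E k (hd p')" using p' adj by (fastforce simp: saws_def)
  ultimately show "p \<in> (\<Union>u\<in>{u. E v u}. Cons v ` saws E k u)" using p'(1) by auto
qed

lemma finite_saws: "finite (saws E k v)" and num_saws_le: "num_saws E k v \<le> \<Delta> ^ k"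
proof (induction k arbitrary: v)
  case 0
  { case 1
    have "saws E 0 v \<subseteq> {[v]}" by (auto simp: saws_def length_Suc_conv)
    then show ?case by (rule finite_subset) simp
  next
    case 2
    have "saws E 0 v \<subseteq> {[v]}" by (auto simp: saws_def length_Suc_conv)
    then have "card (saws E 0 v) \<le> card {[v]}" by (rule card_mono[rotated]) simp
    then show ?case by (simp add: num_saws_def)
  }
next
  case (Suc k)
  have f: "finite (\<Union>u\<in>{u. E v u}. Cons v ` saws E k u)" for v using Suc fin_nb by auto
  { case 1 show ?case by (rule finite_subset[OF saws_Suc_subset f])
  next
    case 2
    have "card (saws E (Suc k) v) \<le> card (\<Union>u\<in>{u. E v u}. Cons v ` saws E k u)"
      by (rule card_mono[OF f saws_Suc_subset])
    also have "\<dots> \<le> (\<Sum>u\<in>{u. E v u}. card (Cons v ` saws E k u))"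
      by (rule card_UN_le[OF fin_nb])
    also have "\<dots> \<le> (\<Sum>u\<in>{u. E v u}. \<Delta> ^ k)"
      using Suc by (intro sum_mono order_trans[OF card_image_le]) (auto simp: num_saws_def)
    also have "\<dots> \<le> \<Delta> * \<Delta> ^ k" using deg[of v] by simp
    finally show ?case by (simp add: num_saws_def) }
qed

lemma finite_saws_in: "finite (saws_in E k \<Lambda> v)"
  unfolding saws_in_def using finite_saws by simp

text \<open>Prepending \<open>v\<close> is injective, walks from different children differ in their
  second vertex, and the result is self-avoiding because \<open>child\<close> lacks
  \<open>v\<close>. In general there is no equality, since walks in a child also avoid the earlier
  neighbours.\<close>

lemma card_saws_in_children:
  assumes "v \<in> \<Lambda>"
  shows "(\<Sum>i\<in>kids \<Lambda> v. card (saws_in E j (child \<Lambda> v i) (nbs v ! i))) \<le> card (saws_in E (Suc j) \<Lambda> v)"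
proof -
  define A where "A = (\<lambda>i. Cons v ` saws_in E j (child \<Lambda> v i) (nbs v ! i))"
  have "(\<Sum>i\<in>kids \<Lambda> v. card (saws_in E j (child \<Lambda> v i) (nbs v ! i))) = (\<Sum>i\<in>kids \<Lambda> v. card (A i))"
    unfolding A_def by (intro sum.cong) (auto simp: card_image)
  also have "\<dots> = card (\<Union>i\<in>kids \<Lambda> v. A i)"
  proof (rule card_UN_disjoint[symmetric])
    show "\<forall>i\<in>kids \<Lambda> v. \<forall>j\<in>kids \<Lambda> v. i \<noteq> j \<longrightarrow> A i \<inter> A j = {}"
      using nbs(1)[of v] by (auto simp: A_def saws_in_def saws_def kids_def nth_eq_iff_index_eq)
  qed (auto simp: A_def finite_saws_in)
  also have "\<dots> \<le> card (saws_in E (Suc j) \<Lambda> v)"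
  proof (rule card_mono[OF finite_saws_in], rule UN_least)
    fix i assume i: "i \<in> kids \<Lambda> v"
    then have adj: "E v (nbs v ! i)" using nbs_adj by (auto simp: kids_def)
    show "A i \<subseteq> saws_in E (Suc j) \<Lambda> v"
    proof
      fix p assume "p \<in> A i"
      then obtain p' where p': "p = v # p'" "p' \<in> saws E j (nbs v ! i)" "set p' \<subseteq> child \<Lambda> v i"
        by (auto simp: A_def saws_in_def)
      have ne: "p' \<noteq> []" using p'(2) by (auto simp: saws_def)
      then have h: "p' ! 0 = nbs v ! i" using p'(2) by (auto simp: saws_def hd_conv_nth)
      have "E (p ! k) (p ! Suc k)" if "k < Suc j" for k
        using that p' h adj by (cases k) (auto simp: saws_def)
      then show "p \<in> saws_in E (Suc j) \<Lambda> v"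
        using p' assms by (auto simp: saws_in_def saws_def child_def)
    qed
  qed
  finally show ?thesis .
qed

text \<open>The truncation \<open>n\<close> runs in step with the depth of \<open>msg\<close>: the
  weight at depth \<open>Suc n\<close> of a vertex has to control the weights at depth
  \<open>n\<close> of its children.\<close>

definition wt :: "real \<Rightarrow> nat \<Rightarrow> 'v set \<Rightarrow> 'v \<Rightarrow> real" where
  "wt c n \<Lambda> v = (\<Sum>j\<le>n. c ^ j * card (saws_in E j \<Lambda> v))"

lemma wt_ge_1: assumes "c \<ge> 0" "v \<in> \<Lambda>" shows "wt c n \<Lambda> v \<ge> 1"
proof -
  have "saws_in E 0 \<Lambda> v = {[v]}" using assms(2) by (auto simp: saws_in_def saws_def length_Suc_conv)
  then have "1 = c ^ 0 * card (saws_in E 0 \<Lambda> v)" by simp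
  also have "\<dots> \<le> wt c n \<Lambda> v" unfolding wt_def using assms(1) by (intro member_le_sum) auto
  finally show ?thesis .
qed

lemma wt_children:
  assumes "c \<ge> 0" "v \<in> \<Lambda>"
  shows "c * (\<Sum>i\<in>kids \<Lambda> v. wt c n (child \<Lambda> v i) (nbs v ! i)) \<le> wt c (Suc n) \<Lambda> v"
proof -
  have "c * (\<Sum>i\<in>kids \<Lambda> v. wt c n (child \<Lambda> v i) (nbs v ! i))
     = (\<Sum>j\<le>n. c ^ Suc j * real (\<Sum>i\<in>kids \<Lambda> v. card (saws_in E j (child \<Lambda> v i) (nbs v ! i))))"
    unfolding wt_def by (subst sum.swap) (simp add: sum_distrib_left mult.assoc)
  also have "\<dots> \<le> (\<Sum>j\<le>n. c ^ Suc j * card (saws_in E (Suc j) \<Lambda> v))"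
    using assms card_saws_in_children[OF assms(2)]
    by (intro sum_mono mult_left_mono) (auto simp del: of_nat_sum)
  also have "\<dots> \<le> wt c (Suc n) \<Lambda> v"
    unfolding wt_def sum.atMost_Suc_shift using assms by simp
  finally show ?thesis .
qed

lemma wt_le:
  assumes "c \<ge> 0" shows "wt c n \<Lambda> v \<le> (\<Sum>j\<le>n. c ^ j * num_saws E j v)"
  unfolding wt_def using assms finite_saws
  by (intro sum_mono mult_left_mono) (auto simp: num_saws_def saws_in_def intro!: card_mono)

text \<open>The argument \<open>n\<close> truncates the recursion tree at depth \<open>n\<close>; the recursion is exact once \<open>n \<ge> card \<Lambda>\<close>.\<close>

fun msg :: "nat \<Rightarrow> 'v set \<Rightarrow> 'v \<Rightarrow> complex \<Rightarrow> complex" where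
  "msg 0 \<Lambda> v s = 0"
| "msg (Suc n) \<Lambda> v s = arsinh (s * (\<Prod>i\<in>kids \<Lambda> v. inverse (cosh (msg n (child \<Lambda> v i) (nbs v ! i) s))))"

text \<open>The recursion at real \<open>s\<close>, kept real-valued so that nonnegativity and the
  bound \<open>arsinh S\<close> are at hand. Its values are the centres around which the complex
  messages will be confined.\<close>

fun rmsg :: "nat \<Rightarrow> 'v set \<Rightarrow> 'v \<Rightarrow> real \<Rightarrow> real" where
  "rmsg 0 \<Lambda> v s = 0"
| "rmsg (Suc n) \<Lambda> v s = arsinh (s * (\<Prod>i\<in>kids \<Lambda> v. inverse (cosh (rmsg n (child \<Lambda> v i) (nbs v ! i) s))))"

lemma arsinh_real_nonneg: "x \<ge> 0 \<Longrightarrow> arsinh x \<ge> (0::real)"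
  by (metis arsinh_real_pos_iff arsinh_real_eq_0_iff less_eq_real_def)

lemma rmsg_nonneg: "s \<ge> 0 \<Longrightarrow> rmsg n \<Lambda> v s \<ge> 0"
  by (cases n) (auto intro!: arsinh_real_nonneg mult_nonneg_nonneg prod_nonneg)

lemma rmsg_le: assumes "0 \<le> s" "s \<le> S" shows "rmsg n \<Lambda> v s \<le> arsinh S"
proof (cases n)
  case 0
  then show ?thesis using assms by (simp add: arsinh_real_nonneg)
next
  case (Suc m)
  have "(\<Prod>i\<in>kids \<Lambda> v. inverse (cosh (rmsg m (child \<Lambda> v i) (nbs v ! i) s))) \<le> 1"
    using cosh_real_ge_1 by (intro prod_le_1) (auto simp: inverse_le_1_iff)
  then have "s * (\<Prod>i\<in>kids \<Lambda> v. inverse (cosh (rmsg m (child \<Lambda> v i) (nbs v ! i) s))) \<le> S * 1"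
    using assms by (intro mult_mono) (auto intro: prod_nonneg)
  then show ?thesis using Suc arsinh_less_iff_real[of S] by (simp add: not_less[symmetric])
qed

section \<open>Exactness of the recursion for partition functions\<close>

lemma Zpoly_empty [simp]: "Zpoly E {} z = 1"
proof -
  have "indep_sets E {} = {{}}" by (auto simp: indep_sets_def)
  then show ?thesis by (simp add: Zpoly_def)
qed

lemma Zpoly_remove:
  assumes "finite \<Lambda>" "v \<in> \<Lambda>"
  shows "Zpoly E \<Lambda> z = Zpoly E (\<Lambda> - {v}) z + z * Zpoly E (\<Lambda> - insert v {u. E v u}) z"
proof -
  let ?A = "indep_sets E (\<Lambda> - {v})" and ?B = "indep_sets E (\<Lambda> - insert v {u. E v u})"
  have finA: "finite ?A" "finite ?B"
    using assms(1) by (auto intro: finite_subset[of _ "Pow \<Lambda>"] simp: indep_sets_def)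
  have split: "indep_sets E \<Lambda> = ?A \<union> insert v ` ?B"
  proof (intro equalityI subsetI)
    fix I assume I: "I \<in> indep_sets E \<Lambda>"
    show "I \<in> ?A \<union> insert v ` ?B"
    proof (cases "v \<in> I")
      case True
      have "I - {v} \<in> ?B" using I True by (auto simp: indep_sets_def)
      moreover have "I = insert v (I - {v})" using True by auto
      ultimately show ?thesis by blast
    qed (use I in \<open>auto simp: indep_sets_def\<close>)
  next
    fix I assume "I \<in> ?A \<union> insert v ` ?B"
    then show "I \<in> indep_sets E \<Lambda>"
      using assms(2) irrefl sym by (auto simp: indep_sets_def)
  qed
  have disj: "?A \<inter> insert v ` ?B = {}" by (auto simp: indep_sets_def)
  have inj: "inj_on (insert v) ?B" by (auto simp: inj_on_def indep_sets_def)
  have cardI: "card (insert v I) = Suc (card I)" if "I \<in> ?B" for I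
  proof -
    have "finite I" "v \<notin> I" using that assms(1) by (auto simp: indep_sets_def intro: finite_subset)
    then show ?thesis by simp
  qed
  have "Zpoly E \<Lambda> z = (\<Sum>I\<in>?A. z ^ card I) + (\<Sum>I\<in>insert v ` ?B. z ^ card I)"
    unfolding Zpoly_def split by (rule sum.union_disjoint) (use finA disj in auto)
  also have "(\<Sum>I\<in>insert v ` ?B. z ^ card I) = (\<Sum>I\<in>?B. z * z ^ card I)"
    using cardI by (simp add: sum.reindex[OF inj])
  finally show ?thesis by (simp add: Zpoly_def sum_distrib_left)
qed

text \<open>\<open>g i\<close> is the factor lost when the \<open>i\<close>-th neighbour is removed
  after the earlier ones. Positions outside \<open>kids\<close> contribute none, because there the
  domain does not change.\<close>

lemma Zpoly_telescope:
  assumes "finite \<Lambda>" "k \<le> length (nbs v)"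
    and "\<And>i. i \<in> kids \<Lambda> v \<Longrightarrow> Zpoly E (child \<Lambda> v i) z = g i * Zpoly E (child \<Lambda> v i - {nbs v ! i}) z"
  shows "Zpoly E (\<Lambda> - {v}) z = (\<Prod>i\<in>kids \<Lambda> v \<inter> {..<k}. g i) * Zpoly E (child \<Lambda> v k) z"
  using assms(2)
proof (induction k)
  case 0
  then show ?case by (simp add: child_def)
next
  case (Suc k)
  have k: "k < length (nbs v)" using Suc.prems by simp
  have ch: "child \<Lambda> v (Suc k) = child \<Lambda> v k - {nbs v ! k}"
    using k by (auto simp: child_def take_Suc_conv_app_nth)
  show ?case
  proof (cases "k \<in> kids \<Lambda> v")
    case True
    then have "kids \<Lambda> v \<inter> {..<Suc k} = insert k (kids \<Lambda> v \<inter> {..<k})" by auto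
    then show ?thesis using Suc assms(3)[OF True] by (simp add: ch mult_ac)
  next
    case False
    then have "kids \<Lambda> v \<inter> {..<Suc k} = kids \<Lambda> v \<inter> {..<k}" by (auto simp: less_Suc_eq)
    moreover have "child \<Lambda> v (Suc k) = child \<Lambda> v k"
      using False k unfolding ch by (auto simp: kids_def child_def)
    ultimately show ?thesis using Suc by simp
  qed
qed

lemma Zpoly_star:
  assumes "finite \<Lambda>"
    and "\<And>i. i \<in> kids \<Lambda> v \<Longrightarrow> Zpoly E (child \<Lambda> v i) z = g i * Zpoly E (child \<Lambda> v i - {nbs v ! i}) z"
  shows "Zpoly E (\<Lambda> - {v}) z = (\<Prod>i\<in>kids \<Lambda> v. g i) * Zpoly E (\<Lambda> - insert v {u. E v u}) z"
proof -
  have "kids \<Lambda> v \<inter> {..<length (nbs v)} = kids \<Lambda> v" by (auto simp: kids_def)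
  moreover have "child \<Lambda> v (length (nbs v)) = \<Lambda> - insert v {u. E v u}"
    by (simp add: child_def nbs(2))
  ultimately show ?thesis using Zpoly_telescope[OF assms(1) order_refl, of v z g] assms(2) by simp
qed

text \<open>The invariant is that \<open>cosh\<close> squared equals Z(\<Lambda>) / Z(\<Lambda> -
  v), written without division so that it can be proved together with nonvanishing. The cardinality
  bound drops by one at the children because \<open>child\<close> lacks \<open>v\<close>; thus depth
  0 only meets the empty domain, where nothing is claimed about messages.\<close>

lemma msg_exact:
  assumes nz: "\<And>n \<Lambda> v. v \<in> \<Lambda> \<Longrightarrow> cosh (msg n \<Lambda> v s) \<noteq> 0"
    and "finite \<Lambda>" "card \<Lambda> \<le> n"
  shows "Zpoly E \<Lambda> (s\<^sup>2) \<noteq> 0 \<and> (\<forall>v\<in>\<Lambda>. Zpoly E \<Lambda> (s\<^sup>2) = (cosh (msg n \<Lambda> v s))\<^sup>2 * Zpoly E (\<Lambda> - {v}) (s\<^sup>2))"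
  using assms(2,3)
proof (induction n arbitrary: \<Lambda>)
  case 0
  then show ?case by simp
next
  case (Suc n)
  have eq: "Zpoly E \<Lambda> (s\<^sup>2) = (cosh (msg (Suc n) \<Lambda> v s))\<^sup>2 * Zpoly E (\<Lambda> - {v}) (s\<^sup>2)" if v: "v \<in> \<Lambda>" for v
  proof -
    define u where "u = (\<lambda>i. msg n (child \<Lambda> v i) (nbs v ! i) s)"
    define P where "P = (\<Prod>i\<in>kids \<Lambda> v. inverse (cosh (u i)))"
    have small: "finite (child \<Lambda> v i)" "card (child \<Lambda> v i) \<le> n" for i
    proof -
      have "child \<Lambda> v i \<subseteq> \<Lambda> - {v}" by (auto simp: child_def)
      then have "card (child \<Lambda> v i) \<le> card (\<Lambda> - {v})" using Suc.prems by (intro card_mono) auto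
      then show "card (child \<Lambda> v i) \<le> n" using Suc.prems v by simp
      show "finite (child \<Lambda> v i)" using Suc.prems by (simp add: child_def)
    qed
    have "Zpoly E (\<Lambda> - {v}) (s\<^sup>2) = (\<Prod>i\<in>kids \<Lambda> v. (cosh (u i))\<^sup>2) * Zpoly E (\<Lambda> - insert v {u. E v u}) (s\<^sup>2)"
      unfolding u_def using Suc.IH[OF small] kid_in_child by (intro Zpoly_star Suc.prems) auto
    moreover have "P\<^sup>2 * (\<Prod>i\<in>kids \<Lambda> v. (cosh (u i))\<^sup>2) = 1"
    proof -
      have "P\<^sup>2 * (\<Prod>i\<in>kids \<Lambda> v. (cosh (u i))\<^sup>2) = (\<Prod>i\<in>kids \<Lambda> v. (inverse (cosh (u i)))\<^sup>2 * (cosh (u i))\<^sup>2)"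
        by (simp add: P_def prod_power_distrib prod.distrib)
      also have "\<dots> = 1" using nz[OF kid_in_child] by (intro prod.neutral) (simp add: u_def field_simps)
      finally show ?thesis .
    qed
    ultimately have "P\<^sup>2 * Zpoly E (\<Lambda> - {v}) (s\<^sup>2) = Zpoly E (\<Lambda> - insert v {u. E v u}) (s\<^sup>2)"
      by (simp add: mult.assoc[symmetric])
    moreover have "(cosh (msg (Suc n) \<Lambda> v s))\<^sup>2 = 1 + s\<^sup>2 * P\<^sup>2"
      by (simp add: cosh_square_eq sinh_arsinh_complex P_def u_def power_mult_distrib)
    ultimately show ?thesis using Zpoly_remove[OF Suc.prems(1) v, of "s\<^sup>2"] by (simp add: algebra_simps)
  qed
  moreover have "Zpoly E \<Lambda> (s\<^sup>2) \<noteq> 0"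
  proof (cases "\<Lambda> = {}")
    case False
    then obtain v where v: "v \<in> \<Lambda>" by auto
    then have "Zpoly E (\<Lambda> - {v}) (s\<^sup>2) \<noteq> 0" using Suc.IH[of "\<Lambda> - {v}"] Suc.prems by simp
    then show ?thesis using eq[OF v] nz[OF v, of "Suc n"] by simp
  qed simp
  ultimately show ?case by blast
qed

text \<open>Removing first \<open>v\<close> and then its neighbours splits the density into two
  ratios of partition functions, each an inverse of squared \<open>cosh\<close> values. Depth
  \<open>Suc n\<close> at \<open>v\<close> means depth \<open>n\<close> at the children, and both
  are exact.\<close>

lemma density_eq:
  assumes nz: "\<And>n \<Lambda> v. v \<in> \<Lambda> \<Longrightarrow> cosh (msg n \<Lambda> v s) \<noteq> 0"
    and "finite \<Lambda>" "card \<Lambda> \<le> n" "v \<in> \<Lambda>"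
  shows "local_density E \<Lambda> v (s\<^sup>2) = (inverse (cosh (msg (Suc n) \<Lambda> v s)) *
           (\<Prod>i\<in>kids \<Lambda> v. inverse (cosh (msg n (child \<Lambda> v i) (nbs v ! i) s))))\<^sup>2"
proof -
  define u where "u = (\<lambda>i. msg n (child \<Lambda> v i) (nbs v ! i) s)"
  define N where "N = Zpoly E (\<Lambda> - insert v {u. E v u}) (s\<^sup>2)"
  have ex: "Zpoly E \<Lambda> (s\<^sup>2) \<noteq> 0 \<and> (\<forall>v\<in>\<Lambda>. Zpoly E \<Lambda> (s\<^sup>2) = (cosh (msg (Suc n) \<Lambda> v s))\<^sup>2 * Zpoly E (\<Lambda> - {v}) (s\<^sup>2))"
    using assms by (intro msg_exact) auto
  have small: "finite (child \<Lambda> v i)" "card (child \<Lambda> v i) \<le> n" for i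
  proof -
    have "child \<Lambda> v i \<subseteq> \<Lambda>" by (auto simp: child_def)
    then have "card (child \<Lambda> v i) \<le> card \<Lambda>" using assms by (intro card_mono) auto
    then show "card (child \<Lambda> v i) \<le> n" using assms by simp
    show "finite (child \<Lambda> v i)" using assms by (simp add: child_def)
  qed
  have "Zpoly E (\<Lambda> - {v}) (s\<^sup>2) = (\<Prod>i\<in>kids \<Lambda> v. (cosh (u i))\<^sup>2) * N"
    unfolding u_def N_def using msg_exact[OF nz small] kid_in_child by (intro Zpoly_star assms) auto
  then have Z: "Zpoly E \<Lambda> (s\<^sup>2) = (cosh (msg (Suc n) \<Lambda> v s))\<^sup>2 * (\<Prod>i\<in>kids \<Lambda> v. (cosh (u i))\<^sup>2) * N"
    using ex assms(4) by (simp add: mult.assoc)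
  then have "N \<noteq> 0" using ex by auto
  moreover have "(cosh (msg (Suc n) \<Lambda> v s))\<^sup>2 * (\<Prod>i\<in>kids \<Lambda> v. (cosh (u i))\<^sup>2) \<noteq> 0" using ex Z by auto
  moreover have "(\<Prod>i\<in>kids \<Lambda> v. inverse (cosh (u i)))\<^sup>2 = inverse (\<Prod>i\<in>kids \<Lambda> v. (cosh (u i))\<^sup>2)"
    using prod_inversef[of "\<lambda>i. (cosh (u i))\<^sup>2" "kids \<Lambda> v"]
    by (simp add: prod_power_distrib power_inverse o_def)
  moreover have "msg n (child \<Lambda> v i) (nbs v ! i) s = u i" for i by (simp add: u_def)
  ultimately show ?thesis unfolding local_density_def N_def[symmetric] Z power_mult_distrib
    by (simp add: divide_inverse power_inverse del: msg.simps)
qed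

end

section \<open>Stability and decay of correlations\<close>

text \<open>\<eta> is the distance from real messages within which the perturbed contraction
  constant is still at most \<open>\<theta> * c powr (1/q)\<close>. \<epsilon> is the amplitude of
  the weighted error, small enough for the error to fit into \<eta> whatever the weight. \<delta> is
  the tolerated error of \<open>s\<close>, small enough for its direct effect to fit into the slack
  \<open>(1 - \<theta>) * \<epsilon>\<close>.\<close>

locale contracting_graph = bounded_graph +
  fixes q \<kappa> S c W \<theta> \<eta> C1 \<epsilon> \<delta> :: real
  assumes q: "q > 0" and S: "S \<ge> 0" and contr: "contractive q \<kappa> S"
    and c: "c > 0" and weights: "\<And>n v. (\<Sum>j\<le>n. c ^ j * num_saws E j v) \<le> W"
    and \<theta>: "0 < \<theta>" "\<theta> < 1"
    and C1: "C1 = 2 ^ \<Delta> * (1 + 3 * S * \<Delta>)"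
    and \<eta>: "0 < \<eta>" "\<eta> \<le> 1/2" "C1 * \<eta> \<le> 1/2"
    and rate: "\<kappa> + (24 * C1 + 4) * \<Delta> * \<eta> \<le> \<theta> * c powr (1/q)"
    and \<epsilon>: "0 < \<epsilon>" "\<epsilon> * W powr (1/q) \<le> \<eta>"
    and \<delta>: "0 < \<delta>" "\<delta> \<le> \<eta>" "2 * 2 ^ \<Delta> * \<delta> \<le> (1 - \<theta>) * \<epsilon>"
begin

definition nearS :: "complex \<Rightarrow> bool" where
  "nearS s \<longleftrightarrow> (\<exists>s0. 0 \<le> s0 \<and> s0 \<le> S \<and> cmod (s - of_real s0) \<le> \<delta>)"

definition wq :: "nat \<Rightarrow> 'a set \<Rightarrow> 'a \<Rightarrow> real" where
  "wq n \<Lambda> v = wt c n \<Lambda> v powr (1/q)"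

lemma wq_bounds: assumes "v \<in> \<Lambda>" shows "1 \<le> wq n \<Lambda> v" "wq n \<Lambda> v \<le> W powr (1/q)"
proof -
  have "1 \<le> wt c n \<Lambda> v" using c assms by (intro wt_ge_1) auto
  then show "1 \<le> wq n \<Lambda> v" unfolding wq_def using q by (intro ge_one_powr_ge_zero) auto
  have "wt c n \<Lambda> v \<le> W" by (rule order_trans[OF wt_le weights]) (use c in auto)
  then show "wq n \<Lambda> v \<le> W powr (1/q)" unfolding wq_def using \<open>1 \<le> wt c n \<Lambda> v\<close> q
    by (intro powr_mono2) auto
qed

text \<open>The weights absorb the branching: the \<open>q\<close>-th powers of the errors sum to at
  most \<open>A powr q\<close> times the children's weights, which \<open>wt_children\<close> bounds
  by the weight of \<open>v\<close> over \<open>c\<close>. The resulting factor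
  \<open>1 / c powr (1/q)\<close> cancels against \<open>rate\<close>.\<close>

lemma contraction_step:
  assumes v: "v \<in> \<Lambda>" and A: "A \<ge> 0"
    and e: "\<And>i. i \<in> kids \<Lambda> v \<Longrightarrow> 0 \<le> e i \<and> e i \<le> A * wq n (child \<Lambda> v i) (nbs v ! i)"
  shows "(\<kappa> + (24 * C1 + 4) * \<Delta> * \<eta>) * (\<Sum>i\<in>kids \<Lambda> v. e i powr q) powr (1/q) \<le> \<theta> * A * wq (Suc n) \<Lambda> v"
proof -
  let ?w = "\<lambda>i. wt c n (child \<Lambda> v i) (nbs v ! i)"
  have w0: "?w i \<ge> 0" for i unfolding wt_def using c by (intro sum_nonneg) auto
  have "(\<Sum>i\<in>kids \<Lambda> v. e i powr q) \<le> (\<Sum>i\<in>kids \<Lambda> v. A powr q * ?w i)"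
  proof (rule sum_mono)
    fix i assume i: "i \<in> kids \<Lambda> v"
    have "e i powr q \<le> (A * wq n (child \<Lambda> v i) (nbs v ! i)) powr q"
      using e[OF i] q by (intro powr_mono2) auto
    also have "\<dots> = A powr q * ?w i" using A q w0[of i] by (simp add: wq_def powr_mult powr_powr)
    finally show "e i powr q \<le> A powr q * ?w i" .
  qed
  also have "\<dots> = A powr q * (\<Sum>i\<in>kids \<Lambda> v. ?w i)" by (simp add: sum_distrib_left)
  also have "\<dots> \<le> A powr q * (wt c (Suc n) \<Lambda> v / c)"
    using wt_children[of c v \<Lambda> n] c v by (intro mult_left_mono) (auto simp: field_simps)
  finally have "(\<Sum>i\<in>kids \<Lambda> v. e i powr q) powr (1/q) \<le> (A powr q * (wt c (Suc n) \<Lambda> v / c)) powr (1/q)"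
    using q by (intro powr_mono2) (auto intro: sum_nonneg)
  also have "\<dots> = A * wq (Suc n) \<Lambda> v / c powr (1/q)"
  proof -
    have "wt c (Suc n) \<Lambda> v \<ge> 0" unfolding wt_def using c by (intro sum_nonneg) auto
    then show ?thesis using A q c by (simp add: wq_def powr_mult powr_divide powr_powr)
  qed
  finally have *: "(\<Sum>i\<in>kids \<Lambda> v. e i powr q) powr (1/q) \<le> A * wq (Suc n) \<Lambda> v / c powr (1/q)" .
  have "(\<kappa> + (24 * C1 + 4) * \<Delta> * \<eta>) * (\<Sum>i\<in>kids \<Lambda> v. e i powr q) powr (1/q)
     \<le> (\<theta> * c powr (1/q)) * (\<Sum>i\<in>kids \<Lambda> v. e i powr q) powr (1/q)"
    using rate by (intro mult_right_mono) auto
  also have "\<dots> \<le> (\<theta> * c powr (1/q)) * (A * wq (Suc n) \<Lambda> v / c powr (1/q))"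
    using * \<theta> by (intro mult_left_mono) auto
  also have "\<dots> = \<theta> * A * wq (Suc n) \<Lambda> v" using c by simp
  finally show ?thesis .
qed

text \<open>The induction closes because \<open>\<theta> * \<epsilon> + (1 - \<theta>) * \<epsilon>
  = \<epsilon>\<close>: the first part comes from the children, and the second pays for the shift of
  \<open>s\<close>, the weights being at least 1. The induction hypothesis also keeps the children
  within \<eta>, as the contraction requires.\<close>

lemma msg_near_rmsg:
  assumes s0: "0 \<le> s0" "s0 \<le> S" and s: "cmod (s - of_real s0) \<le> \<delta>" and v: "v \<in> \<Lambda>"
  shows "cmod (msg n \<Lambda> v s - of_real (rmsg n \<Lambda> v s0)) \<le> \<epsilon> * wq n \<Lambda> v"
  using v
proof (induction n arbitrary: \<Lambda> v)
  case 0
  then show ?case using \<epsilon> wq_bounds[of v \<Lambda> 0] by simp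
next
  case (Suc n)
  define u where "u = (\<lambda>i. msg n (child \<Lambda> v i) (nbs v ! i) s)"
  define r where "r = (\<lambda>i. rmsg n (child \<Lambda> v i) (nbs v ! i) s0)"
  have IH: "cmod (u i - of_real (r i)) \<le> \<epsilon> * wq n (child \<Lambda> v i) (nbs v ! i)" if "i \<in> kids \<Lambda> v" for i
    unfolding u_def r_def by (rule Suc.IH[OF kid_in_child[OF that]])
  have near: "r i \<ge> 0 \<and> cmod (u i - of_real (r i)) \<le> \<eta>" if i: "i \<in> kids \<Lambda> v" for i
  proof -
    have "\<epsilon> * wq n (child \<Lambda> v i) (nbs v ! i) \<le> \<epsilon> * W powr (1/q)"
      using wq_bounds[OF kid_in_child[OF i]] \<epsilon> by (intro mult_left_mono) auto
    then have "cmod (u i - of_real (r i)) \<le> \<eta>" using IH[OF i] \<epsilon>(2) by linarith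
    then show ?thesis using rmsg_nonneg[OF s0(1)] by (simp add: r_def)
  qed
  have real: "complex_of_real (rmsg (Suc n) \<Lambda> v s0) = arsinh (of_real s0 * (\<Prod>i\<in>kids \<Lambda> v. inverse (cosh (complex_of_real (r i)))))"
  proof -
    have "of_real s0 * (\<Prod>i\<in>kids \<Lambda> v. inverse (cosh (complex_of_real (r i))))
      = complex_of_real (s0 * (\<Prod>i\<in>kids \<Lambda> v. inverse (cosh (r i))))"
      by (simp add: cosh_of_real)
    then show ?thesis by (simp only: arsinh_of_real rmsg.simps r_def)
  qed
  have "cmod (msg (Suc n) \<Lambda> v s - of_real (rmsg (Suc n) \<Lambda> v s0))
     \<le> (\<kappa> + (24 * C1 + 4) * \<Delta> * \<eta>) * (\<Sum>i\<in>kids \<Lambda> v. cmod (u i - of_real (r i)) powr q) powr (1/q) + 2 * 2 ^ \<Delta> * cmod (s - of_real s0)"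
    unfolding real msg.simps
    using message_lipschitz[OF contr q S finite_kids card_kids, of \<Lambda> v r "\<lambda>i. of_real (r i)" \<eta> r u s0 "of_real s0" s C1]
      near s0 s \<delta> \<eta> C1 by (simp add: u_def)
  also have "\<dots> \<le> \<theta> * \<epsilon> * wq (Suc n) \<Lambda> v + (1 - \<theta>) * \<epsilon> * wq (Suc n) \<Lambda> v"
  proof (rule add_mono)
    show "(\<kappa> + (24 * C1 + 4) * \<Delta> * \<eta>) * (\<Sum>i\<in>kids \<Lambda> v. cmod (u i - of_real (r i)) powr q) powr (1/q) \<le> \<theta> * \<epsilon> * wq (Suc n) \<Lambda> v"
      using IH \<epsilon> by (intro contraction_step Suc.prems) auto
    have "2 * 2 ^ \<Delta> * cmod (s - of_real s0) \<le> 2 * 2 ^ \<Delta> * \<delta>" using s by (intro mult_left_mono) auto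
    also have "\<dots> \<le> (1 - \<theta>) * \<epsilon> * 1" using \<delta> by simp
    also have "\<dots> \<le> (1 - \<theta>) * \<epsilon> * wq (Suc n) \<Lambda> v"
      using \<theta> \<epsilon> wq_bounds[OF Suc.prems, of "Suc n"] by (intro mult_left_mono) auto
    finally show "2 * 2 ^ \<Delta> * cmod (s - of_real s0) \<le> (1 - \<theta>) * \<epsilon> * wq (Suc n) \<Lambda> v" .
  qed
  finally show ?case by (simp add: algebra_simps)
qed

lemma msg_near:
  assumes s0: "0 \<le> s0" "s0 \<le> S" and s: "cmod (s - of_real s0) \<le> \<delta>" and v: "v \<in> \<Lambda>"
  shows "cmod (msg n \<Lambda> v s - of_real (rmsg n \<Lambda> v s0)) \<le> \<eta>"
proof -
  have "\<epsilon> * wq n \<Lambda> v \<le> \<epsilon> * W powr (1/q)"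
    using wq_bounds[OF v] \<epsilon> by (intro mult_left_mono) auto
  then show ?thesis using msg_near_rmsg[OF assms, of n] \<epsilon>(2) by linarith
qed

lemma msg_in_strip: assumes "nearS s" "v \<in> \<Lambda>" shows "msg n \<Lambda> v s \<in> strip"
proof -
  obtain s0 where "0 \<le> s0" "s0 \<le> S" "cmod (s - of_real s0) \<le> \<delta>" using assms(1) by (auto simp: nearS_def)
  from msg_near[OF this assms(2), of n] have "cmod (msg n \<Lambda> v s - of_real (rmsg n \<Lambda> v s0)) \<le> 1/2"
    using \<eta> by linarith
  then show ?thesis by (rule near_real_in_strip)
qed

lemma cosh_msg_nz: assumes "nearS s" "v \<in> \<Lambda>" shows "cosh (msg n \<Lambda> v s) \<noteq> 0"
  by (rule cosh_strip_nz[OF msg_in_strip[OF assms]])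

lemma Zpoly_nz: assumes "nearS s" "finite \<Lambda>" shows "Zpoly E \<Lambda> (s\<^sup>2) \<noteq> 0"
  using msg_exact[OF cosh_msg_nz[OF assms(1)] assms(2) order_refl] by blast

text \<open>Bounds the distance of any two messages at the same \<open>s\<close>: each is within
  \<eta> of a real message, and real messages lie between 0 and \<open>arsinh S\<close>.\<close>

definition M where "M = 2 * \<eta> + arsinh S"

lemma M_nonneg: "M \<ge> 0"
  using \<eta> arsinh_real_nonneg[OF S] by (simp add: M_def)

section \<open>Exponential decay of the influence of distant vertices\<close>

lemma kids_agree:
  assumes "\<Lambda> \<inter> gball E (Suc r) v = \<Lambda>' \<inter> gball E (Suc r) v"
  shows "kids \<Lambda> v = kids \<Lambda>' v"
proof -
  have "u \<in> \<Lambda> \<longleftrightarrow> u \<in> \<Lambda>'" if "E v u" for u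
    using assms gball_step[where E=E and v=v and u=u and r=r, OF that] gball_self[of u E r] by blast
  then show ?thesis using nbs_adj by (auto simp: kids_def)
qed

lemma child_agree:
  assumes "\<Lambda> \<inter> gball E (Suc r) v = \<Lambda>' \<inter> gball E (Suc r) v" "i \<in> kids \<Lambda> v"
  shows "child \<Lambda> v i \<inter> gball E r (nbs v ! i) = child \<Lambda>' v i \<inter> gball E r (nbs v ! i)"
proof -
  have "E v (nbs v ! i)" using assms(2) nbs_adj by (auto simp: kids_def)
  from gball_step[where E=E and v=v and r=r, OF this] show ?thesis using assms(1) by (auto simp: child_def)
qed

text \<open>Each level gains a factor \<theta> and uses up one unit of radius; at radius 0 only the
  trivial bound \<open>M\<close> is left. Since \<open>s\<close> is the same on both sides, no
  source term appears. The depths \<open>n\<close> and \<open>m\<close> may differ, so truncation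
  counts as just another distant disagreement.\<close>

lemma msg_decay:
  assumes s: "nearS s" and v: "v \<in> \<Lambda>" "v \<in> \<Lambda>'"
    and agree: "\<Lambda> \<inter> gball E r v = \<Lambda>' \<inter> gball E r v" and nm: "r \<le> n" "r \<le> m"
  shows "cmod (msg n \<Lambda> v s - msg m \<Lambda>' v s) \<le> M * \<theta> ^ r * wq n \<Lambda> v"
  using v agree nm
proof (induction r arbitrary: n m \<Lambda> \<Lambda>' v)
  case 0
  obtain s0 where s0: "0 \<le> s0" "s0 \<le> S" "cmod (s - of_real s0) \<le> \<delta>" using s by (auto simp: nearS_def)
  let ?a = "rmsg n \<Lambda> v s0" and ?b = "rmsg m \<Lambda>' v s0"
  have "cmod (of_real ?a - of_real ?b) = \<bar>?a - ?b\<bar>"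
    unfolding of_real_diff[symmetric] by (rule norm_of_real)
  also have "\<dots> \<le> arsinh S"
    using rmsg_nonneg[OF s0(1), of n \<Lambda> v] rmsg_nonneg[OF s0(1), of m \<Lambda>' v]
      rmsg_le[OF s0(1,2), of n \<Lambda> v] rmsg_le[OF s0(1,2), of m \<Lambda>' v] by linarith
  finally have ab: "cmod (of_real ?a - of_real ?b) \<le> arsinh S" .
  have "cmod (msg n \<Lambda> v s - msg m \<Lambda>' v s) \<le> M"
    using msg_near[OF s0 0(1), of n] msg_near[OF s0 0(2), of m] ab unfolding M_def by norm
  also have "\<dots> \<le> M * wq n \<Lambda> v" using mult_left_mono[OF wq_bounds(1)[OF 0(1), of n] M_nonneg] by simp
  finally show ?case by simp
next
  case (Suc r)
  obtain s0 where s0: "0 \<le> s0" "s0 \<le> S" "cmod (s - of_real s0) \<le> \<delta>" using s by (auto simp: nearS_def)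
  obtain n' m' where nm: "n = Suc n'" "m = Suc m'" "r \<le> n'" "r \<le> m'"
    using Suc.prems(4,5) by (metis Suc_le_D Suc_le_mono)
  define u where "u = (\<lambda>i. msg n' (child \<Lambda> v i) (nbs v ! i) s)"
  define u' where "u' = (\<lambda>i. msg m' (child \<Lambda>' v i) (nbs v ! i) s)"
  define \<rho> where "\<rho> = (\<lambda>i. rmsg n' (child \<Lambda> v i) (nbs v ! i) s0)"
  define \<rho>' where "\<rho>' = (\<lambda>i. rmsg m' (child \<Lambda>' v i) (nbs v ! i) s0)"
  have k: "kids \<Lambda>' v = kids \<Lambda> v" by (rule kids_agree[OF Suc.prems(3), symmetric])
  have mem: "nbs v ! i \<in> child \<Lambda> v i" "nbs v ! i \<in> child \<Lambda>' v i" if "i \<in> kids \<Lambda> v" for i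
    using kid_in_child[of i \<Lambda> v] kid_in_child[of i \<Lambda>' v] k that by auto
  have near: "\<rho> i \<ge> 0 \<and> cmod (u i - of_real (\<rho> i)) \<le> \<eta>" if "i \<in> kids \<Lambda> v" for i
    unfolding u_def \<rho>_def using msg_near[OF s0 mem(1)[OF that]] rmsg_nonneg[OF s0(1)] by blast
  have near': "\<rho>' i \<ge> 0 \<and> cmod (u' i - of_real (\<rho>' i)) \<le> \<eta>" if "i \<in> kids \<Lambda> v" for i
    unfolding u'_def \<rho>'_def using msg_near[OF s0 mem(2)[OF that]] rmsg_nonneg[OF s0(1)] by blast
  have "cmod (msg n \<Lambda> v s - msg m \<Lambda>' v s)
     \<le> (\<kappa> + (24 * C1 + 4) * \<Delta> * \<eta>) * (\<Sum>i\<in>kids \<Lambda> v. cmod (u i - u' i) powr q) powr (1/q) + 2 * 2 ^ \<Delta> * cmod (s - s)"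
    unfolding nm msg.simps k
    using message_lipschitz[OF contr q S finite_kids card_kids, of \<Lambda> v \<rho>' u' \<eta> \<rho> u s0 s s C1]
      near near' s0 \<delta> \<eta> C1 by (simp add: u_def u'_def)
  also have "\<dots> \<le> \<theta> * (M * \<theta> ^ r) * wq (Suc n') \<Lambda> v"
  proof -
    have "cmod (u i - u' i) \<le> M * \<theta> ^ r * wq n' (child \<Lambda> v i) (nbs v ! i)" if "i \<in> kids \<Lambda> v" for i
      unfolding u_def u'_def using mem[OF that] child_agree[OF Suc.prems(3) that] nm by (intro Suc.IH) auto
    then show ?thesis
      using contraction_step[OF Suc.prems(1), of "M * \<theta> ^ r" "\<lambda>i. cmod (u i - u' i)" n'] M_nonneg \<theta> by simp
  qed
  finally show ?case by (simp add: nm mult_ac)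
qed

definition H where "H = (2 * 2 ^ \<Delta>)\<^sup>2"

definition K where "K = 4 * 2 ^ \<Delta> * (6 * 2 ^ \<Delta> * (M * W powr (1/q)) + 6 * 2 ^ \<Delta> * (\<Delta> * (M * W powr (1/q))))"

lemma norm_density_le:
  assumes s: "nearS s" and fin: "finite \<Lambda>" and v: "v \<in> \<Lambda>"
  shows "cmod (local_density E \<Lambda> v (s\<^sup>2)) \<le> H"
proof -
  have "cmod (local_density E \<Lambda> v (s\<^sup>2)) = (cmod (inverse (cosh (msg (Suc (card \<Lambda>)) \<Lambda> v s))) *
     cmod (\<Prod>i\<in>kids \<Lambda> v. inverse (cosh (msg (card \<Lambda>) (child \<Lambda> v i) (nbs v ! i) s))))\<^sup>2"
    using density_eq[OF cosh_msg_nz[OF s] fin order_refl v] by (simp only: norm_power norm_mult)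
  also have "\<dots> \<le> (2 * 2 ^ \<Delta>)\<^sup>2"
  proof (intro power_mono mult_mono)
    show "cmod (inverse (cosh (msg (Suc (card \<Lambda>)) \<Lambda> v s))) \<le> 2"
      by (rule norm_sech_le[OF msg_in_strip[OF s v]])
    show "cmod (\<Prod>i\<in>kids \<Lambda> v. inverse (cosh (msg (card \<Lambda>) (child \<Lambda> v i) (nbs v ! i) s))) \<le> 2 ^ \<Delta>"
      by (rule sech_prod_norm_le[OF finite_kids card_kids msg_in_strip[OF s kid_in_child]])
  qed auto
  finally show ?thesis by (simp add: H_def)
qed

text \<open>Densities are squares, and a difference of squares is a sum, at most
  \<open>4 * 2 ^ \<Delta>\<close>, times a difference; this gives the shape of \<open>K\<close>.
  Agreement is required up to \<open>Suc r\<close> because the children's messages see one unit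
  less.\<close>

lemma density_decay:
  assumes s: "nearS s" and fin: "finite \<Lambda>" "finite \<Lambda>'" and v: "v \<in> \<Lambda>" "v \<in> \<Lambda>'"
    and agree: "\<Lambda> \<inter> gball E (Suc r) v = \<Lambda>' \<inter> gball E (Suc r) v"
  shows "cmod (local_density E \<Lambda> v (s\<^sup>2) - local_density E \<Lambda>' v (s\<^sup>2)) \<le> K * \<theta> ^ r"
proof -
  \<comment> \<open>Large enough for exactness on both domains and for the depth to exceed
    \<open>r\<close>.\<close>
  define n where "n = Suc r + card \<Lambda> + card \<Lambda>'"
  define a where "a = msg (Suc n) \<Lambda> v s"
  define a' where "a' = msg (Suc n) \<Lambda>' v s"
  define u where "u = (\<lambda>i. msg n (child \<Lambda> v i) (nbs v ! i) s)"
  define u' where "u' = (\<lambda>i. msg n (child \<Lambda>' v i) (nbs v ! i) s)"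
  define P where "P = (\<Prod>i\<in>kids \<Lambda> v. inverse (cosh (u i)))"
  define P' where "P' = (\<Prod>i\<in>kids \<Lambda> v. inverse (cosh (u' i)))"
  define B where "B = M * W powr (1/q) * \<theta> ^ r"
  have k: "kids \<Lambda>' v = kids \<Lambda> v" by (rule kids_agree[OF agree, symmetric])
  have B0: "B \<ge> 0" using M_nonneg \<theta> by (simp add: B_def)
  have mem: "nbs v ! i \<in> child \<Lambda> v i" "nbs v ! i \<in> child \<Lambda>' v i" if "i \<in> kids \<Lambda> v" for i
    using kid_in_child[of i \<Lambda> v] kid_in_child[of i \<Lambda>' v] k that by auto
  have st: "a \<in> strip" "a' \<in> strip" unfolding a_def a'_def using msg_in_strip[OF s] v by blast+
  have stu: "u i \<in> strip" "u' i \<in> strip" if "i \<in> kids \<Lambda> v" for i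
    unfolding u_def u'_def using msg_in_strip[OF s] mem[OF that] by blast+
  have d: "local_density E \<Lambda> v (s\<^sup>2) = (inverse (cosh a) * P)\<^sup>2" "local_density E \<Lambda>' v (s\<^sup>2) = (inverse (cosh a') * P')\<^sup>2"
    using density_eq[OF cosh_msg_nz[OF s], of \<Lambda> n v] density_eq[OF cosh_msg_nz[OF s], of \<Lambda>' n v] fin v k
    unfolding P_def P'_def a_def a'_def u_def u'_def by (auto simp: n_def simp del: msg.simps)
  have wB: "M * \<theta> ^ r * wq n' \<Lambda>0 v0 \<le> B" if "v0 \<in> \<Lambda>0" for n' \<Lambda>0 v0
    using mult_left_mono[OF wq_bounds(2)[OF that, of n'], of "M * \<theta> ^ r"] M_nonneg \<theta>
    by (simp add: B_def mult_ac)
  have aa: "cmod (a - a') \<le> B"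
  proof -
    have "cmod (a - a') \<le> M * \<theta> ^ Suc r * wq (Suc n) \<Lambda> v"
      unfolding a_def a'_def by (rule msg_decay[OF s v agree]) (auto simp: n_def)
    also have "\<dots> \<le> M * \<theta> ^ r * wq (Suc n) \<Lambda> v"
      using M_nonneg \<theta> wq_bounds(1)[OF v(1), of "Suc n"]
      by (intro mult_right_mono mult_left_mono power_decreasing) auto
    finally show ?thesis using wB[OF v(1), of "Suc n"] by simp
  qed
  have uu: "cmod (u i - u' i) \<le> B" if i: "i \<in> kids \<Lambda> v" for i
  proof -
    have "cmod (u i - u' i) \<le> M * \<theta> ^ r * wq n (child \<Lambda> v i) (nbs v ! i)"
      unfolding u_def u'_def
      by (rule msg_decay[OF s mem[OF i] child_agree[OF agree i]]) (auto simp: n_def)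
    then show ?thesis using wB[OF mem(1)[OF i], of n] by simp
  qed
  have "(\<Sum>i\<in>kids \<Lambda> v. cmod (u i - u' i)) \<le> real (card (kids \<Lambda> v)) * B"
    using uu by (intro sum_bounded_above) auto
  also have "\<dots> \<le> \<Delta> * B" using card_kids[of \<Lambda> v] B0 by (intro mult_right_mono) auto
  finally have sumu: "(\<Sum>i\<in>kids \<Lambda> v. cmod (u i - u' i)) \<le> \<Delta> * B" .
  have PP: "cmod (P - P') \<le> 2 ^ \<Delta> * 3 * (\<Delta> * B)"
  proof -
    have "cmod (P - P') \<le> 2 ^ \<Delta> * 3 * (\<Sum>i\<in>kids \<Lambda> v. cmod (u i - u' i))"
      unfolding P_def P'_def by (rule sech_prod_lipschitz[OF finite_kids card_kids stu])
    also have "\<dots> \<le> 2 ^ \<Delta> * 3 * (\<Delta> * B)" by (rule mult_left_mono[OF sumu]) simp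
    finally show ?thesis .
  qed
  have Pb: "cmod P \<le> 2 ^ \<Delta>" "cmod P' \<le> 2 ^ \<Delta>"
    unfolding P_def P'_def by (auto intro!: sech_prod_norm_le card_kids stu)
  let ?x = "inverse (cosh a) * P" and ?y = "inverse (cosh a') * P'"
  have nx: "cmod ?x \<le> 2 * 2 ^ \<Delta>" "cmod ?y \<le> 2 * 2 ^ \<Delta>"
    unfolding norm_mult using norm_sech_le[OF st(1)] norm_sech_le[OF st(2)] Pb by (auto intro!: mult_mono)
  have "?x - ?y = (inverse (cosh a) - inverse (cosh a')) * P + inverse (cosh a') * (P - P')"
    by (simp add: algebra_simps)
  then have "cmod (?x - ?y) \<le> cmod (inverse (cosh a) - inverse (cosh a')) * cmod P + cmod (inverse (cosh a')) * cmod (P - P')"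
    by (metis norm_triangle_ineq norm_mult)
  also have "\<dots> \<le> (6 * B) * 2 ^ \<Delta> + 2 * (2 ^ \<Delta> * 3 * (\<Delta> * B))"
  proof (intro add_mono mult_mono)
    show "cmod (inverse (cosh a) - inverse (cosh a')) \<le> 6 * B" using sech_lipschitz[OF st] aa by linarith
  qed (use Pb PP norm_sech_le[OF st(2)] B0 in auto)
  finally have xy: "cmod (?x - ?y) \<le> 6 * 2 ^ \<Delta> * B + 6 * 2 ^ \<Delta> * (\<Delta> * B)" by (simp add: mult_ac)
  have "?x\<^sup>2 - ?y\<^sup>2 = (?x + ?y) * (?x - ?y)" by (simp add: power2_eq_square algebra_simps)
  then have "cmod (?x\<^sup>2 - ?y\<^sup>2) = cmod (?x + ?y) * cmod (?x - ?y)" by (simp only: norm_mult)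
  also have "\<dots> \<le> (4 * 2 ^ \<Delta>) * (6 * 2 ^ \<Delta> * B + 6 * 2 ^ \<Delta> * (\<Delta> * B))"
    using nx xy norm_triangle_ineq[of ?x ?y] by (intro mult_mono) auto
  finally show ?thesis unfolding d K_def B_def by (simp add: algebra_simps)
qed

end

section \<open>Lattices and orbits\<close>

lemma relpowp_sym:
  assumes "\<And>u v. E u v \<Longrightarrow> E v u" and "(E ^^ k) u v"
  shows "(E ^^ k) v u"
  using assms(2)
proof (induction k arbitrary: v)
  case (Suc k)
  then obtain w where w: "(E ^^ k) u w" "E w v" by auto
  then show ?case using relpowp_Suc_I2[of E v w k u] Suc.IH[OF w(1)] assms(1) by blast
qed auto

lemma near_iff: "near E r v S \<longleftrightarrow> gball E r v \<inter> S \<noteq> {}"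
  by (auto simp: near_def gball_def)

lemma near_mono: assumes "r \<le> r'" "near E r v S" shows "near E r' v S"
proof -
  obtain u k where "u \<in> S" "k \<le> r" "(E ^^ k) v u" using assms(2) by (auto simp: near_def)
  then show ?thesis using assms(1) unfolding near_def by (meson order_trans)
qed

lemma bdry_mono: "r \<le> r' \<Longrightarrow> bdry E r S \<subseteq> bdry E r' S"
  by (auto simp: bdry_def intro: near_mono)

lemma gball_subset_if_not_bdry: "v \<in> S \<Longrightarrow> v \<notin> bdry E r S \<Longrightarrow> gball E r v \<subseteq> S"
  using gball_self[of v E r] unfolding bdry_def near_iff by blast

section \<open>Invariance under automorphisms\<close>

definition automorphism :: "('v \<Rightarrow> 'v \<Rightarrow> bool) \<Rightarrow> ('v \<Rightarrow> 'v) \<Rightarrow> bool" where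
  "automorphism E \<phi> \<longleftrightarrow> bij \<phi> \<and> (\<forall>u v. E u v \<longleftrightarrow> E (\<phi> u) (\<phi> v))"

lemma automorphism_relpowp:
  assumes "automorphism E \<phi>" shows "(E ^^ k) (\<phi> u) (\<phi> v) \<longleftrightarrow> (E ^^ k) u v"
proof (induction k arbitrary: v)
  case 0
  then show ?case using assms by (auto simp: automorphism_def bij_def inj_eq)
next
  case (Suc k)
  have inv: "E (\<phi> w) (\<phi> v) = E w v" for w using assms by (simp add: automorphism_def)
  have ex: "(\<exists>w. P w) \<longleftrightarrow> (\<exists>w. P (\<phi> w))" for P :: "'a \<Rightarrow> bool"
  proof -
    have "range \<phi> = UNIV" using assms by (simp add: automorphism_def bij_def)
    then show ?thesis by (metis rangeE UNIV_I)
  qed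
  have "(E ^^ Suc k) (\<phi> u) (\<phi> v) \<longleftrightarrow> (\<exists>w. (E ^^ k) (\<phi> u) w \<and> E w (\<phi> v))" by auto
  also have "\<dots> \<longleftrightarrow> (\<exists>w. (E ^^ k) (\<phi> u) (\<phi> w) \<and> E (\<phi> w) (\<phi> v))" by (rule ex)
  also have "\<dots> \<longleftrightarrow> (E ^^ Suc k) u v" by (simp only: Suc.IH inv) auto
  finally show ?case .
qed

lemma automorphism_gball:
  assumes "automorphism E \<phi>" shows "\<phi> ` gball E r v = gball E r (\<phi> v)"
proof (intro equalityI subsetI)
  fix x assume "x \<in> gball E r (\<phi> v)"
  moreover obtain y where "x = \<phi> y" using assms by (metis automorphism_def bij_def surj_def)
  ultimately show "x \<in> \<phi> ` gball E r v" by (auto simp: gball_def automorphism_relpowp[OF assms])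
qed (auto simp: gball_def automorphism_relpowp[OF assms])

lemma automorphism_Zpoly:
  assumes "automorphism E \<phi>" shows "Zpoly E (\<phi> ` \<Lambda>) z = Zpoly E \<Lambda> z"
proof -
  have inj: "inj \<phi>" using assms by (simp add: automorphism_def bij_def)
  have "indep_sets E (\<phi> ` \<Lambda>) = (`) \<phi> ` indep_sets E \<Lambda>"
  proof (intro equalityI subsetI)
    fix I assume I: "I \<in> indep_sets E (\<phi> ` \<Lambda>)"
    then have "I \<subseteq> \<phi> ` \<Lambda>" by (simp add: indep_sets_def)
    then obtain J where J: "J \<subseteq> \<Lambda>" "I = \<phi> ` J" by (meson subset_imageE)
    then have "J \<in> indep_sets E \<Lambda>" using I assms by (auto simp: indep_sets_def automorphism_def)
    then show "I \<in> (`) \<phi> ` indep_sets E \<Lambda>" using J by blast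
  next
    fix I assume "I \<in> (`) \<phi> ` indep_sets E \<Lambda>"
    then show "I \<in> indep_sets E (\<phi> ` \<Lambda>)" using assms by (auto simp: indep_sets_def automorphism_def)
  qed
  moreover have "inj_on ((`) \<phi>) (indep_sets E \<Lambda>)"
    using inj by (auto simp: inj_on_def inj_image_eq_iff)
  moreover have "card (\<phi> ` I) = card I" for I using inj by (intro card_image) (auto simp: inj_on_def)
  ultimately show ?thesis by (simp add: Zpoly_def sum.reindex)
qed

lemma automorphism_density:
  assumes "automorphism E \<phi>" shows "local_density E (\<phi> ` \<Lambda>) (\<phi> v) z = local_density E \<Lambda> v z"
proof -
  have "\<phi> ` \<Lambda> - insert (\<phi> v) {u. E (\<phi> v) u} = \<phi> ` (\<Lambda> - insert v {u. E v u})"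
    using assms by (auto simp: automorphism_def bij_def inj_eq)
  then show ?thesis by (simp add: local_density_def automorphism_Zpoly[OF assms])
qed

section \<open>The partition function near 0, its derivative and its logarithm\<close>

lemma Zpoly_at_0: assumes "finite \<Lambda>" shows "Zpoly E \<Lambda> 0 = 1"
proof -
  have fin: "finite (indep_sets E \<Lambda>)"
    using assms by (auto intro: finite_subset[of _ "Pow \<Lambda>"] simp: indep_sets_def)
  have "Zpoly E \<Lambda> 0 = (\<Sum>I\<in>indep_sets E \<Lambda>. if I = {} then 1 else 0)"
    unfolding Zpoly_def
  proof (rule sum.cong)
    fix I assume "I \<in> indep_sets E \<Lambda>"
    then have "finite I" using assms by (auto simp: indep_sets_def intro: finite_subset)
    then show "(0::complex) ^ card I = (if I = {} then 1 else 0)" by (auto simp: power_0_left)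
  qed simp
  also have "\<dots> = 1" using fin by (subst sum.delta) (auto simp: indep_sets_def)
  finally show ?thesis .
qed

text \<open>Double counting of pairs of an independent set \<open>I\<close> and a vertex
  \<open>v\<close> in it: the factor \<open>card I\<close> is spent on choosing \<open>v\<close>,
  and \<open>I - {v}\<close> avoids \<open>v\<close> and its neighbours.\<close>

lemma Zpoly_has_derivative:
  assumes "finite \<Lambda>" and sym: "\<And>u v. E u v \<Longrightarrow> E v u" and irrefl: "\<And>v. \<not> E v v"
  shows "(Zpoly E \<Lambda> has_field_derivative (\<Sum>v\<in>\<Lambda>. Zpoly E (\<Lambda> - insert v {u. E v u}) z)) (at z)"
proof -
  let ?S = "indep_sets E \<Lambda>"
  have fin: "finite ?S"
    using assms by (auto intro: finite_subset[of _ "Pow \<Lambda>"] simp: indep_sets_def)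
  have "(Zpoly E \<Lambda> has_field_derivative (\<Sum>I\<in>?S. of_nat (card I) * z ^ (card I - 1))) (at z)"
    unfolding Zpoly_def[abs_def] by (auto intro!: derivative_eq_intros sum.cong)
  also have "(\<Sum>I\<in>?S. of_nat (card I) * z ^ (card I - 1)) = (\<Sum>I\<in>?S. \<Sum>v\<in>\<Lambda>. if v \<in> I then z ^ (card I - 1) else 0)"
  proof (rule sum.cong)
    fix I assume "I \<in> ?S"
    then have "\<Lambda> \<inter> I = I" by (auto simp: indep_sets_def)
    then show "of_nat (card I) * z ^ (card I - 1) = (\<Sum>v\<in>\<Lambda>. if v \<in> I then z ^ (card I - 1) else 0)"
      using assms(1) by (simp add: sum.If_cases)
  qed simp
  also have "\<dots> = (\<Sum>v\<in>\<Lambda>. \<Sum>I\<in>?S. if v \<in> I then z ^ (card I - 1) else 0)" by (rule sum.swap)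
  also have "\<dots> = (\<Sum>v\<in>\<Lambda>. Zpoly E (\<Lambda> - insert v {u. E v u}) z)"
  proof (rule sum.cong)
    fix v assume v: "v \<in> \<Lambda>"
    let ?B = "indep_sets E (\<Lambda> - insert v {u. E v u})"
    have eq: "?S \<inter> {I. v \<in> I} = insert v ` ?B"
    proof (intro equalityI subsetI)
      fix I assume I: "I \<in> ?S \<inter> {I. v \<in> I}"
      then have "I - {v} \<in> ?B" by (auto simp: indep_sets_def)
      moreover have "I = insert v (I - {v})" using I by auto
      ultimately show "I \<in> insert v ` ?B" by blast
    qed (use v sym irrefl in \<open>auto simp: indep_sets_def\<close>)
    have inj: "inj_on (insert v) ?B" by (auto simp: inj_on_def indep_sets_def)
    have "(\<Sum>I\<in>?S. if v \<in> I then z ^ (card I - 1) else 0) = (\<Sum>I\<in>insert v ` ?B. z ^ (card I - 1))"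
      using fin by (simp add: sum.If_cases eq)
    also have "\<dots> = (\<Sum>I\<in>?B. z ^ card I)"
      unfolding sum.reindex[OF inj] o_def
    proof (rule sum.cong)
      fix I assume "I \<in> ?B"
      then have "finite I" "v \<notin> I" using assms(1) by (auto simp: indep_sets_def intro: finite_subset)
      then show "z ^ (card (insert v I) - 1) = z ^ card I" by simp
    qed simp
    finally show "(\<Sum>I\<in>?S. if v \<in> I then z ^ (card I - 1) else 0) = Zpoly E (\<Lambda> - insert v {u. E v u}) z"
      by (simp add: Zpoly_def)
  qed simp
  finally show ?thesis .
qed

text \<open>\<open>log_branch\<close> is defined by choice, so its value must be pinned down: two
  continuous logarithms differ by multiples of 2 pi i, a discrete set, hence by a constant on a
  connected \<open>D\<close>, and they agree at 0.\<close>

lemma log_branch_unique: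
  assumes D: "connected D" "0 \<in> D" and g: "continuous_on D g" "\<And>z. z \<in> D \<Longrightarrow> exp (g z) = h z" "g 0 = 0"
    and z: "z \<in> D"
  shows "log_branch D h z = g z"
proof -
  let ?P = "\<lambda>g. continuous_on D g \<and> (\<forall>z\<in>D. exp (g z) = h z) \<and> g 0 = 0"
  define l where "l = log_branch D h"
  have "?P g" using g by blast
  then have l: "?P l" unfolding l_def log_branch_def by (rule someI[where P = ?P])
  have "(\<lambda>z. l z - g z) constant_on D"
  proof (rule continuous_discrete_range_constant[OF D(1)])
    show "continuous_on D (\<lambda>z. l z - g z)" using l g by (intro continuous_intros) auto
    fix x assume x: "x \<in> D"
    have "2 * pi \<le> cmod (l y - g y - (l x - g x))" if y: "y \<in> D" "l y - g y \<noteq> l x - g x" for y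
    proof -
      have "exp (l y - g y) = exp (l x - g x)" using l g x y by (simp add: exp_diff) (metis exp_not_eq_zero)
      then obtain n :: int where n: "l y - g y = l x - g x + (of_int (2 * n) * pi) * \<i>"
        unfolding exp_eq by blast
      then have "n \<noteq> 0" using y by auto
      have "cmod (l y - g y - (l x - g x)) = 2 * \<bar>real_of_int n\<bar> * pi"
        unfolding n by (simp add: norm_mult)
      moreover have "\<bar>real_of_int n\<bar> \<ge> 1" using \<open>n \<noteq> 0\<close> by linarith
      ultimately show ?thesis by simp
    qed
    then show "\<exists>e>0. \<forall>y. y \<in> D \<and> l y - g y \<noteq> l x - g x \<longrightarrow> e \<le> cmod (l y - g y - (l x - g x))"
      by (intro exI[of _ "2 * pi"]) auto
  qed
  then obtain k where "\<And>z. z \<in> D \<Longrightarrow> l z - g z = k" by (auto simp: constant_on_def)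
  then have "l z - g z = l 0 - g 0" using D z by simp
  then show ?thesis using l g by (simp add: l_def)
qed

section \<open>Orbits of the lattice action and their equidistribution\<close>

locale crystal =
  fixes E :: "'v \<Rightarrow> 'v \<Rightarrow> bool" and d :: nat and act :: "(nat \<Rightarrow> int) \<Rightarrow> 'v \<Rightarrow> 'v"
  assumes sym: "E u v \<Longrightarrow> E v u" and irrefl: "\<not> E v v" and fin_nb: "finite {u. E v u}"
    and connected: "E\<^sup>*\<^sup>* u v"
    and action: "lattice_action E d act"
begin

lemma finite_gball: "finite (gball E r v)"
proof (induction r arbitrary: v)
  case 0
  have "gball E 0 v \<subseteq> {v}" by (auto simp: gball_def)
  then show ?case by (rule finite_subset) simp
next
  case (Suc r)
  have "gball E (Suc r) v \<subseteq> insert v (\<Union>u\<in>{u. E v u}. gball E r u)"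
  proof
    fix x assume "x \<in> gball E (Suc r) v"
    then obtain k where k: "k \<le> Suc r" "(E ^^ k) v x" by (auto simp: gball_def)
    show "x \<in> insert v (\<Union>u\<in>{u. E v u}. gball E r u)"
    proof (cases k)
      case 0
      then show ?thesis using k by simp
    next
      case (Suc k')
      then obtain u where "E v u" "(E ^^ k') u x" using k relpowp_Suc_D2 by metis
      then show ?thesis using k Suc by (auto simp: gball_def)
    qed
  qed
  then show ?case by (rule finite_subset) (use Suc fin_nb in auto)
qed

lemma finite_bdry: assumes "finite S" shows "finite (bdry E r S)"
proof -
  have "bdry E r S \<subseteq> (\<Union>u\<in>S. gball E r u)"
  proof
    fix x assume "x \<in> bdry E r S"
    then obtain u k where u: "u \<in> S" "k \<le> r" "(E ^^ k) x u" by (auto simp: bdry_def near_def)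
    then have "(E ^^ k) u x" using relpowp_sym[of E, OF sym] by blast
    then show "x \<in> (\<Union>u\<in>S. gball E r u)" using u by (auto simp: gball_def)
  qed
  then show ?thesis by (rule finite_subset) (use assms finite_gball in auto)
qed

lemma act_automorphism: "g \<in> Zd d \<Longrightarrow> automorphism E (act g)"
proof -
  have "\<forall>g\<in>Zd d. bij (act g) \<and> (\<forall>u v. E u v \<longleftrightarrow> E (act g u) (act g v))"
    using action unfolding lattice_action_def by (elim conjE)
  then show "g \<in> Zd d \<Longrightarrow> automorphism E (act g)" unfolding automorphism_def by (rule bspec)
qed

lemma act_add: "g \<in> Zd d \<Longrightarrow> h \<in> Zd d \<Longrightarrow> act (\<lambda>i. g i + h i) v = act g (act h v)"
proof -
  have "\<forall>g\<in>Zd d. \<forall>h\<in>Zd d. act (\<lambda>i. g i + h i) = act g \<circ> act h"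
    using action unfolding lattice_action_def by (elim conjE)
  then show "g \<in> Zd d \<Longrightarrow> h \<in> Zd d \<Longrightarrow> act (\<lambda>i. g i + h i) v = act g (act h v)" by simp
qed

lemma act_0: "act (\<lambda>_. 0) v = v"
proof -
  have "act (\<lambda>_. 0) = id" using action unfolding lattice_action_def by (elim conjE)
  then show ?thesis by simp
qed

lemma act_free:
  assumes "g \<in> Zd d" "h \<in> Zd d" "act g v = act h v" shows "g = h"
proof -
  have m: "(\<lambda>i. - h i) \<in> Zd d" using assms by (simp add: Zd_def)
  have dm: "(\<lambda>i. - h i + g i) \<in> Zd d" using assms by (simp add: Zd_def)
  have "act (\<lambda>i. - h i + g i) v = act (\<lambda>i. - h i + h i) v"
    using act_add[OF m assms(1)] act_add[OF m assms(2)] assms(3) by simp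
  then have "act (\<lambda>i. - h i + g i) v = v" by (simp add: act_0)
  moreover have "\<forall>g\<in>Zd d. \<forall>v. act g v = v \<longrightarrow> g = (\<lambda>_. 0)"
    using action unfolding lattice_action_def by (elim conjE)
  ultimately have "(\<lambda>i. - h i + g i) = (\<lambda>_. 0)" using dm by blast
  then have "- h i + g i = 0" for i by (rule fun_cong)
  then show ?thesis by (intro ext) (simp add: add_eq_0_iff)
qed

definition orbit :: "'v \<Rightarrow> 'v set" where
  "orbit v = (\<lambda>g. act g v) ` Zd d"

definition orbits :: "'v set set" where "orbits = range orbit"

lemma orbit_self: "v \<in> orbit v"
  unfolding orbit_def by (rule image_eqI[of _ _ "\<lambda>_. 0"]) (auto simp: act_0 Zd_def)

lemma orbit_eq: assumes "w \<in> orbit v" shows "orbit w = orbit v"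
proof -
  obtain g where g: "g \<in> Zd d" "w = act g v" using assms by (auto simp: orbit_def)
  show ?thesis
  proof (intro equalityI subsetI)
    fix x assume "x \<in> orbit w"
    then obtain h where h: "h \<in> Zd d" "x = act h w" by (auto simp: orbit_def)
    have "x = act (\<lambda>i. h i + g i) v" using g h by (simp add: act_add)
    moreover have "(\<lambda>i. h i + g i) \<in> Zd d" using g h by (simp add: Zd_def)
    ultimately show "x \<in> orbit v" by (simp add: orbit_def)
  next
    fix x assume "x \<in> orbit v"
    then obtain h where h: "h \<in> Zd d" "x = act h v" by (auto simp: orbit_def)
    have k: "(\<lambda>i. h i - g i) \<in> Zd d" using g h by (simp add: Zd_def)
    have "act (\<lambda>i. h i - g i) w = act (\<lambda>i. (h i - g i) + g i) v" using act_add[OF k g(1)] g by simp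
    then have "x = act (\<lambda>i. h i - g i) w" using h by simp
    then show "x \<in> orbit w" using k by (simp add: orbit_def)
  qed
qed

lemma finite_orbits: "finite orbits"
proof -
  obtain F where F: "finite F" "\<forall>v. \<exists>g\<in>Zd d. \<exists>u\<in>F. v = act g u"
    using action unfolding lattice_action_def by (elim conjE exE)
  have "orbits \<subseteq> orbit ` F"
  proof
    fix Q assume "Q \<in> orbits"
    then obtain v where v: "Q = orbit v" by (auto simp: orbits_def)
    obtain g u where "g \<in> Zd d" "u \<in> F" "v = act g u" using F(2) by blast
    then have "v \<in> orbit u" by (simp add: orbit_def)
    from orbit_eq[OF this] show "Q \<in> orbit ` F" using v \<open>u \<in> F\<close> by simp
  qed
  then show ?thesis using F(1) by (rule finite_surj[rotated])
qed

lemma orbits_ne: "orbits \<noteq> {}"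
  by (simp add: orbits_def)

text \<open>Sending \<open>act g u1\<close> to \<open>act g u2\<close> is injective because the
  action is free, and it moves every point along a walk of one fixed length \<open>r\<close>, since
  automorphisms preserve walks. A point of \<Lambda> whose image leaves \<Lambda> lies in the
  \<open>r\<close>-boundary.\<close>

lemma card_orbit_le:
  assumes "Q1 \<in> orbits" "Q2 \<in> orbits"
  shows "\<exists>r. \<forall>\<Lambda>. finite \<Lambda> \<longrightarrow> card (\<Lambda> \<inter> Q1) \<le> card (\<Lambda> \<inter> Q2) + card (bdry E r \<Lambda>)"
proof -
  obtain u1 u2 where u: "Q1 = orbit u1" "Q2 = orbit u2" using assms by (auto simp: orbits_def)
  obtain r where r: "(E ^^ r) u1 u2" using connected[of u1 u2] by (auto simp: rtranclp_power)
  define G where "G = (\<lambda>x. SOME g. g \<in> Zd d \<and> x = act g u1)"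
  have G: "G x \<in> Zd d \<and> x = act (G x) u1" if "x \<in> Q1" for x
  proof -
    have "\<exists>g. g \<in> Zd d \<and> x = act g u1" using that by (auto simp: u orbit_def)
    then show ?thesis unfolding G_def by (rule someI_ex)
  qed
  define \<phi> where "\<phi> = (\<lambda>x. act (G x) u2)"
  have inj: "inj_on \<phi> Q1"
  proof (rule inj_onI)
    fix x y assume xy: "x \<in> Q1" "y \<in> Q1" "\<phi> x = \<phi> y"
    then have "G x = G y" using act_free G unfolding \<phi>_def by blast
    then show "x = y" using G xy by metis
  qed
  have rel: "(E ^^ r) x (\<phi> x)" if "x \<in> Q1" for x
    using automorphism_relpowp[OF act_automorphism, of "G x" r u1 u2] G[OF that] r by (auto simp: \<phi>_def)
  show ?thesis
  proof (intro exI allI impI)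
    fix \<Lambda> :: "'v set" assume fin: "finite \<Lambda>"
    define A where "A = {x \<in> \<Lambda> \<inter> Q1. \<phi> x \<notin> \<Lambda>}"
    have "A \<subseteq> bdry E r \<Lambda>"
    proof
      fix x assume x: "x \<in> A"
      then have "near E r x \<Lambda>" using gball_self[of x E r] unfolding A_def near_iff by blast
      moreover have "near E r x (- \<Lambda>)" using x rel[of x] by (auto simp: A_def near_def)
      ultimately show "x \<in> bdry E r \<Lambda>" by (simp add: bdry_def)
    qed
    then have cA: "card A \<le> card (bdry E r \<Lambda>)" by (intro card_mono finite_bdry fin)
    have "card (\<Lambda> \<inter> Q1 - A) \<le> card (\<Lambda> \<inter> Q2)"
    proof (rule card_inj_on_le)
      show "inj_on \<phi> (\<Lambda> \<inter> Q1 - A)" using inj by (rule inj_on_subset) auto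
      show "\<phi> ` (\<Lambda> \<inter> Q1 - A) \<subseteq> \<Lambda> \<inter> Q2" using G by (auto simp: A_def \<phi>_def u orbit_def)
    qed (use fin in auto)
    moreover have "\<Lambda> \<inter> Q1 = (\<Lambda> \<inter> Q1 - A) \<union> A" by (auto simp: A_def)
    then have "card (\<Lambda> \<inter> Q1) \<le> card (\<Lambda> \<inter> Q1 - A) + card A" by (metis card_Un_le)
    ultimately show "card (\<Lambda> \<inter> Q1) \<le> card (\<Lambda> \<inter> Q2) + card (bdry E r \<Lambda>)" using cA by linarith
  qed
qed

lemma sum_orbits:
  assumes "finite \<Lambda>" shows "(\<Sum>v\<in>\<Lambda>. f v) = (\<Sum>Q\<in>orbits. \<Sum>v\<in>\<Lambda> \<inter> Q. f v)"
proof -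
  have "\<Lambda> = (\<Union>Q\<in>orbits. \<Lambda> \<inter> Q)" using orbit_self by (auto simp: orbits_def)
  then have "(\<Sum>v\<in>\<Lambda>. f v) = (\<Sum>v\<in>(\<Union>Q\<in>orbits. \<Lambda> \<inter> Q). f v)" by simp
  also have "\<dots> = (\<Sum>Q\<in>orbits. \<Sum>v\<in>\<Lambda> \<inter> Q. f v)"
  proof (rule sum.UNION_disjoint[OF finite_orbits])
    show "\<forall>i\<in>orbits. \<forall>j\<in>orbits. i \<noteq> j \<longrightarrow> \<Lambda> \<inter> i \<inter> (\<Lambda> \<inter> j) = {}"
      using orbit_eq by (auto simp: orbits_def) blast+
  qed (use assms in auto)
  finally show ?thesis .
qed

text \<open>Multiplied by the number of orbits, the deviation is a sum of pairwise comparisons; as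
  there are finitely many pairs, one radius \<open>R\<close> serves them all.\<close>

lemma orbits_equidistributed:
  "\<exists>R. \<forall>\<Lambda> Q. finite \<Lambda> \<longrightarrow> Q \<in> orbits \<longrightarrow>
    \<bar>real (card orbits) * real (card (\<Lambda> \<inter> Q)) - real (card \<Lambda>)\<bar> \<le> real (card orbits) * real (card (bdry E R \<Lambda>))"
proof -
  obtain k where k: "\<And>Q1 Q2 \<Lambda>. Q1 \<in> orbits \<Longrightarrow> Q2 \<in> orbits \<Longrightarrow> finite \<Lambda> \<Longrightarrow>
      card (\<Lambda> \<inter> Q1) \<le> card (\<Lambda> \<inter> Q2) + card (bdry E (k Q1 Q2) \<Lambda>)"
    using card_orbit_le by metis
  define R where "R = Max ((\<lambda>(Q1,Q2). k Q1 Q2) ` (orbits \<times> orbits))"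
  have kR: "k Q1 Q2 \<le> R" if "Q1 \<in> orbits" "Q2 \<in> orbits" for Q1 Q2
    unfolding R_def using that finite_orbits by (intro Max_ge) auto
  have le: "card (\<Lambda> \<inter> Q1) \<le> card (\<Lambda> \<inter> Q2) + card (bdry E R \<Lambda>)"
    if "Q1 \<in> orbits" "Q2 \<in> orbits" "finite \<Lambda>" for Q1 Q2 \<Lambda>
    using k[OF that] card_mono[OF finite_bdry[OF that(3)] bdry_mono[OF kR[OF that(1,2)], of E \<Lambda>]] by simp
  show ?thesis
  proof (intro exI[of _ R] allI impI)
    fix \<Lambda> :: "'v set" and Q assume fin: "finite \<Lambda>" and Q: "Q \<in> orbits"
    have "real (card \<Lambda>) = (\<Sum>Q'\<in>orbits. real (card (\<Lambda> \<inter> Q')))"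
      using sum_orbits[OF fin, of "\<lambda>_. 1::real"] by simp
    then have "\<bar>real (card orbits) * real (card (\<Lambda> \<inter> Q)) - real (card \<Lambda>)\<bar>
       = \<bar>\<Sum>Q'\<in>orbits. real (card (\<Lambda> \<inter> Q)) - real (card (\<Lambda> \<inter> Q'))\<bar>"
      by (simp add: sum_subtractf)
    also have "\<dots> \<le> (\<Sum>Q'\<in>orbits. \<bar>real (card (\<Lambda> \<inter> Q)) - real (card (\<Lambda> \<inter> Q'))\<bar>)" by (rule sum_abs)
    also have "\<dots> \<le> (\<Sum>Q'\<in>orbits. real (card (bdry E R \<Lambda>)))"
    proof (rule sum_mono)
      fix Q' assume "Q' \<in> orbits"
      then show "\<bar>real (card (\<Lambda> \<inter> Q)) - real (card (\<Lambda> \<inter> Q'))\<bar> \<le> real (card (bdry E R \<Lambda>))"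
        using le[OF Q _ fin, of Q'] le[OF _ Q fin, of Q'] by linarith
    qed
    finally show "\<bar>real (card orbits) * real (card (\<Lambda> \<inter> Q)) - real (card \<Lambda>)\<bar> \<le> real (card orbits) * real (card (bdry E R \<Lambda>))"
      by simp
  qed
qed

end

section \<open>The infinite-volume limit\<close>

text \<open>An interface that hides the messages and keeps zero-freeness, a uniform bound and
  exponential locality of the densities. Convexity of \<open>Om\<close> provides logarithms and
  primitives; its boundedness turns bounds on derivatives into bounds on functions.\<close>

locale crystal_density = crystal +
  fixes Om :: "complex set" and B H K \<theta> :: real
  assumes Om: "open Om" "convex Om" "0 \<in> Om" and Om_bound: "\<And>z. z \<in> Om \<Longrightarrow> cmod z \<le> B"
    and Z_nz: "\<And>\<Lambda> z. finite \<Lambda> \<Longrightarrow> z \<in> Om \<Longrightarrow> Zpoly E \<Lambda> z \<noteq> 0"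
    and density_le: "\<And>\<Lambda> v z. finite \<Lambda> \<Longrightarrow> v \<in> \<Lambda> \<Longrightarrow> z \<in> Om \<Longrightarrow> cmod (local_density E \<Lambda> v z) \<le> H"
    and decay: "\<And>\<Lambda> \<Lambda>' v r z. finite \<Lambda> \<Longrightarrow> finite \<Lambda>' \<Longrightarrow> v \<in> \<Lambda> \<Longrightarrow> v \<in> \<Lambda>' \<Longrightarrow> z \<in> Om \<Longrightarrow>
      \<Lambda> \<inter> gball E (Suc r) v = \<Lambda>' \<inter> gball E (Suc r) v \<Longrightarrow>
      cmod (local_density E \<Lambda> v z - local_density E \<Lambda>' v z) \<le> K * \<theta> ^ r"
    and \<theta>: "0 < \<theta>" "\<theta> < 1"
begin

abbreviation ball_density :: "nat \<Rightarrow> 'a \<Rightarrow> complex \<Rightarrow> complex" where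
  "ball_density r v z \<equiv> local_density E (gball E (Suc r) v) v z"

definition hlim :: "'a \<Rightarrow> complex \<Rightarrow> complex" where
  "hlim v z = lim (\<lambda>r. ball_density r v z)"

lemma H_nonneg: "H \<ge> 0"
  using density_le[of "{undefined}" undefined 0] Om(3) by (meson norm_ge_zero order_trans finite.intros singletonI)

lemma decay_null: "(\<lambda>r. C * (K * \<theta> ^ r)) \<longlonglongrightarrow> 0"
  using \<theta> by (intro tendsto_mult_right_zero LIMSEQ_realpow_zero) auto

lemma small_decay: assumes "e > 0" shows "\<exists>r. C * (K * \<theta> ^ r) < e"
  using eventually_happens[OF order_tendstoD(2)[OF decay_null assms, of C]] by auto

lemma density_ball_dist:
  assumes "finite \<Lambda>" "gball E (Suc r) v \<subseteq> \<Lambda>" "r \<le> r'" "z \<in> Om"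
  shows "cmod (local_density E \<Lambda> v z - ball_density r' v z) \<le> K * \<theta> ^ r"
proof (rule decay)
  show "v \<in> \<Lambda>" using assms(2) gball_self[of v E "Suc r"] by blast
  show "\<Lambda> \<inter> gball E (Suc r) v = gball E (Suc r') v \<inter> gball E (Suc r) v"
    using assms(2) gball_mono[of "Suc r" "Suc r'" E v] assms(3) by blast
qed (use assms finite_gball in auto)

lemma hlim_tendsto:
  assumes "z \<in> Om" shows "(\<lambda>r. ball_density r v z) \<longlonglongrightarrow> hlim v z"
proof -
  have "Cauchy (\<lambda>r. ball_density r v z)"
  proof (rule CauchyI)
    fix e :: real assume "e > 0"
    then obtain r where r: "K * \<theta> ^ r < e" using small_decay[of e 1] by auto
    have "cmod (ball_density m v z - ball_density n v z) < e" if "r \<le> m" "r \<le> n" for m n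
      using density_ball_dist[of "gball E (Suc m) v" r v n z] finite_gball gball_mono[of "Suc r" "Suc m" E v] that assms r
      by fastforce
    then show "\<exists>M. \<forall>m\<ge>M. \<forall>n\<ge>M. cmod (ball_density m v z - ball_density n v z) < e" by blast
  qed
  then have "convergent (\<lambda>r. ball_density r v z)" by (rule Cauchy_convergent)
  then show ?thesis unfolding hlim_def by (simp only: convergent_LIMSEQ_iff)
qed

lemma density_hlim_dist:
  assumes "finite \<Lambda>" "gball E (Suc r) v \<subseteq> \<Lambda>" "z \<in> Om"
  shows "cmod (local_density E \<Lambda> v z - hlim v z) \<le> K * \<theta> ^ r"
proof (rule LIMSEQ_le_const2)
  show "(\<lambda>r'. cmod (local_density E \<Lambda> v z - ball_density r' v z)) \<longlonglongrightarrow> cmod (local_density E \<Lambda> v z - hlim v z)"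
    by (intro tendsto_intros hlim_tendsto assms)
  show "\<exists>N. \<forall>n\<ge>N. cmod (local_density E \<Lambda> v z - ball_density n v z) \<le> K * \<theta> ^ r"
    using density_ball_dist[OF assms(1,2) _ assms(3)] by blast
qed

lemma hlim_le: assumes "z \<in> Om" shows "cmod (hlim v z) \<le> H"
proof (rule LIMSEQ_le_const2)
  show "(\<lambda>r. cmod (ball_density r v z)) \<longlonglongrightarrow> cmod (hlim v z)"
    by (intro tendsto_intros hlim_tendsto assms)
  show "\<exists>N. \<forall>n\<ge>N. cmod (ball_density n v z) \<le> H"
    using density_le[OF finite_gball gball_self assms] by blast
qed

text \<open>Already the ball densities agree: an automorphism maps balls to balls and preserves
  \<open>Zpoly\<close>.\<close>

lemma hlim_orbit: assumes "w \<in> orbit v" shows "hlim w z = hlim v z"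
proof -
  obtain g where g: "g \<in> Zd d" "w = act g v" using assms by (auto simp: orbit_def)
  note a = act_automorphism[OF g(1)]
  have "ball_density r w z = ball_density r v z" for r
    unfolding g(2) automorphism_gball[OF a, symmetric] by (rule automorphism_density[OF a])
  then show ?thesis by (simp add: hlim_def)
qed

lemma Zpoly_holomorphic: "Zpoly E \<Lambda> holomorphic_on A"
  unfolding Zpoly_def[abs_def] by (intro holomorphic_intros)

lemma hlim_holomorphic: "hlim v holomorphic_on Om"
proof (rule holomorphic_uniform_sequence[OF Om(1)])
  show "ball_density r v holomorphic_on Om" for r
    unfolding local_density_def using Z_nz finite_gball
    by (intro holomorphic_intros Zpoly_holomorphic) auto
  have ul: "uniform_limit Om (\<lambda>r. ball_density r v) (hlim v) sequentially"
  proof (rule uniform_limitI)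
    fix e :: real assume "e > 0"
    then have "\<forall>\<^sub>F r in sequentially. 1 * (K * \<theta> ^ r) < e" by (intro order_tendstoD(2)[OF decay_null])
    then show "\<forall>\<^sub>F r in sequentially. \<forall>z\<in>Om. dist (ball_density r v z) (hlim v z) < e"
    proof eventually_elim
      case (elim r)
      show ?case
      proof
        fix z assume "z \<in> Om"
        from density_hlim_dist[OF finite_gball order_refl this, of r v]
        show "dist (ball_density r v z) (hlim v z) < e" unfolding dist_norm using elim by linarith
      qed
    qed
  qed
  fix x assume "x \<in> Om"
  then obtain e where "e > 0" "cball x e \<subseteq> Om" using Om(1) open_contains_cball by blast
  then show "\<exists>d>0. cball x d \<subseteq> Om \<and> uniform_limit (cball x d) (\<lambda>r. ball_density r v) (hlim v) sequentially"
    using uniform_limit_on_subset[OF ul] by blast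
qed

definition rep :: "'a set \<Rightarrow> 'a" where "rep Q = (SOME v. v \<in> Q)"

lemma rep_in: "Q \<in> orbits \<Longrightarrow> rep Q \<in> Q"
  unfolding rep_def orbits_def using orbit_self someI_ex[of "\<lambda>v. v \<in> Q"] by blast

definition mean_density :: "complex \<Rightarrow> complex" where
  "mean_density z = (\<Sum>Q\<in>orbits. hlim (rep Q) z) / of_nat (card orbits)"

lemma card_orbits_pos: "card orbits > 0"
  using finite_orbits orbits_ne by (simp add: card_gt_0_iff)

lemma mean_density_holomorphic: "mean_density holomorphic_on Om"
  unfolding mean_density_def[abs_def] using card_orbits_pos by (intro holomorphic_intros hlim_holomorphic) auto

text \<open>Three errors: vertices whose ball of radius \<open>Suc r\<close> fits into \<Lambda> are
  within \<open>K * \<theta> ^ r\<close> of their limit, the other vertices cost at most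
  \<open>2 * H\<close> each, and the last term comes from unequal shares of the orbits.
  \<open>R\<close> depends on the lattice alone, so \<open>r\<close> may be chosen
  afterwards.\<close>

lemma average_density:
  "\<exists>R. \<forall>\<Lambda> r z. finite \<Lambda> \<longrightarrow> \<Lambda> \<noteq> {} \<longrightarrow> z \<in> Om \<longrightarrow>
    cmod ((\<Sum>v\<in>\<Lambda>. local_density E \<Lambda> v z) / of_nat (card \<Lambda>) - mean_density z)
      \<le> K * \<theta> ^ r + (2 * H * (real (card (bdry E (Suc r) \<Lambda>)) / real (card \<Lambda>))
          + card orbits * H * (real (card (bdry E R \<Lambda>)) / real (card \<Lambda>)))"
proof -
  obtain R where R: "\<And>\<Lambda> Q. finite \<Lambda> \<Longrightarrow> Q \<in> orbits \<Longrightarrow>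
    \<bar>real (card orbits) * real (card (\<Lambda> \<inter> Q)) - real (card \<Lambda>)\<bar> \<le> real (card orbits) * real (card (bdry E R \<Lambda>))"
    using orbits_equidistributed by blast
  show ?thesis
  proof (intro exI[of _ R] allI impI)
    fix \<Lambda> :: "'a set" and r z assume fin: "finite \<Lambda>" and ne: "\<Lambda> \<noteq> {}" and z: "z \<in> Om"
    define N where "N = real (card \<Lambda>)"
    define m where "m = real (card orbits)"
    define S where "S = (\<Sum>v\<in>\<Lambda>. local_density E \<Lambda> v z)"
    define T where "T = (\<Sum>v\<in>\<Lambda>. hlim v z)"
    let ?b = "bdry E (Suc r) \<Lambda>"
    have N0: "N > 0" using fin ne by (simp add: N_def card_gt_0_iff)
    have m0: "m > 0" using card_orbits_pos by (simp add: m_def)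
    have "cmod (S - T) \<le> (\<Sum>v\<in>\<Lambda>. K * \<theta> ^ r + (if v \<in> ?b then 2 * H else 0))"
      unfolding S_def T_def sum_subtractf[symmetric]
    proof (rule sum_norm_le)
      fix v assume v: "v \<in> \<Lambda>"
      have K0: "K * \<theta> ^ r \<ge> 0" using density_hlim_dist[OF finite_gball order_refl z, of r v] norm_ge_zero order_trans by blast
      show "cmod (local_density E \<Lambda> v z - hlim v z) \<le> K * \<theta> ^ r + (if v \<in> ?b then 2 * H else 0)"
      proof (cases "v \<in> ?b")
        case True
        have "cmod (local_density E \<Lambda> v z - hlim v z) \<le> H + H"
          using density_le[OF fin v z] hlim_le[OF z, of v] by (intro norm_triangle_le_diff add_mono)
        then show ?thesis using True K0 by simp
      next
        case False
        then show ?thesis using density_hlim_dist[OF fin gball_subset_if_not_bdry[OF v False] z] by simp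
      qed
    qed
    also have "\<dots> = N * (K * \<theta> ^ r) + 2 * H * real (card (\<Lambda> \<inter> ?b))"
      using fin by (simp add: sum.distrib sum.If_cases N_def)
    also have "\<dots> \<le> N * (K * \<theta> ^ r) + 2 * H * real (card ?b)"
      using H_nonneg card_mono[OF finite_bdry[OF fin], of "\<Lambda> \<inter> ?b"] by (intro add_left_mono mult_left_mono) auto
    finally have ST: "cmod (S - T) \<le> N * (K * \<theta> ^ r) + 2 * H * real (card ?b)" .
    have "T = (\<Sum>Q\<in>orbits. \<Sum>v\<in>\<Lambda> \<inter> Q. hlim v z)" unfolding T_def by (rule sum_orbits[OF fin])
    also have "\<dots> = (\<Sum>Q\<in>orbits. of_real (card (\<Lambda> \<inter> Q)) * hlim (rep Q) z)"
    proof (rule sum.cong)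
      fix Q assume Q: "Q \<in> orbits"
      have "hlim v z = hlim (rep Q) z" if "v \<in> Q" for v
      proof (rule hlim_orbit)
        obtain u where u: "Q = orbit u" using Q by (auto simp: orbits_def)
        then have "orbit (rep Q) = Q" using orbit_eq rep_in[OF Q] by blast
        then show "v \<in> orbit (rep Q)" using that by simp
      qed
      then show "(\<Sum>v\<in>\<Lambda> \<inter> Q. hlim v z) = of_real (card (\<Lambda> \<inter> Q)) * hlim (rep Q) z" by simp
    qed simp
    finally have "T - of_real N * mean_density z
       = (\<Sum>Q\<in>orbits. of_real (card (\<Lambda> \<inter> Q) - N / m) * hlim (rep Q) z)"
      by (simp add: mean_density_def m_def sum_distrib_left sum_divide_distrib sum_subtractf left_diff_distrib)
    also have "cmod \<dots> \<le> (\<Sum>Q\<in>orbits. real (card (bdry E R \<Lambda>)) * H)"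
    proof (rule sum_norm_le)
      fix Q assume Q: "Q \<in> orbits"
      have "m * \<bar>card (\<Lambda> \<inter> Q) - N / m\<bar> = \<bar>m * (card (\<Lambda> \<inter> Q) - N / m)\<bar>" using m0 by (simp add: abs_mult)
      also have "\<dots> = \<bar>m * card (\<Lambda> \<inter> Q) - N\<bar>" using m0 by (simp add: right_diff_distrib)
      also have "\<dots> \<le> m * card (bdry E R \<Lambda>)" using R[OF fin Q] by (simp add: m_def N_def)
      finally have "\<bar>card (\<Lambda> \<inter> Q) - N / m\<bar> \<le> card (bdry E R \<Lambda>)" using m0 by simp
      then show "cmod (of_real (card (\<Lambda> \<inter> Q) - N / m) * hlim (rep Q) z) \<le> real (card (bdry E R \<Lambda>)) * H"
        unfolding norm_mult norm_of_real using hlim_le[OF z] by (intro mult_mono) auto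
    qed
    also have "\<dots> = m * H * real (card (bdry E R \<Lambda>))" by (simp add: m_def)
    finally have TM: "cmod (T - of_real N * mean_density z) \<le> m * H * real (card (bdry E R \<Lambda>))" .
    have "S / of_real N - mean_density z = ((S - T) + (T - of_real N * mean_density z)) / of_real N"
      using N0 by (simp add: field_simps)
    then have "cmod (S / of_real N - mean_density z) = cmod ((S - T) + (T - of_real N * mean_density z)) / N"
      using N0 by (simp only: norm_divide norm_of_real abs_of_pos)
    also have "\<dots> \<le> (N * (K * \<theta> ^ r) + 2 * H * real (card ?b) + m * H * real (card (bdry E R \<Lambda>))) / N"
      using ST TM N0 by (intro divide_right_mono norm_triangle_le add_mono) auto
    also have "\<dots> = K * \<theta> ^ r + (2 * H * (real (card ?b) / N) + m * H * (real (card (bdry E R \<Lambda>)) / N))"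
      using N0 by (simp add: field_simps)
    finally show "cmod ((\<Sum>v\<in>\<Lambda>. local_density E \<Lambda> v z) / of_nat (card \<Lambda>) - mean_density z)
      \<le> K * \<theta> ^ r + (2 * H * (real (card (bdry E (Suc r) \<Lambda>)) / real (card \<Lambda>))
          + card orbits * H * (real (card (bdry E R \<Lambda>)) / real (card \<Lambda>)))"
      by (simp add: S_def N_def m_def)
  qed
qed

lemma log_Zpoly_exists:
  assumes fin: "finite \<Lambda>"
  shows "\<exists>g. g 0 = 0 \<and> (\<forall>z\<in>Om. exp (g z) = Zpoly E \<Lambda> z) \<and>
    (\<forall>z\<in>Om. (g has_field_derivative (\<Sum>v\<in>\<Lambda>. local_density E \<Lambda> v z)) (at z))"
proof -
  obtain g0 where g0: "g0 holomorphic_on Om" "\<And>z. z \<in> Om \<Longrightarrow> exp (g0 z) = Zpoly E \<Lambda> z"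
    using holomorphic_logarithm_exists[OF Om(2,1) Zpoly_holomorphic Z_nz[OF fin] Om(3)] by metis
  \<comment> \<open>The shift makes the logarithm vanish at 0 and does not affect
    \<open>exp\<close>, because \<open>Zpoly\<close> is 1 there.\<close>
  define g where "g = (\<lambda>z. g0 z - g0 0)"
  have "exp (g0 0) = 1" using g0(2)[OF Om(3)] Zpoly_at_0[OF fin, of E] by simp
  then have ex: "exp (g z) = Zpoly E \<Lambda> z" if "z \<in> Om" for z using g0(2)[OF that] by (simp add: g_def exp_diff)
  have "(g has_field_derivative (\<Sum>v\<in>\<Lambda>. local_density E \<Lambda> v z)) (at z)" if z: "z \<in> Om" for z
  proof -
    define g' where "g' = deriv g0 z"
    have g': "(g has_field_derivative g') (at z)"
      unfolding g_def g'_def using DERIV_diff[OF holomorphic_derivI[OF g0(1) Om(1) z] DERIV_const[of "g0 0"]] by simp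
    have "((\<lambda>z. exp (g z)) has_field_derivative exp (g z) * g') (at z)"
      by (rule DERIV_chain2[OF DERIV_exp g'])
    then have "(Zpoly E \<Lambda> has_field_derivative exp (g z) * g') (at z)"
      using ex has_field_derivative_transform_within_open[OF _ Om(1) z] by blast
    then have "exp (g z) * g' = (\<Sum>v\<in>\<Lambda>. Zpoly E (\<Lambda> - insert v {u. E v u}) z)"
      using Zpoly_has_derivative[where E=E, OF fin sym irrefl] DERIV_unique by blast
    then have "g' = (\<Sum>v\<in>\<Lambda>. local_density E \<Lambda> v z)"
      using Z_nz[OF fin z] ex[OF z] by (simp add: local_density_def sum_divide_distrib[symmetric] field_simps)
    then show ?thesis using g' by simp
  qed
  then show ?thesis using ex by (intro exI[of _ g]) (simp add: g_def)
qed

text \<open>The limit is the primitive of \<open>mean_density\<close> that vanishes at 0. As the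
  logarithms vanish there too, the bound on the derivatives integrates over segments in
  \<open>Om\<close> to one that is uniform on all of \<open>D\<close>, and restriction to compact
  subsets is immediate.\<close>

theorem free_energy_exists:
  assumes D: "D \<subseteq> Om" "connected D" "0 \<in> D"
  shows "free_energy_unique_analytic E D"
proof -
  obtain F0 where F0: "\<And>z. z \<in> Om \<Longrightarrow> (F0 has_field_derivative mean_density z) (at z within Om)"
    using holomorphic_convex_primitive'[OF Om(2,1) mean_density_holomorphic] by metis
  define F where "F = (\<lambda>z. F0 z - F0 0)"
  have F: "(F has_field_derivative mean_density z) (at z within Om)" if "z \<in> Om" for z
    unfolding F_def using DERIV_diff[OF F0[OF that] DERIV_const[of "F0 0"]] by simp
  have F_hol: "F holomorphic_on Om" unfolding holomorphic_on_def field_differentiable_def using F by blast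
  obtain R where R: "\<And>\<Lambda> r z. finite \<Lambda> \<Longrightarrow> \<Lambda> \<noteq> {} \<Longrightarrow> z \<in> Om \<Longrightarrow>
    cmod ((\<Sum>v\<in>\<Lambda>. local_density E \<Lambda> v z) / of_nat (card \<Lambda>) - mean_density z)
      \<le> K * \<theta> ^ r + (2 * H * (real (card (bdry E (Suc r) \<Lambda>)) / real (card \<Lambda>))
          + card orbits * H * (real (card (bdry E R \<Lambda>)) / real (card \<Lambda>)))"
    using average_density by blast
  have dist: "cmod (finite_free_energy E D \<Lambda> z - F z)
      \<le> B * (K * \<theta> ^ r) + B * (2 * H * (real (card (bdry E (Suc r) \<Lambda>)) / real (card \<Lambda>))
          + card orbits * H * (real (card (bdry E R \<Lambda>)) / real (card \<Lambda>)))"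
    if fin: "finite \<Lambda>" and ne: "\<Lambda> \<noteq> {}" and z: "z \<in> D" for \<Lambda> r z
  proof -
    obtain g where g: "g 0 = 0" "\<And>z. z \<in> Om \<Longrightarrow> exp (g z) = Zpoly E \<Lambda> z"
        "\<And>z. z \<in> Om \<Longrightarrow> (g has_field_derivative (\<Sum>v\<in>\<Lambda>. local_density E \<Lambda> v z)) (at z)"
      using log_Zpoly_exists[OF fin] by blast
    have "continuous_on Om g"
      using g(3) DERIV_isCont continuous_at_imp_continuous_on by blast
    then have "continuous_on D g" using D(1) continuous_on_subset by blast
    then have lb: "log_branch D (Zpoly E \<Lambda>) z = g z"
      using g D z by (intro log_branch_unique) auto
    define e where "e = K * \<theta> ^ r + (2 * H * (real (card (bdry E (Suc r) \<Lambda>)) / real (card \<Lambda>))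
          + card orbits * H * (real (card (bdry E R \<Lambda>)) / real (card \<Lambda>)))"
    define f where "f = (\<lambda>z. g z / of_nat (card \<Lambda>) - F z)"
    have "cmod (f z - f 0) \<le> e * cmod (z - 0)"
    proof (rule field_differentiable_bound[OF Om(2)])
      fix x assume x: "x \<in> Om"
      show "(f has_field_derivative (\<Sum>v\<in>\<Lambda>. local_density E \<Lambda> v x) / of_nat (card \<Lambda>) - mean_density x) (at x within Om)"
        unfolding f_def using F[OF x] has_field_derivative_at_within[OF g(3)[OF x], of Om]
        by (intro DERIV_diff DERIV_cdivide)
      show "cmod ((\<Sum>v\<in>\<Lambda>. local_density E \<Lambda> v x) / of_nat (card \<Lambda>) - mean_density x) \<le> e"
        unfolding e_def by (rule R[OF fin ne x])
    qed (use D z Om in auto)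
    moreover have "e \<ge> 0" using R[OF fin ne Om(3), of r] norm_ge_zero order_trans unfolding e_def by blast
    then have "e * cmod (z - 0) \<le> e * B" using Om_bound[of z] D z by (intro mult_left_mono) auto
    moreover have "f 0 = 0" by (simp add: f_def F_def g)
    ultimately have "cmod (f z) \<le> e * B" by simp
    then show ?thesis by (simp add: f_def finite_free_energy_def lb e_def algebra_simps)
  qed
  have conv: "uniform_limit D (\<lambda>n. finite_free_energy E D (\<Lambda>s n)) F sequentially"
    if fvh: "folner_van_hove E \<Lambda>s" for \<Lambda>s
  proof (rule uniform_limitI)
    fix e :: real assume e: "e > 0"
    then obtain r where r: "B * (K * \<theta> ^ r) < e / 2" using small_decay[of "e/2" B] by auto
    have fin: "finite (\<Lambda>s n)" for n using fvh by (simp add: folner_van_hove_def)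
    have "filterlim (\<lambda>n. card (\<Lambda>s n)) at_top sequentially" using fvh by (simp add: folner_van_hove_def)
    then have large: "\<forall>\<^sub>F n in sequentially. 1 \<le> card (\<Lambda>s n)" by (simp add: filterlim_at_top)
    have lim: "(\<lambda>n. real (card (bdry E r (\<Lambda>s n))) / real (card (\<Lambda>s n))) \<longlonglongrightarrow> 0" for r
      using fvh by (simp add: folner_van_hove_def)
    have "(\<lambda>n. B * (2 * H * (real (card (bdry E (Suc r) (\<Lambda>s n))) / real (card (\<Lambda>s n)))
          + card orbits * H * (real (card (bdry E R (\<Lambda>s n))) / real (card (\<Lambda>s n))))) \<longlonglongrightarrow> 0"
      by (intro tendsto_mult_right_zero tendsto_add_zero lim)
    then have "\<forall>\<^sub>F n in sequentially. B * (2 * H * (real (card (bdry E (Suc r) (\<Lambda>s n))) / real (card (\<Lambda>s n)))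
          + card orbits * H * (real (card (bdry E R (\<Lambda>s n))) / real (card (\<Lambda>s n)))) < e / 2"
      by (rule order_tendstoD(2)) (use e in simp)
    with large show "\<forall>\<^sub>F n in sequentially. \<forall>z\<in>D. dist (finite_free_energy E D (\<Lambda>s n) z) (F z) < e"
    proof eventually_elim
      case (elim n)
      then have ne: "\<Lambda>s n \<noteq> {}" by auto
      show ?case
      proof
        fix z assume "z \<in> D"
        from dist[OF fin ne this, of r] show "dist (finite_free_energy E D (\<Lambda>s n) z) (F z) < e"
          unfolding dist_norm using elim(2) r by linarith
      qed
    qed
  qed
  show ?thesis
    unfolding free_energy_unique_analytic_def
  proof (intro conjI exI[of _ F] allI impI ballI)
    show "Zpoly E \<Lambda> z \<noteq> 0" if "finite \<Lambda>" "z \<in> D" for \<Lambda> z using Z_nz that D by blast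
    have "interior D \<subseteq> Om" using D interior_subset by blast
    then show "F analytic_on interior D"
      using F_hol Om(1) by (meson analytic_on_open analytic_on_subset)
    fix \<Lambda>s Ks assume "folner_van_hove E \<Lambda>s" and "compact Ks \<and> Ks \<subseteq> interior D"
    then show "uniform_limit Ks (\<lambda>n. finite_free_energy E D (\<Lambda>s n)) F sequentially"
      using conv uniform_limit_on_subset interior_subset by (metis subset_trans)
  qed
qed

end

section \<open>Choice of parameters\<close>

text \<open>The degree is constant on each of the finitely many orbits.\<close>

lemma crystal_bounded_degree:
  assumes "crystal E d act"
  shows "\<exists>\<Delta>. bounded_graph E \<Delta>"
proof -
  interpret crystal E d act by fact
  obtain F where F: "finite F" "\<forall>v. \<exists>g\<in>Zd d. \<exists>u\<in>F. v = act g u"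
    using action unfolding lattice_action_def by (elim conjE exE)
  define \<Delta> where "\<Delta> = Max (insert 0 ((\<lambda>u. card {w. E u w}) ` F))"
  have "card {w. E v w} \<le> \<Delta>" for v
  proof -
    obtain g u where gu: "g \<in> Zd d" "u \<in> F" "v = act g u" using F(2) by blast
    have a: "bij (act g)" "\<And>x y. E (act g x) (act g y) \<longleftrightarrow> E x y"
      using act_automorphism[OF gu(1)] by (auto simp: automorphism_def)
    have "{w. E v w} = act g ` {w. E u w}"
    proof (intro equalityI subsetI)
      fix w assume w: "w \<in> {w. E v w}"
      obtain x where "w = act g x" using a(1) by (metis bij_pointE)
      then show "w \<in> act g ` {w. E u w}" using w a(2) gu by simp
    qed (use a(2) gu in auto)
    then have "card {w. E v w} = card {w. E u w}"
      using a(1) by (simp add: card_image bij_def inj_on_def)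
    also have "\<dots> \<le> \<Delta>" unfolding \<Delta>_def using F(1) gu(2) by (intro Max_ge) auto
    finally show ?thesis .
  qed
  then have "bounded_graph E \<Delta>" using sym irrefl fin_nb by unfold_locales auto
  then show ?thesis by blast
qed

context bounded_graph
begin

text \<open>Excludes the value infinity, on which \<open>real_of_ereal\<close> would be
  meaningless.\<close>

lemma connective_constant_le: "connective_constant E \<le> ereal \<Delta>"
  unfolding connective_constant_def
proof (rule Limsup_bounded)
  show "\<forall>\<^sub>F k in sequentially. sigma_k E k \<le> ereal \<Delta>"
    using eventually_gt_at_top[of 0]
  proof eventually_elim
    case (elim k)
    have "root k (real (num_saws E k v)) \<le> \<Delta>" for v
    proof -
      have "real (num_saws E k v) \<le> real \<Delta> ^ k"
        using num_saws_le[of k v] by (metis of_nat_le_iff of_nat_power)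
      then have "root k (real (num_saws E k v)) \<le> root k (real \<Delta> ^ k)" using elim by simp
      then show ?thesis using elim by (simp add: real_root_power_cancel)
    qed
    then show ?case unfolding sigma_k_def by (intro SUP_least) simp
  qed
qed

text \<open>\<open>sigma_k\<close> takes the supremum over the starting vertex before the limit, so
  from some \<open>k0\<close> on the bound \<open>\<rho> ^ k\<close> holds uniformly in
  \<open>v\<close>. The weights are then dominated by a geometric series up to finitely many terms,
  which the degree controls.\<close>

lemma saw_weights_bounded:
  fixes c \<rho> :: real
  assumes "connective_constant E < ereal \<rho>" "c > 0" "c * \<rho> < 1" "\<rho> > 0"
  shows "\<exists>W::real. \<forall>n v. (\<Sum>j\<le>n. c ^ j * num_saws E j v) \<le> W"
proof -
  have "\<forall>\<^sub>F k in sequentially. sigma_k E k < ereal \<rho>"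
    using assms(1) unfolding connective_constant_def by (rule Limsup_lessD)
  then obtain k0 where k0: "\<And>k. k \<ge> k0 \<Longrightarrow> sigma_k E k < ereal \<rho>"
    by (auto simp: eventually_sequentially)
  have big: "real (num_saws E k v) \<le> \<rho> ^ k" if k: "k \<ge> k0" "k > 0" for k v
  proof -
    have "ereal (root k (real (num_saws E k v))) \<le> sigma_k E k"
      unfolding sigma_k_def by (rule SUP_upper) simp
    also have "\<dots> < ereal \<rho>" by (rule k0[OF k(1)])
    finally have "root k (real (num_saws E k v)) \<le> \<rho>" by simp
    then have "root k (real (num_saws E k v)) ^ k \<le> \<rho> ^ k" using k by (intro power_mono) auto
    then show ?thesis using k by simp
  qed
  \<comment> \<open>The index 0 always falls under the degree bound: \<open>root 0\<close> is
    constantly 0 and carries no information.\<close>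
  define a where "a = (\<lambda>j. if j \<le> k0 then (c * \<Delta>) ^ j else (c * \<rho>) ^ j)"
  have "summable (\<lambda>j. (c * \<rho>) ^ j)" using assms by (intro summable_geometric) auto
  then have sa: "summable a"
  proof (rule summable_cong[THEN iffD1, rotated])
    show "\<forall>\<^sub>F j in sequentially. (c * \<rho>) ^ j = a j"
      using eventually_gt_at_top[of k0] by eventually_elim (simp add: a_def)
  qed
  have a0: "a j \<ge> 0" for j using assms by (simp add: a_def)
  have "(\<Sum>j\<le>n. c ^ j * num_saws E j v) \<le> suminf a" for n v
  proof -
    have "(\<Sum>j\<le>n. c ^ j * num_saws E j v) \<le> (\<Sum>j\<le>n. a j)"
    proof (rule sum_mono)
      fix j
      show "c ^ j * num_saws E j v \<le> a j"
      proof (cases "j \<le> k0")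
        case True
        have "real (num_saws E j v) \<le> real \<Delta> ^ j"
          using num_saws_le[of j v] by (metis of_nat_le_iff of_nat_power)
        then show ?thesis using True assms by (simp add: a_def power_mult_distrib)
      next
        case False
        then show ?thesis using big[of j v] assms by (simp add: a_def power_mult_distrib)
      qed
    qed
    also have "\<dots> \<le> suminf a" using a0 by (intro sum_le_suminf sa) auto
    finally show ?thesis .
  qed
  then show ?thesis by blast
qed

text \<open>\<theta> is the midpoint of \<open>\<kappa> / p\<close> and 1, which leaves the gap
  \<open>\<theta> * p - \<kappa>\<close>. \<open>X\<close> adds up everything whose product with
  \<eta> must be small, so that a single \<eta> meets all demands; \<epsilon> and \<delta> are then
  read off from their constraints.\<close>

lemma contracting_parameters:
  fixes c W :: real
  assumes q: "q > 0" and S: "S \<ge> 0" and contr: "contractive q \<kappa> S" and c: "c > 0"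
    and W: "\<And>n v. (\<Sum>j\<le>n. c ^ j * num_saws E j v) \<le> W"
    and \<kappa>: "0 < \<kappa>" "\<kappa> < c powr (1/q)"
  shows "\<exists>\<theta> \<eta> C1 \<epsilon> \<delta>. contracting_graph E \<Delta> q \<kappa> S c W \<theta> \<eta> C1 \<epsilon> \<delta>"
proof -
  define p where "p = c powr (1/q)"
  define \<theta> where "\<theta> = (1 + \<kappa> / p) / 2"
  define C1 where "C1 = 2 ^ \<Delta> * (1 + 3 * S * \<Delta>)"
  define X where "X = (24 * C1 + 4) * \<Delta> + 2 * C1 + 2"
  define \<eta> where "\<eta> = min 1 (\<theta> * p - \<kappa>) / X"
  define \<epsilon> where "\<epsilon> = \<eta> / W powr (1/q)"
  define \<delta> where "\<delta> = min \<eta> ((1 - \<theta>) * \<epsilon> / (2 * 2 ^ \<Delta>))"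
  have p: "p > 0" "\<kappa> < p" using c \<kappa> by (auto simp: p_def)
  have \<theta>: "0 < \<theta>" "\<theta> < 1" using p \<kappa> by (auto simp: \<theta>_def add_pos_pos)
  have gap: "\<theta> * p - \<kappa> > 0" using p by (simp add: \<theta>_def field_simps)
  have C10: "C1 \<ge> 0" using S by (simp add: C1_def)
  have X: "X \<ge> 2" "X \<ge> 2 * C1" "X \<ge> (24 * C1 + 4) * \<Delta>" using C10 by (auto simp: X_def)
  have \<eta>0: "\<eta> > 0" using gap X by (simp add: \<eta>_def)
  have \<eta>X: "X * \<eta> \<le> 1" "X * \<eta> \<le> \<theta> * p - \<kappa>" using X by (auto simp: \<eta>_def)
  have le: "Y * \<eta> \<le> X * \<eta>" if "Y \<le> X" for Y using that \<eta>0 by (intro mult_right_mono) auto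
  have "1 \<le> W"
  proof -
    have "saws E 0 undefined = {[undefined]}" by (auto simp: saws_def length_Suc_conv)
    then show ?thesis using W[where n=0 and v=undefined] by (simp add: num_saws_def)
  qed
  then have Wp: "W powr (1/q) > 0" by simp
  have \<epsilon>: "0 < \<epsilon>" "\<epsilon> * W powr (1/q) = \<eta>" using \<eta>0 Wp by (auto simp: \<epsilon>_def)
  have \<delta>: "0 < \<delta>" "\<delta> \<le> \<eta>" using \<eta>0 \<epsilon> \<theta> by (auto simp: \<delta>_def)
  have "\<delta> \<le> (1 - \<theta>) * \<epsilon> / (2 * 2 ^ \<Delta>)" by (simp add: \<delta>_def)
  then have \<delta>3: "2 * 2 ^ \<Delta> * \<delta> \<le> (1 - \<theta>) * \<epsilon>" by (simp add: field_simps)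
  have "contracting_graph E \<Delta> q \<kappa> S c W \<theta> \<eta> C1 \<epsilon> \<delta>"
  proof unfold_locales
    show "\<eta> \<le> 1/2" using le[OF X(1)] \<eta>X by linarith
    show "C1 * \<eta> \<le> 1/2" using le[OF X(2)] \<eta>X by linarith
    show "\<kappa> + (24 * C1 + 4) * \<Delta> * \<eta> \<le> \<theta> * c powr (1/q)"
      using le[OF X(3)] \<eta>X unfolding p_def[symmetric] by linarith
  qed (use q S contr c W \<theta> C1_def \<eta>0 \<epsilon> \<delta> \<delta>3 in auto)
  then show ?thesis by blast
qed

end

section \<open>Neighbourhoods of the interval and the final assembly\<close>

definition open_nbhd :: "real \<Rightarrow> real \<Rightarrow> complex set" where
  "open_nbhd lam \<delta> = {z. \<exists>t\<in>{0..lam}. cmod (z - of_real t) < \<delta>}"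

lemma open_nbhd: "open (open_nbhd lam \<delta>)"
proof -
  have "open_nbhd lam \<delta> = (\<Union>t\<in>{0..lam}. ball (of_real t) \<delta>)"
    by (auto simp: open_nbhd_def dist_norm norm_minus_commute)
  then show ?thesis by (simp add: open_UN)
qed

text \<open>\<open>P\<close> covers both \<open>< \<delta>\<close> and
  \<open>\<le> \<delta>\<close>: the open tube carries the holomorphic arguments, the closed one is
  the domain in the theorem.\<close>

lemma convex_tube:
  fixes P :: "real \<Rightarrow> bool"
  assumes P: "\<And>a b u v. P a \<Longrightarrow> P b \<Longrightarrow> 0 \<le> u \<Longrightarrow> 0 \<le> v \<Longrightarrow> u + v = 1 \<Longrightarrow> P (u * a + v * b)"
    and mono: "\<And>a b. P b \<Longrightarrow> a \<le> b \<Longrightarrow> P a"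
  shows "convex {z. \<exists>t\<in>{0..lam}. P (cmod (z - of_real t))}"
proof (rule convexI)
  fix x y u v assume "x \<in> {z. \<exists>t\<in>{0..lam}. P (cmod (z - of_real t))}" "y \<in> {z. \<exists>t\<in>{0..lam}. P (cmod (z - of_real t))}"
    and uv: "0 \<le> u" "0 \<le> v" "u + v = (1::real)"
  then obtain s t where s: "s \<in> {0..lam}" "P (cmod (x - of_real s))" and t: "t \<in> {0..lam}" "P (cmod (y - of_real t))"
    by auto
  have "u *\<^sub>R x + v *\<^sub>R y - of_real (u * s + v * t) = of_real u * (x - of_real s) + of_real v * (y - of_real t)"
    by (simp add: scaleR_conv_of_real algebra_simps)
  also have "cmod \<dots> \<le> u * cmod (x - of_real s) + v * cmod (y - of_real t)"
    using uv norm_triangle_ineq[of "of_real u * (x - of_real s)" "of_real v * (y - of_real t)"] by (simp add: norm_mult)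
  finally have "P (cmod (u *\<^sub>R x + v *\<^sub>R y - of_real (u * s + v * t)))"
    using P[OF s(2) t(2) uv] mono by blast
  moreover have "u * s + v * t \<in> {0..lam}"
    using convexD[of "{0..lam}" s t u v] s t uv by simp
  ultimately show "u *\<^sub>R x + v *\<^sub>R y \<in> {z. \<exists>t\<in>{0..lam}. P (cmod (z - of_real t))}" by blast
qed

lemma convex_open_nbhd: "convex (open_nbhd lam \<delta>)"
  unfolding open_nbhd_def
proof (rule convex_tube)
  fix a b u v :: real assume "a < \<delta>" "b < \<delta>" "0 \<le> u" "0 \<le> v" "u + v = 1"
  then show "u * a + v * b < \<delta>" by (rule convex_bound_lt)
qed auto

lemma convex_nbhd_interval: "convex (nbhd_interval lam \<delta>)"
  unfolding nbhd_interval_def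
proof (rule convex_tube)
  fix a b u v :: real assume "a \<le> \<delta>" "b \<le> \<delta>" "0 \<le> u" "0 \<le> v" "u + v = 1"
  then show "u * a + v * b \<le> \<delta>" by (rule convex_bound_le)
qed auto

text \<open>As \<open>Re s \<ge> 0\<close>, the point \<open>s\<close> is no farther from
  \<open>s0\<close> than from \<open>- s0\<close>, so the square of its distance to
  \<open>s0\<close> is at most the product of both distances, which is the distance from
  \<open>z\<close> to \<open>t\<close>. Hence radius \<delta> for \<open>s\<close> matches
  \<open>\<delta>\<^sup>2\<close> for \<open>z\<close>, even near 0 where the root is not
  Lipschitz.\<close>

lemma sqrt_near_interval:
  assumes "z \<in> open_nbhd lam (\<delta>\<^sup>2)" "\<delta> > 0"
  obtains s s0 where "s\<^sup>2 = z" "0 \<le> s0" "s0 \<le> sqrt lam" "cmod (s - of_real s0) \<le> \<delta>"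
proof -
  obtain t where t: "0 \<le> t" "t \<le> lam" "cmod (z - of_real t) < \<delta>\<^sup>2" using assms by (auto simp: open_nbhd_def)
  define s where "s = csqrt z"
  define s0 where "s0 = sqrt t"
  have "s0 \<ge> 0" "s0\<^sup>2 = t" using t by (auto simp: s0_def)
  have "Re s \<ge> 0" using csqrt_principal[of z] by (auto simp: s_def)
  have "cmod (s - of_real s0) \<le> cmod (s + of_real s0)"
  proof -
    have "\<bar>Re s - s0\<bar> \<le> \<bar>Re s + s0\<bar>" using \<open>Re s \<ge> 0\<close> \<open>s0 \<ge> 0\<close> by linarith
    then have "(Re s - s0)\<^sup>2 \<le> (Re s + s0)\<^sup>2" by (simp only: abs_le_square_iff)
    then show ?thesis by (simp add: cmod_def)
  qed
  then have "cmod (s - of_real s0) ^ 2 \<le> cmod (s - of_real s0) * cmod (s + of_real s0)"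
    unfolding power2_eq_square by (intro mult_left_mono) auto
  also have "\<dots> = cmod (s\<^sup>2 - of_real (s0\<^sup>2))"
    unfolding norm_mult[symmetric] by (simp add: power2_eq_square algebra_simps)
  also have "\<dots> = cmod (z - of_real t)" using \<open>s0\<^sup>2 = t\<close> by (simp add: s_def)
  finally have "cmod (s - of_real s0) ^ 2 \<le> \<delta>\<^sup>2" using t by linarith
  then have "cmod (s - of_real s0) \<le> \<delta>" using assms(2) by (rule power2_le_imp_le[OF _ less_imp_le])
  moreover have "s\<^sup>2 = z" by (simp add: s_def)
  moreover have "s0 \<le> sqrt lam" using t by (simp add: s0_def)
  ultimately show thesis using that \<open>s0 \<ge> 0\<close> by blast
qed

lemma (in contracting_graph) crystal_densityI:
  assumes "crystal E d act" and S: "S = sqrt lam" and lam: "lam \<ge> 0"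
  shows "crystal_density E d act (open_nbhd lam (\<delta>\<^sup>2)) (lam + \<delta>\<^sup>2) H K \<theta>"
proof -
  interpret crystal E d act by fact
  have ex: "\<exists>s. s\<^sup>2 = z \<and> nearS s" if z: "z \<in> open_nbhd lam (\<delta>\<^sup>2)" for z
  proof -
    obtain s s0 where s: "s\<^sup>2 = z" "0 \<le> s0" "s0 \<le> sqrt lam" "cmod (s - of_real s0) \<le> \<delta>"
      using sqrt_near_interval[OF z \<delta>(1)] .
    then have "nearS s" unfolding nearS_def using S by auto
    then show ?thesis using s(1) by blast
  qed
  show ?thesis
  proof unfold_locales
    show "open (open_nbhd lam (\<delta>\<^sup>2))" by (rule open_nbhd)
    show "convex (open_nbhd lam (\<delta>\<^sup>2))" by (rule convex_open_nbhd)
    show "0 \<in> open_nbhd lam (\<delta>\<^sup>2)" using lam \<delta>(1) by (auto simp: open_nbhd_def intro!: bexI[of _ 0])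
    show "cmod z \<le> lam + \<delta>\<^sup>2" if z: "z \<in> open_nbhd lam (\<delta>\<^sup>2)" for z
    proof -
      obtain t where t: "0 \<le> t" "t \<le> lam" "cmod (z - of_real t) < \<delta>\<^sup>2" using z by (auto simp: open_nbhd_def)
      have "cmod z \<le> cmod (z - of_real t) + cmod (of_real t)" by (metis diff_add_cancel norm_triangle_ineq)
      then show ?thesis using t by simp
    qed
    show "Zpoly E \<Lambda> z \<noteq> 0" if "finite \<Lambda>" "z \<in> open_nbhd lam (\<delta>\<^sup>2)" for \<Lambda> z
      using ex[OF that(2)] Zpoly_nz[OF _ that(1)] by blast
    show "cmod (local_density E \<Lambda> v z) \<le> H" if "finite \<Lambda>" "v \<in> \<Lambda>" "z \<in> open_nbhd lam (\<delta>\<^sup>2)" for \<Lambda> v z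
      using ex[OF that(3)] norm_density_le[OF _ that(1,2)] by blast
    show "cmod (local_density E \<Lambda> v z - local_density E \<Lambda>' v z) \<le> K * \<theta> ^ r"
      if "finite \<Lambda>" "finite \<Lambda>'" "v \<in> \<Lambda>" "v \<in> \<Lambda>'" "z \<in> open_nbhd lam (\<delta>\<^sup>2)"
        "\<Lambda> \<inter> gball E (Suc r) v = \<Lambda>' \<inter> gball E (Suc r) v" for \<Lambda> \<Lambda>' v r z
      using ex[OF that(5)] density_decay[OF _ that(1-4,6)] by blast
  qed (use \<theta> in auto)
qed

theorem theorem1p2:
  fixes E :: "'v \<Rightarrow> 'v \<Rightarrow> bool" and lam :: real
  assumes "infinite_lattice E"
    and "connective_constant E > 1"
    and "lam < lambda_c (real_of_ereal (connective_constant E))"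
  shows "\<exists>\<delta>>0. free_energy_unique_analytic E (nbhd_interval lam \<delta>)"
proof (cases "lam \<ge> 0")
  case False
  \<comment> \<open>For negative \<open>lam\<close> the interval is empty and every condition holds
    vacuously.\<close>
  then have "nbhd_interval lam 1 = {}" by (auto simp: nbhd_interval_def)
  then have "free_energy_unique_analytic E (nbhd_interval lam 1)"
    by (simp add: free_energy_unique_analytic_def analytic_on_def)
  then show ?thesis by (intro exI[of _ 1]) simp
next
  case True
  obtain d act where "lattice_action E d act"
    using assms(1) unfolding infinite_lattice_def by blast
  then have crystal: "crystal E d act"
    using assms(1) unfolding infinite_lattice_def crystal_def by blast
  obtain \<Delta> where "bounded_graph E \<Delta>" using crystal_bounded_degree[OF crystal] by blast
  then interpret bounded_graph E \<Delta> .
  define \<sigma> where "\<sigma> = real_of_ereal (connective_constant E)"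
  have \<sigma>: "connective_constant E = ereal \<sigma>"
    using assms(2) connective_constant_le unfolding \<sigma>_def
    by (cases "connective_constant E") auto
  then have \<sigma>1: "\<sigma> > 1" using assms(2) by simp
  obtain q \<kappa> where q: "q > 1" and \<kappa>: "\<kappa> > 0" "\<kappa> powr q * \<sigma> < 1" and contr: "contractive q \<kappa> (sqrt lam)"
    using hardcore_contraction[OF \<sigma>1 True] assms(3) unfolding \<sigma>_def by blast
  have "\<kappa> powr q < 1 / \<sigma>" using \<kappa> \<sigma>1 by (simp add: field_simps)
  \<comment> \<open>Above \<open>\<kappa> powr q\<close>, the weighted recursion contracts; below
    \<open>1 / \<sigma>\<close>, the series over walks stays bounded, with \<rho> as a growth rate
    strictly between \<sigma> and \<open>1 / c\<close>.\<close>
  then obtain c where c: "\<kappa> powr q < c" "c < 1 / \<sigma>" using dense by blast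
  have c0: "c > 0" using c(1) \<kappa>(1) powr_gt_zero[of \<kappa> q] by linarith
  have "\<sigma> < 1 / c" using c(2) c0 \<sigma>1 by (simp add: field_simps)
  then obtain \<rho> where \<rho>: "\<sigma> < \<rho>" "\<rho> < 1 / c" using dense by blast
  obtain W :: real where W: "\<And>n v. (\<Sum>j\<le>n. c ^ j * num_saws E j v) \<le> W"
    using saw_weights_bounded[of \<rho> c] \<sigma> \<rho> c0 \<sigma>1 by (auto simp: field_simps)
  have "\<kappa> = (\<kappa> powr q) powr (1/q)" using q \<kappa> by (simp add: powr_powr)
  also have "\<dots> < c powr (1/q)" using c(1) q \<kappa> by (intro powr_less_mono2) auto
  finally have \<kappa>c: "\<kappa> < c powr (1/q)" .
  obtain \<theta> \<eta> C1 \<epsilon> \<delta> where "contracting_graph E \<Delta> q \<kappa> (sqrt lam) c W \<theta> \<eta> C1 \<epsilon> \<delta>"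
    using contracting_parameters[OF _ _ contr c0 W \<kappa>(1) \<kappa>c] q True by auto
  then interpret contracting_graph E \<Delta> q \<kappa> "sqrt lam" c W \<theta> \<eta> C1 \<epsilon> \<delta> .
  interpret crystal_density E d act "open_nbhd lam (\<delta>\<^sup>2)" "lam + \<delta>\<^sup>2" H K \<theta>
    by (rule crystal_densityI[OF crystal refl True])
  \<comment> \<open>Half the radius puts the closed neighbourhood inside the open one.\<close>
  define D where "D = nbhd_interval lam (\<delta>\<^sup>2 / 2)"
  have pos: "\<delta>\<^sup>2 / 2 > 0" using \<delta>(1) by simp
  have "D \<subseteq> open_nbhd lam (\<delta>\<^sup>2)"
  proof
    fix z assume "z \<in> D"
    then obtain t where t: "t \<in> {0..lam}" "cmod (z - of_real t) \<le> \<delta>\<^sup>2 / 2"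
      unfolding D_def nbhd_interval_def by blast
    have "cmod (z - of_real t) < \<delta>\<^sup>2" using t(2) pos by linarith
    then show "z \<in> open_nbhd lam (\<delta>\<^sup>2)" unfolding open_nbhd_def using t(1) by blast
  qed
  moreover have "connected D" unfolding D_def by (intro convex_connected convex_nbhd_interval)
  moreover have "0 \<in> D" using True pos by (auto simp: D_def nbhd_interval_def intro!: bexI[of _ 0])
  ultimately have "free_energy_unique_analytic E D" by (rule free_energy_exists)
  then show ?thesis using pos unfolding D_def by blast
qed

end
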